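(* Let $\Phi(z)=\sum_{n\ge0}z^{2^n}$. Then, modulo $8$, \begin{align*} \sum_{n\ge0}s_{n+1}(SL_2(\mathbb Z))\,z^n={}&4z^{20}+4z^{17}+4z^{14}+4z^{12}+4z^{10}+4z^9+6z^8+4z^5+6z^4+4z^2+4z+6\\ &+\tfrac{7}{z^2}+\tfrac{3}{z^3}+\tfrac{6}{z^6}+\tfrac{6}{z^7}+\tfrac{4}{z^8}+\tfrac{1}{z^9}+\tfrac{3}{z^{11}}+\tfrac{6}{z^{12}}\\ &+\Big(4z^3+4z^2+\tfrac{4}{z}+\tfrac{6}{z^3}+\tfrac{6}{z^4}+\tfrac{6}{z^6}+\tfrac{2}{z^7}+\tfrac{4}{z^8}+\tfrac{4}{z^9}+\tfrac{4}{z^{10}}+\tfrac{6}{z^{12}}+\tfrac{2}{z^{13}}\Big)\Phi(z)\\ &+\Big(4z^8+4z^4+4z^3+6z^2+4+\tfrac{4}{z}+\tfrac{6}{z^2}+\tfrac{2}{z^3}+\tfrac{5}{z^4}+\tfrac{2}{z^5}\\ &\qquad+\tfrac{6}{z^6}+\tfrac{1}{z^7}+\tfrac{4}{z^8}+\tfrac{6}{z^9}+\tfrac{4}{z^{10}}+\tfrac{6}{z^{11}}+\tfrac{6}{z^{12}}+\tfrac{5}{z^{13}}\Big)\Phi^2(z)\\ &+\Big(4z^2+\tfrac{4}{z^2}+\tfrac{4}{z^3}+\tfrac{2}{z^4}+\tfrac{4}{z^5}+\tfrac{4}{z^6}+\tfrac{2}{z^7}+\tfrac{4}{z^9}+\tfrac{4}{z^{11}}+\tfrac{4}{z^{12}}+\tfrac{2}{z^{13}}\Big)\Phi^3(z).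 \end{align*}
   Context: For a finitely generated group $\Gamma$, $s_n(\Gamma)$ denotes the number of subgroups of index $n$ in $\Gamma$. For formal Laurent series with integer coefficients, an equality "modulo $M$" means that coefficients of equal powers of $z$ agree modulo $M$. $\Phi^i(z)$ denotes $(\Phi(z))^i$. *)

theory Defs
  imports
    "HOL-Analysis.Determinants"
    "HOL-Algebra.Coset"
    "HOL-Computational_Algebra.Formal_Laurent_Series"
    "HOL-Number_Theory.Cong"
begin

definition SL2Z :: "(int ^ 2 ^ 2) monoid" where
  "SL2Z = \<lparr>carrier = {A. det A = 1}, mult = (**), one = mat 1\<rparr>"

lemma group_SL2Z: "group SL2Z"
proof (rule groupI)
  fix A assume "A \<in> carrier SL2Z"
  then have A: "A$1$1 * A$2$2 - A$1$2 * A$2$1 = 1"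
    by (simp add: SL2Z_def det_2)
  define B :: "int ^ 2 ^ 2" where
    "B = (\<chi> i j. if i = 1 then (if j = 1 then A$2$2 else - A$1$2)
                 else (if j = 1 then - A$2$1 else A$1$1))"
  have "det B = 1"
    using A by (simp add: B_def det_2 algebra_simps)
  moreover have "B ** A = mat 1"
    using A by (simp add: B_def vec_eq_iff forall_2 matrix_matrix_mult_def mat_def
        sum_2 algebra_simps)
  ultimately show "\<exists>B\<in>carrier SL2Z. B \<otimes>\<^bsub>SL2Z\<^esub> A = \<one>\<^bsub>SL2Z\<^esub>"
    by (auto simp: SL2Z_def)
qed (auto simp: SL2Z_def det_mul matrix_mul_assoc)

text \<open>
  The number of subgroups of index \<open>n\<close>, for \<open>n \<ge> 1\<close>. As \<^const>\<open>card\<close> of an infinite set is \<open>0\<close>,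
  the inner \<^const>\<open>card\<close> admits only subgroups of genuinely finite index when \<open>n \<ge> 1\<close>; the outer one
  is the intended number when there are finitely many such subgroups, in particular whenever \<open>G\<close>
  is a finitely generated group.
\<close>
definition subgroup_count :: "('a, 'b) monoid_scheme \<Rightarrow> nat \<Rightarrow> nat" where
  "subgroup_count G n = card {H. subgroup H G \<and> card (rcosets\<^bsub>G\<^esub> H) = n}"

definition Phi_fps :: "int fps" where
  "Phi_fps = Abs_fps (\<lambda>m. if \<exists>n::nat. m = 2 ^ n then 1 else 0)"

lemma Phi_fps_sums: "(\<lambda>n::nat. fps_X ^ (2 ^ n)) sums Phi_fps"
  unfolding sums_def tendsto_fps_iff
proof
  fix m :: nat
  have "fps_nth (\<Sum>n<N. fps_X ^ (2 ^ n)) m = fps_nth Phi_fps m" if "N > m" for N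
  proof -
    have "(\<Sum>n<N. fps_nth (fps_X ^ (2 ^ n)) m :: int) = (\<Sum>n<N. if m = 2 ^ n then 1 else 0)"
      by (simp add: fps_X_power_nth)
    also have "\<dots> = (if \<exists>n::nat. m = 2 ^ n then 1 else 0)"
    proof (cases "\<exists>n::nat. m = 2 ^ n")
      case True
      then obtain k where k: "m = 2 ^ k" by blast
      have "k < N"
        using that k less_trans[OF less_exp[of k]] by blast
      then show ?thesis
        using k by simp
    qed auto
    finally show ?thesis
      by (simp add: Phi_fps_def fps_sum_nth)
  qed
  then show "\<forall>\<^sub>F N in sequentially. fps_nth (\<Sum>n<N. fps_X ^ (2 ^ n)) m = fps_nth Phi_fps m"
    by (intro eventually_sequentiallyI[of "Suc m"]) simp
qed

definition Phi :: "int fls" where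
  "Phi = fps_to_fls Phi_fps"

definition fls_cong :: "int fls \<Rightarrow> int fls \<Rightarrow> int \<Rightarrow> bool" where
  "fls_cong f g M \<longleftrightarrow> (\<forall>k. [fls_nth f k = fls_nth g k] (mod M))"

end

theory Submission
  imports Defs "HOL-Combinatorics.Cycles" "HOL-Combinatorics.Permutations"
begin

text \<open>
  As \<open>-I\<close> is central in \<open>SL\<^sub>2(Z)\<close>, the actions in which \<open>-I\<close> acts trivially and those in which it acts
  without fixed points each satisfy M. Hall's recurrence, so that the subgroups containing \<open>-I\<close>, and those
  not containing it, are counted by the logarithmic derivatives of the exponential generating functions \<open>P\<close>
  and \<open>Q\<close> of these two kinds of actions. By the presentation \<open>\<langle>S, U | S^4, S^2 = U^3\<rangle>\<close>, an action of the
  first kind is a pair of permutations with \<open>a^2 = b^3 = 1\<close>, and one of the second kind is a fixed point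
  free involution together with a square root and a cube root of it. The recurrences for the numbers of
  these objects give linear differential equations for \<open>P\<close> and \<open>Q\<close>, hence Riccati equations with integer
  coefficients for the logarithmic derivatives. Modulo 8 these have unique solutions, and the relations
  satisfied by \<open>\<Phi>\<close> show that explicit polynomials in \<open>\<Phi>\<close> solve them.
\<close>

section \<open>Actions of a group on finite sets\<close>

text \<open>Splitting by \<open>-I\<close> makes the generators independent: if \<open>-I\<close>
  acts trivially, \<open>a\<close> and \<open>b\<close> can be chosen separately, and otherwise they
  can once the involution \<open>z = a^2 = b^3\<close> is fixed. The counts thus become products of
  sequences with short linear recurrences. The passage to logarithmic derivatives is forced as well:
  \<open>P\<close> and \<open>Q\<close> have factorials in their denominators and cannot be reduced
  modulo 8, while their logarithmic derivatives have the numbers of subgroups as coefficients. The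
  relation for \<open>\<Phi>\<close> comes in two layers. Modulo 2 the series \<Phi>^2 + \<Phi> + z
  vanishes, so it is twice an integral series, and this half satisfies a quadratic relation modulo 2
  of its own. Calculations modulo 8 therefore use 1, p, e, pe, where p is a tail of \<Phi> and e the
  half belonging to it. In the solutions the coefficient of e is even and that of pe divisible by 4,
  so knowing e^2 modulo 2 is enough. As e is quadratic in p, this yields a cubic polynomial in
  \<Phi>; as p is \<Phi> without its first terms, divided by a power of z, negative powers of z
  appear.\<close>

text \<open>The value \<open>id\<close> outside the carrier makes every homomorphism into the
  permutations of \<open>A\<close> a single function, so that \<open>card\<close> counts
  homomorphisms. The family \<open>F\<close> of admissible stabilizers lets one recurrence serve
  both kinds of actions.\<close>

definition actions :: "('g, 'x) monoid_scheme \<Rightarrow> 'g set set \<Rightarrow> 'a set \<Rightarrow> ('g \<Rightarrow> 'a \<Rightarrow> 'a) set" where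
  "actions G F A = {\<phi>. (\<forall>g\<in>carrier G. \<phi> g permutes A) \<and> (\<forall>g. g \<notin> carrier G \<longrightarrow> \<phi> g = id) \<and>
     (\<forall>g\<in>carrier G. \<forall>h\<in>carrier G. \<phi> (g \<otimes>\<^bsub>G\<^esub> h) = \<phi> g \<circ> \<phi> h) \<and>
     (\<forall>x\<in>A. {g\<in>carrier G. \<phi> g x = x} \<in> F)}"

definition trans_actions :: "('g, 'x) monoid_scheme \<Rightarrow> 'g set set \<Rightarrow> 'a set \<Rightarrow> 'a \<Rightarrow> ('g \<Rightarrow> 'a \<Rightarrow> 'a) set" where
  "trans_actions G F A x0 = {\<phi>\<in>actions G F A. (\<lambda>g. \<phi> g x0) ` carrier G = A}"

definition restrict_perm :: "'a set \<Rightarrow> ('a \<Rightarrow> 'a) \<Rightarrow> 'a \<Rightarrow> 'a" where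
  "restrict_perm B f x = (if x \<in> B then f x else x)"

text \<open>Extensionality fixes the values outside \<open>A\<close>, so that \<open>card\<close>
  counts bijections between the two sets only.\<close>

definition pointed_bijections :: "'a set \<Rightarrow> 'b set \<Rightarrow> 'a \<Rightarrow> 'b \<Rightarrow> ('a \<Rightarrow> 'b) set" where
  "pointed_bijections A B a b = {f \<in> extensional A. bij_betw f A B \<and> f a = b}"

lemma restrict_perm_permutes:
  assumes "bij_betw f B B"
  shows "restrict_perm B f permutes B"
proof -
  have "bij_betw (restrict_perm B f) B B"
    using assms by (subst bij_betw_cong[of B _ f]) (auto simp: restrict_perm_def)
  then show ?thesis
    by (intro bij_imp_permutes) (auto simp: restrict_perm_def)
qed

lemma card_bijections:
  assumes "finite A" "finite B" "card A = card B"
  shows "card {f \<in> extensional A. bij_betw f A B} = fact (card A)"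
proof -
  have "{f \<in> extensional A. bij_betw f A B} = {f \<in> A \<rightarrow>\<^sub>E B. inj_on f A}"
    using assms by (auto simp: bij_betw_def PiE_def) (metis card_image card_subset_eq image_eqI
        image_subset_iff_funcset)
  moreover have "card {f \<in> A \<rightarrow>\<^sub>E B. inj_on f A} = fact (card A)"
    using card_inj_on_subset_funcset[of A B A] assms by (simp add: fact_prod_rev)
  ultimately show ?thesis by simp
qed

lemma card_pointed_bijections:
  assumes "finite A" "finite B" "card A = card B" "a \<in> A" "b \<in> B"
  shows "card (pointed_bijections A B a b) = fact (card A - 1)"
proof -
  have "bij_betw (\<lambda>f. restrict f (A - {a})) (pointed_bijections A B a b)
     {f \<in> extensional (A - {a}). bij_betw f (A - {a}) (B - {b})}"
  proof (rule bij_betwI[where g = "\<lambda>f. f(a := b)"], goal_cases)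
    case 1
    { fix f assume "f \<in> pointed_bijections A B a b"
      then have "bij_betw f A B" "f a = b" by (auto simp: pointed_bijections_def)
      then have "bij_betw f (A - {a}) (B - {b})"
        by (metis assms(4) bij_betw_DiffI bij_betw_singletonI empty_subsetI insert_subset bij_betwE)
      then have "bij_betw (restrict f (A - {a})) (A - {a}) (B - {b})"
        by (subst bij_betw_cong[of _ _ f]) auto }
    then show ?case by auto
  next
    case 2
    { fix f assume f: "f \<in> extensional (A - {a})" "bij_betw f (A - {a}) (B - {b})"
      have "bij_betw (f(a := b)) (A - {a}) (B - {b})"
        using f(2) by (subst bij_betw_cong[of _ _ f]) auto
      moreover have "bij_betw (f(a := b)) {a} {b}" by (auto simp: bij_betw_def)
      ultimately have "bij_betw (f(a := b)) ((A - {a}) \<union> {a}) ((B - {b}) \<union> {b})"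
        by (intro bij_betw_combine) auto
      then have "bij_betw (f(a := b)) A B" using assms
        by (simp add: insert_absorb)
      moreover have "f(a := b) \<in> extensional A" using f(1) assms(4) by (auto simp: extensional_def)
      ultimately have "f(a := b) \<in> pointed_bijections A B a b"
        by (auto simp: pointed_bijections_def) }
    then show ?case by auto
  qed (use assms in \<open>auto simp: pointed_bijections_def fun_eq_iff extensional_def restrict_def\<close>)
  then have "card (pointed_bijections A B a b) =
      card {f \<in> extensional (A - {a}). bij_betw f (A - {a}) (B - {b})}"
    by (rule bij_betw_same_card)
  also have "\<dots> = fact (card (A - {a}))"
    using assms by (intro card_bijections) auto
  finally show ?thesis using assms by simp
qed

section \<open>Elementary facts on actions and stabilizers\<close>

lemma actionsD:
  assumes "\<phi> \<in> actions G F A"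
  shows "g \<in> carrier G \<Longrightarrow> \<phi> g permutes A"
    and "g \<notin> carrier G \<Longrightarrow> \<phi> g = id"
    and "g \<in> carrier G \<Longrightarrow> h \<in> carrier G \<Longrightarrow> \<phi> (g \<otimes>\<^bsub>G\<^esub> h) x = \<phi> g (\<phi> h x)"
    and "x \<in> A \<Longrightarrow> {g\<in>carrier G. \<phi> g x = x} \<in> F"
    and "g \<in> carrier G \<Longrightarrow> x \<in> A \<Longrightarrow> \<phi> g x \<in> A"
  using assms permutes_in_image[of "\<phi> g" A x] by (auto simp: actions_def)

lemma (in group) action_one:
  assumes "\<phi> \<in> actions G F A"
  shows "\<phi> \<one> x = x"
proof -
  have "\<phi> \<one> (\<phi> \<one> x) = \<phi> \<one> x"
    using actionsD(3)[OF assms, of "\<one>" "\<one>" x] by simp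
  then show ?thesis
    using permutes_inj[OF actionsD(1)[OF assms one_closed]] by (auto dest: injD)
qed

lemma (in group) action_inv:
  assumes "\<phi> \<in> actions G F A" "g \<in> carrier G"
  shows "\<phi> (inv g) (\<phi> g x) = x" "\<phi> g (\<phi> (inv g) x) = x"
  using actionsD(3)[OF assms(1), of "inv g" g x] actionsD(3)[OF assms(1), of g "inv g" x]
    action_one[OF assms(1)] assms(2) by auto

lemma (in group) action_eq_iff:
  assumes "\<phi> \<in> actions G F A" "g \<in> carrier G" "h \<in> carrier G"
  shows "\<phi> g x = \<phi> h x \<longleftrightarrow> \<phi> (inv h \<otimes> g) x = x"
proof -
  have "\<phi> (inv h \<otimes> g) x = \<phi> (inv h) (\<phi> g x)"
    using actionsD(3)[OF assms(1)] assms by simp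
  then show ?thesis
    by (metis action_inv[OF assms(1,3)])
qed

lemma (in group) subgroup_stabilizer:
  assumes "\<phi> \<in> actions G F A"
  shows "subgroup {g\<in>carrier G. \<phi> g x = x} G"
proof (rule subgroupI)
  show "{g \<in> carrier G. \<phi> g x = x} \<noteq> {}"
    using action_one[OF assms] by blast
  fix g assume g: "g \<in> {g \<in> carrier G. \<phi> g x = x}"
  then show "inv g \<in> {g \<in> carrier G. \<phi> g x = x}"
    using action_inv(1)[OF assms, of g x] by auto
qed (auto simp: actionsD[OF assms])

lemma (in group) stabilizer_image:
  assumes "\<phi> \<in> actions G F A" "g \<in> carrier G"
  shows "{k\<in>carrier G. \<phi> k (\<phi> g x) = \<phi> g x} =
     (\<lambda>h. g \<otimes> h \<otimes> inv g) ` {h\<in>carrier G. \<phi> h x = x}" (is "?L = ?R")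
proof (intro equalityI subsetI)
  fix k assume k: "k \<in> ?L"
  then have "\<phi> (inv g \<otimes> k \<otimes> g) x = x"
    using assms actionsD(3)[OF assms(1)] action_inv[OF assms] by simp
  moreover have "k = g \<otimes> (inv g \<otimes> k \<otimes> g) \<otimes> inv g"
    using k assms by (simp add: m_assoc inv_solve_right) (simp add: m_assoc[symmetric])
  ultimately show "k \<in> ?R"
    using k assms by (intro image_eqI[where x = "inv g \<otimes> k \<otimes> g"]) auto
next
  fix k assume "k \<in> ?R"
  then show "k \<in> ?L"
    using assms actionsD(3)[OF assms(1)] action_inv[OF assms] by auto
qed

section \<open>Transitive actions and cosets\<close>

text \<open>The points of an orbit of a left action correspond to left cosets; inversion turns these
  into right cosets, so \<open>H #> x\<close> belongs to the point \<open>inv x\<close> applied to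
  \<open>x0\<close>. This is well defined because (hx)^-1 x0 = x^-1 x0 for h in \<open>H\<close>.
  The second claim disposes of the chosen representative.\<close>

lemma (in group) bij_betw_cosets_orbit:
  assumes \<phi>: "\<phi> \<in> trans_actions G F A x0" and A: "x0 \<in> A"
  defines "H \<equiv> {g\<in>carrier G. \<phi> g x0 = x0}"
  shows "bij_betw (\<lambda>g. \<phi> (inv (SOME x. x \<in> g)) x0) (rcosets H) A"
    and "x \<in> carrier G \<Longrightarrow> \<phi> (inv (SOME y. y \<in> H #> x)) x0 = \<phi> (inv x) x0"
proof -
  have act: "\<phi> \<in> actions G F A" and tr: "(\<lambda>g. \<phi> g x0) ` carrier G = A"
    using \<phi> by (auto simp: trans_actions_def)
  have sub: "subgroup H G" unfolding H_def by (rule subgroup_stabilizer[OF act])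
  show *: "\<phi> (inv (SOME y. y \<in> H #> x)) x0 = \<phi> (inv x) x0" if x: "x \<in> carrier G" for x
  proof -
    have "x \<in> H #> x" using rcos_self[OF x sub] .
    then have "(SOME y. y \<in> H #> x) \<in> H #> x" by (rule someI)
    then obtain h where h: "h \<in> H" "(SOME y. y \<in> H #> x) = h \<otimes> x"
      by (auto simp: r_coset_def)
    then have "inv h \<in> H" "h \<in> carrier G"
      using sub subgroup.m_inv_closed subgroup.mem_carrier by metis+
    then show ?thesis
      using x by (simp add: h inv_mult_group actionsD(3)[OF act]) (simp add: H_def)
  qed
  show "bij_betw (\<lambda>g. \<phi> (inv (SOME x. x \<in> g)) x0) (rcosets H) A"
    unfolding bij_betw_def
  proof
    show "inj_on (\<lambda>g. \<phi> (inv (SOME x. x \<in> g)) x0) (rcosets H)"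
    proof (rule inj_onI)
      fix C D assume "C \<in> rcosets H" "D \<in> rcosets H"
      then obtain c d where cd: "c \<in> carrier G" "d \<in> carrier G" "C = H #> c" "D = H #> d"
        by (auto simp: RCOSETS_def)
      assume "\<phi> (inv (SOME x. x \<in> C)) x0 = \<phi> (inv (SOME x. x \<in> D)) x0"
      then have "\<phi> (inv c) x0 = \<phi> (inv d) x0" using * cd by simp
      then have "d \<otimes> inv c \<in> H"
        using cd action_eq_iff[OF act, of "inv c" "inv d" x0] by (simp add: H_def)
      then have "d \<in> H #> c"
        using cd subgroup.rcos_module_rev[OF sub is_group] by auto
      then show "C = D" using cd repr_independence[OF _ _ sub] by metis
    qed
    have "(\<lambda>g. \<phi> (inv (SOME x. x \<in> g)) x0) ` (rcosets H) = (\<lambda>x. \<phi> (inv x) x0) ` carrier G"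
      using * by (auto simp: RCOSETS_def image_iff)
    also have "\<dots> = (\<lambda>x. \<phi> x x0) ` carrier G"
      by (force simp: image_iff intro: bexI[where x = "inv _"])
    finally show "(\<lambda>g. \<phi> (inv (SOME x. x \<in> g)) x0) ` (rcosets H) = A" using tr by simp
  qed
qed

lemma (in group) r_mult_bij_betw_rcosets:
  assumes H: "subgroup H G" and g: "g \<in> carrier G"
  shows "bij_betw (\<lambda>C. C #> g) (rcosets H) (rcosets H)"
proof (rule bij_betwI[where g = "\<lambda>C. C #> inv g"])
  have "C #> k \<in> rcosets H" if "C \<in> rcosets H" "k \<in> carrier G" for C k
    using that subgroup.subset[OF H] by (auto simp: RCOSETS_def coset_mult_assoc)
  then show "(\<lambda>C. C #> g) \<in> rcosets H \<rightarrow> rcosets H" "(\<lambda>C. C #> inv g) \<in> rcosets H \<rightarrow> rcosets H"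
    using g by auto
qed (use g subgroup.subset[OF H] in \<open>auto simp: RCOSETS_def coset_mult_assoc m_assoc\<close>)

text \<open>On right cosets g acts from the left by C |-> C g^-1; \<beta> transports this action to
  \<open>A\<close>.\<close>

definition coset_action :: "('g, 'x) monoid_scheme \<Rightarrow> 'g set \<Rightarrow> ('g set \<Rightarrow> 'a) \<Rightarrow> 'a set \<Rightarrow> 'g \<Rightarrow> 'a \<Rightarrow> 'a" where
  "coset_action G H \<beta> A g = (if g \<in> carrier G
     then restrict_perm A (\<lambda>y. \<beta> (inv_into (rcosets\<^bsub>G\<^esub> H) \<beta> y #>\<^bsub>G\<^esub> inv\<^bsub>G\<^esub> g)) else id)"

lemma (in group) coset_action_apply:
  assumes H: "subgroup H G" and \<beta>: "bij_betw \<beta> (rcosets H) A" and C: "C \<in> rcosets H" and g: "g \<in> carrier G"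
  shows "coset_action G H \<beta> A g (\<beta> C) = \<beta> (C #> inv g)"
  using assms bij_betwE[OF \<beta>] bij_betw_inv_into_left[OF \<beta> C]
  by (simp add: coset_action_def restrict_perm_def)

lemma (in group) coset_action_transitive:
  assumes H: "subgroup H G" "H \<in> F" and \<beta>: "\<beta> \<in> pointed_bijections (rcosets H) A H x0"
    and F: "\<And>H g. H \<in> F \<Longrightarrow> g \<in> carrier G \<Longrightarrow> (\<lambda>h. g \<otimes> h \<otimes> inv g) ` H \<in> F"
  shows "coset_action G H \<beta> A \<in> trans_actions G F A x0"
    and "{g\<in>carrier G. coset_action G H \<beta> A g x0 = x0} = H"
proof -
  let ?\<phi> = "coset_action G H \<beta> A"
  have bij: "bij_betw \<beta> (rcosets H) A" and x0: "\<beta> H = x0"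
    using \<beta> by (auto simp: pointed_bijections_def)
  have HH: "H \<in> rcosets H" using subgroup.subgroup_in_rcosets[OF H(1) is_group] .
  have sub: "C \<subseteq> carrier G" if "C \<in> rcosets H" for C
    using that r_coset_subset_G[OF subgroup.subset[OF H(1)]] by (auto simp: RCOSETS_def)
  have mult: "C #> g \<in> rcosets H" if "C \<in> rcosets H" "g \<in> carrier G" for C g
    using bij_betwE[OF r_mult_bij_betw_rcosets[OF H(1) that(2)]] that(1) by blast
  note app = coset_action_apply[OF H(1) bij]
  have perm: "?\<phi> g permutes A" if g: "g \<in> carrier G" for g
  proof -
    have "bij_betw (\<beta> \<circ> (\<lambda>C. C #> inv g) \<circ> inv_into (rcosets H) \<beta>) A A"
      using g H by (intro bij_betw_trans[OF bij_betw_inv_into[OF bij]]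
          bij_betw_trans[OF r_mult_bij_betw_rcosets bij]) auto
    then show ?thesis using g
      by (auto simp: coset_action_def o_def intro!: restrict_perm_permutes)
  qed
  have hom: "?\<phi> (g \<otimes> h) = ?\<phi> g \<circ> ?\<phi> h" if g: "g \<in> carrier G" "h \<in> carrier G" for g h
  proof
    fix y show "?\<phi> (g \<otimes> h) y = (?\<phi> g \<circ> ?\<phi> h) y"
    proof (cases "y \<in> A")
      case True
      then obtain C where C: "C \<in> rcosets H" "y = \<beta> C"
        using bij by (auto simp: bij_betw_def)
      then show ?thesis
        using g by (simp add: app mult inv_mult_group coset_mult_assoc sub)
    next
      case False
      then show ?thesis
        using g permutes_not_in[OF perm] by simp
    qed
  qed
  \<comment> \<open>The family is \<open>UNIV\<close> for now: that all stabilizers lie in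
    \<open>F\<close> follows only after they are recognized as conjugates of \<open>H\<close>, and
    this already uses the action.\<close>
  have act: "?\<phi> \<in> actions G UNIV A"
    using perm hom by (auto simp: actions_def coset_action_def[of G H \<beta> A])
  show stab: "{g\<in>carrier G. ?\<phi> g x0 = x0} = H"
  proof -
    have "?\<phi> g x0 = x0 \<longleftrightarrow> g \<in> H" if g: "g \<in> carrier G" for g
    proof -
      have "?\<phi> g x0 = x0 \<longleftrightarrow> \<beta> (H #> inv g) = \<beta> H"
        using app[OF HH g] x0 by simp
      also have "\<dots> \<longleftrightarrow> H #> inv g = H"
        using bij HH mult g by (auto simp: bij_betw_def dest: inj_onD)
      also have "\<dots> \<longleftrightarrow> inv g \<in> H"
        using g H coset_join1 coset_join2 by (metis inv_closed subgroup.subset)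
      also have "\<dots> \<longleftrightarrow> g \<in> H"
        using g H by (metis inv_inv subgroup.m_inv_closed)
      finally show ?thesis .
    qed
    then show ?thesis using H subgroup.subset by blast
  qed
  have tr: "(\<lambda>g. ?\<phi> g x0) ` carrier G = A"
  proof -
    have "(\<lambda>g. ?\<phi> g x0) ` carrier G = (\<lambda>g. \<beta> (H #> inv g)) ` carrier G"
      using app[OF HH] x0 by (intro image_cong) auto
    also have "\<dots> = \<beta> ` ((\<lambda>g. H #> g) ` (m_inv G ` carrier G))"
      by (simp add: image_image)
    also have "m_inv G ` carrier G = carrier G"
      by (force simp: image_iff intro: bexI[where x = "inv _"])
    also have "(\<lambda>g. H #> g) ` carrier G = rcosets H"
      by (auto simp: RCOSETS_def)
    also have "\<beta> ` (rcosets H) = A" using bij by (simp add: bij_betw_def)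
    finally show ?thesis .
  qed
  have "{g\<in>carrier G. ?\<phi> g x = x} \<in> F" if x: "x \<in> A" for x
  proof -
    have "x \<in> (\<lambda>g. ?\<phi> g x0) ` carrier G" by (subst tr) (rule x)
    then obtain g where "g \<in> carrier G" "x = ?\<phi> g x0" by blast
    then show ?thesis
      using stabilizer_image[OF act, of g x0] F[OF H(2), of g] stab by simp
  qed
  then have "?\<phi> \<in> actions G F A"
    using act unfolding actions_def by blast
  then show "?\<phi> \<in> trans_actions G F A x0"
    using tr unfolding trans_actions_def by blast
qed

text \<open>A transitive action with base point amounts to its stabilizer \<open>H\<close> together
  with the identification of the cosets of \<open>H\<close> with \<open>A\<close> that sends
  \<open>H\<close> to \<open>x0\<close>. For each \<open>H\<close> of index \<open>card A\<close>
  there are (card A - 1)! such identifications.\<close>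

lemma (in group) card_trans_actions:
  fixes A :: "'c set"
  assumes A: "finite A" "x0 \<in> A" and fin: "finite (actions G F A)"
    and F: "\<And>H g. H \<in> F \<Longrightarrow> g \<in> carrier G \<Longrightarrow> (\<lambda>h. g \<otimes> h \<otimes> inv g) ` H \<in> F"
  shows "finite {H\<in>F. subgroup H G \<and> card (rcosets H) = card A}"
    and "card (trans_actions G F A x0) =
      fact (card A - 1) * card {H\<in>F. subgroup H G \<and> card (rcosets H) = card A}"
proof -
  define \<H> where "\<H> = {H\<in>F. subgroup H G \<and> card (rcosets H) = card A}"
  define St where "St \<phi> = {g\<in>carrier G. \<phi> g x0 = x0}" for \<phi> :: "'a \<Rightarrow> 'c \<Rightarrow> 'c"
  define or where "or \<phi> = restrict (\<lambda>C. \<phi> (inv (SOME x. x \<in> C)) x0) (rcosets (St \<phi>))" for \<phi> :: "'a \<Rightarrow> 'c \<Rightarrow> 'c"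
  have cpos: "card A > 0" using A by (auto simp: card_gt_0_iff)
  have HH: "H \<in> rcosets H" if "subgroup H G" for H
    using subgroup.subgroup_in_rcosets[OF that is_group] .
  have or_app: "or \<phi> (St \<phi> #> g) = \<phi> (inv g) x0" if "\<phi> \<in> trans_actions G F A x0" "g \<in> carrier G" for \<phi> g
    using bij_betw_cosets_orbit(2)[OF that(1) A(2) that(2)] that subgroup_stabilizer[of \<phi> F A x0]
    by (auto simp: or_def St_def trans_actions_def intro!: rcosetsI subgroup.subset)
  have St: "subgroup (St \<phi>) G" if "\<phi> \<in> trans_actions G F A x0" for \<phi>
    using that subgroup_stabilizer[of \<phi> F A x0] by (auto simp: trans_actions_def St_def)
  have bij: "bij_betw (\<lambda>\<phi>. (St \<phi>, or \<phi>)) (trans_actions G F A x0)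
      (Sigma \<H> (\<lambda>H. pointed_bijections (rcosets H) A H x0))"
  proof (rule bij_betwI[where g = "\<lambda>(H, \<beta>). coset_action G H \<beta> A"])
    show "(\<lambda>\<phi>. (St \<phi>, or \<phi>)) \<in> trans_actions G F A x0 \<rightarrow>
      (SIGMA H:\<H>. pointed_bijections (rcosets H) A H x0)"
    proof
      fix \<phi> assume \<phi>: "\<phi> \<in> trans_actions G F A x0"
      then have act: "\<phi> \<in> actions G F A" by (simp add: trans_actions_def)
      have b: "bij_betw (or \<phi>) (rcosets (St \<phi>)) A"
        using bij_betw_cosets_orbit(1)[OF \<phi> A(2)]
        by (subst bij_betw_cong[where g = "\<lambda>C. \<phi> (inv (SOME x. x \<in> C)) x0"]) (auto simp: or_def St_def)
      have "or \<phi> (St \<phi>) = x0"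
        using or_app[OF \<phi>, of "\<one>"] action_one[OF act] coset_mult_one[OF subgroup.subset[OF St[OF \<phi>]]]
        by simp
      with b \<phi> show "(St \<phi>, or \<phi>) \<in> (SIGMA H:\<H>. pointed_bijections (rcosets H) A H x0)"
        using bij_betw_same_card[OF b] St[OF \<phi>] actionsD(4)[OF act A(2)]
        by (auto simp: pointed_bijections_def \<H>_def or_def St_def)
    qed
    show "(\<lambda>(H, \<beta>). coset_action G H \<beta> A) \<in>
        (SIGMA H:\<H>. pointed_bijections (rcosets H) A H x0) \<rightarrow> trans_actions G F A x0"
      using coset_action_transitive(1)[OF _ _ _ F] by (auto simp: \<H>_def)
    show "(case (St \<phi>, or \<phi>) of (H, \<beta>) \<Rightarrow> coset_action G H \<beta> A) = \<phi>" if \<phi>: "\<phi> \<in> trans_actions G F A x0" for \<phi>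
    proof -
      have act: "\<phi> \<in> actions G F A" using \<phi> by (simp add: trans_actions_def)
      have b: "bij_betw (or \<phi>) (rcosets (St \<phi>)) A"
        using bij_betw_cosets_orbit(1)[OF \<phi> A(2)]
        by (subst bij_betw_cong[where g = "\<lambda>C. \<phi> (inv (SOME x. x \<in> C)) x0"]) (auto simp: or_def St_def)
      have "coset_action G (St \<phi>) (or \<phi>) A g y = \<phi> g y" for g y
      proof (cases "g \<in> carrier G \<and> y \<in> A")
        case True
        then obtain k where k: "k \<in> carrier G" "y = \<phi> k x0"
          using \<phi> by (auto simp: trans_actions_def)
        have y: "y = or \<phi> (St \<phi> #> inv k)" using or_app[OF \<phi>, of "inv k"] k by simp
        have "coset_action G (St \<phi>) (or \<phi>) A g y = or \<phi> (St \<phi> #> inv k #> inv g)"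
          unfolding y using True k by (intro coset_action_apply[OF St[OF \<phi>] b])
            (auto intro!: rcosetsI subgroup.subset St \<phi>)
        also have "\<dots> = or \<phi> (St \<phi> #> inv (g \<otimes> k))"
          using True k subgroup.subset[OF St[OF \<phi>]] by (simp add: coset_mult_assoc inv_mult_group)
        also have "\<dots> = \<phi> g y"
          using True k or_app[OF \<phi>, of "inv (g \<otimes> k)"] actionsD(3)[OF act] by simp
        finally show ?thesis .
      next
        case False
        then show ?thesis
          using actionsD(1)[OF act, of g] actionsD(2)[OF act, of g]
          by (auto simp: coset_action_def restrict_perm_def permutes_not_in)
      qed
      then show ?thesis by (auto simp: fun_eq_iff)
    qed
    show "(\<lambda>\<phi>. (St \<phi>, or \<phi>)) (case p of (H, \<beta>) \<Rightarrow> coset_action G H \<beta> A) = p"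
      if pS: "p \<in> (SIGMA H:\<H>. pointed_bijections (rcosets H) A H x0)" for p
    proof -
      obtain H \<beta> where p: "p = (H, \<beta>)" "H \<in> F" "subgroup H G" "\<beta> \<in> pointed_bijections (rcosets H) A H x0"
        using pS by (auto simp: \<H>_def)
      note ct = coset_action_transitive[OF p(3,2,4) F]
      have St: "St (coset_action G H \<beta> A) = H" using ct(2) by (simp add: St_def)
      have bij: "bij_betw \<beta> (rcosets H) A" and x0: "\<beta> H = x0"
        using p(4) by (auto simp: pointed_bijections_def)
      have "or (coset_action G H \<beta> A) C = \<beta> C" for C
      proof (cases "C \<in> rcosets H")
        case True
        then obtain g where g: "g \<in> carrier G" "C = H #> g" by (auto simp: RCOSETS_def)
        have "or (coset_action G H \<beta> A) C = coset_action G H \<beta> A (inv g) x0"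
          using or_app[OF ct(1) g(1)] St g by simp
        also have "\<dots> = \<beta> C"
          using coset_action_apply[OF p(3) bij HH[OF p(3)], of "inv g"] g x0 by simp
        finally show ?thesis .
      next
        case False
        then show ?thesis using St p(4)
          by (auto simp: or_def pointed_bijections_def extensional_def)
      qed
      then show ?thesis using St p by (auto simp: fun_eq_iff)
    qed
  qed
  have fin': "finite (trans_actions G F A x0)"
    using fin by (rule finite_subset[rotated]) (auto simp: trans_actions_def)
  have finS: "finite (Sigma \<H> (\<lambda>H. pointed_bijections (rcosets H) A H x0))"
    using bij_betw_finite[OF bij] fin' by simp
  have cardp: "card (pointed_bijections (rcosets H) A H x0) = fact (card A - 1)" if "H \<in> \<H>" for H
  proof -
    \<comment> \<open>The index equals \<open>card A\<close>, which is positive, so the default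
      value 0 of \<open>card\<close> on infinite sets is excluded.\<close>
    have "finite (rcosets H)" using that cpos by (intro card_ge_0_finite) (auto simp: \<H>_def)
    then show ?thesis
      using card_pointed_bijections[of "rcosets H" A H x0] that A HH by (auto simp: \<H>_def)
  qed
  \<comment> \<open>Every fibre is nonempty, so the finite set of pairs projects onto all subgroups
    in question. Their finiteness thus comes from that of the set of actions.\<close>
  have "pointed_bijections (rcosets H) A H x0 \<noteq> {}" if "H \<in> \<H>" for H
    using cardp[OF that] by (metis card.empty fact_nonzero)
  then have "fst ` Sigma \<H> (\<lambda>H. pointed_bijections (rcosets H) A H x0) = \<H>"
    by (auto simp: fst_image_Sigma)
  with finite_imageI[OF finS, of fst] have fH: "finite \<H>" by simp
  then show "finite {H\<in>F. subgroup H G \<and> card (rcosets H) = card A}" by (simp add: \<H>_def)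
  have finp: "finite (pointed_bijections (rcosets H) A H x0)" if "H \<in> \<H>" for H
    by (rule card_ge_0_finite) (simp add: cardp[OF that])
  have "card (trans_actions G F A x0) = card (Sigma \<H> (\<lambda>H. pointed_bijections (rcosets H) A H x0))"
    using bij by (rule bij_betw_same_card)
  also have "\<dots> = (\<Sum>H\<in>\<H>. fact (card A - 1))"
    using fH finp by (simp add: card_SigmaI cardp)
  finally show "card (trans_actions G F A x0) =
      fact (card A - 1) * card {H\<in>F. subgroup H G \<and> card (rcosets H) = card A}"
    by (simp add: \<H>_def)
qed

section \<open>Splitting off an orbit\<close>

lemma restrict_perm_action:
  assumes G: "group G" and \<phi>: "\<phi> \<in> actions G F A" and B: "B \<subseteq> A"
    and inv: "\<And>g x. g \<in> carrier G \<Longrightarrow> x \<in> B \<Longrightarrow> \<phi> g x \<in> B"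
  shows "(\<lambda>g. restrict_perm B (\<phi> g)) \<in> actions G F B"
proof -
  interpret group G by fact
  have "restrict_perm B (\<phi> g) permutes B" if g: "g \<in> carrier G" for g
  proof (rule restrict_perm_permutes, rule bij_betwI[where g = "\<phi> (inv\<^bsub>G\<^esub> g)"])
  qed (use g inv action_inv[OF \<phi> g] in auto)
  moreover have "restrict_perm B (\<phi> (g \<otimes>\<^bsub>G\<^esub> h)) = restrict_perm B (\<phi> g) \<circ> restrict_perm B (\<phi> h)"
    if "g \<in> carrier G" "h \<in> carrier G" for g h
    using that inv actionsD(3)[OF \<phi>] by (auto simp: restrict_perm_def fun_eq_iff)
  moreover have "{g \<in> carrier G. restrict_perm B (\<phi> g) x = x} \<in> F" if "x \<in> B" for x
    using that B actionsD(4)[OF \<phi>, of x] by (auto simp: restrict_perm_def)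
  ultimately show ?thesis
    using actionsD(2)[OF \<phi>] by (auto simp: actions_def restrict_perm_def fun_eq_iff)
qed

text \<open>Permutations of disjoint sets commute, which makes the pointwise composition
  multiplicative; each point keeps its stabilizer.\<close>

lemma comp_actions:
  assumes \<phi>: "\<phi> \<in> actions G F B" and \<psi>: "\<psi> \<in> actions G F C" and BC: "B \<inter> C = {}"
  shows "(\<lambda>g. \<phi> g \<circ> \<psi> g) \<in> actions G F (B \<union> C)"
    and "g \<in> carrier G \<Longrightarrow> x \<in> B \<Longrightarrow> \<phi> g (\<psi> g x) = \<phi> g x"
    and "g \<in> carrier G \<Longrightarrow> x \<in> C \<Longrightarrow> \<phi> g (\<psi> g x) = \<psi> g x"
proof -
  show 1: "\<phi> g (\<psi> g x) = \<phi> g x" if "g \<in> carrier G" "x \<in> B" for g x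
  proof -
    have "x \<notin> C" using that BC by blast
    then show ?thesis using permutes_not_in[OF actionsD(1)[OF \<psi> that(1)], of x] by simp
  qed
  show 2: "\<phi> g (\<psi> g x) = \<psi> g x" if "g \<in> carrier G" "x \<in> C" for g x
  proof -
    have "\<psi> g x \<notin> B" using actionsD(5)[OF \<psi> that] BC by blast
    then show ?thesis using permutes_not_in[OF actionsD(1)[OF \<phi> that(1)]] by simp
  qed
  have perm: "\<phi> g \<circ> \<psi> g permutes B \<union> C" if "g \<in> carrier G" for g
    using actionsD(1)[OF \<phi> that] actionsD(1)[OF \<psi> that]
    by (auto intro!: permutes_compose intro: permutes_subset)
  have hom: "\<phi> (g \<otimes>\<^bsub>G\<^esub> h) (\<psi> (g \<otimes>\<^bsub>G\<^esub> h) x) = \<phi> g (\<psi> g (\<phi> h (\<psi> h x)))"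
    if "g \<in> carrier G" "h \<in> carrier G" for g h x
  proof -
    have "\<psi> g (\<phi> h y) = \<phi> h (\<psi> g y)" for y
      using permutes_not_in[OF actionsD(1)[OF \<psi> that(1)]] permutes_not_in[OF actionsD(1)[OF \<phi> that(2)]]
        actionsD(5)[OF \<phi> that(2)] actionsD(5)[OF \<psi> that(1)] BC
      by (metis disjoint_iff)
    then show ?thesis using actionsD(3)[OF \<phi>] actionsD(3)[OF \<psi>] that by simp
  qed
  have "{g\<in>carrier G. \<phi> g (\<psi> g x) = x} \<in> F" if "x \<in> B \<union> C" for x
  proof (cases "x \<in> B")
    case True
    then have "{g\<in>carrier G. \<phi> g (\<psi> g x) = x} = {g\<in>carrier G. \<phi> g x = x}" using 1 by auto
    then show ?thesis using actionsD(4)[OF \<phi> True] by simp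
  next
    case False
    then have "{g\<in>carrier G. \<phi> g (\<psi> g x) = x} = {g\<in>carrier G. \<psi> g x = x}"
    proof (intro Collect_cong conj_cong refl)
      fix g assume "g \<in> carrier G"
      then show "\<phi> g (\<psi> g x) = x \<longleftrightarrow> \<psi> g x = x" using 2[of g x] that False by simp
    qed
    then show ?thesis using actionsD(4)[OF \<psi>, of x] that False by simp
  qed
  then show "(\<lambda>g. \<phi> g \<circ> \<psi> g) \<in> actions G F (B \<union> C)"
    using perm hom actionsD(2)[OF \<phi>] actionsD(2)[OF \<psi>] by (auto simp: actions_def fun_eq_iff)
qed

text \<open>The orbit \<open>Z\<close> of \<open>x0\<close>, the transitive action on
  \<open>Z\<close> and the action on the complement determine an action and can be prescribed
  freely. Composition recovers the action from its two restrictions.\<close>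

lemma (in group) card_actions_orbit:
  fixes A :: "'c set"
  assumes A: "finite A" "x0 \<in> A" and fin: "\<And>B::'c set. finite B \<Longrightarrow> finite (actions G F B)"
  shows "card (actions G F A) =
     (\<Sum>Z | x0 \<in> Z \<and> Z \<subseteq> A. card (trans_actions G F Z x0) * card (actions G F (A - Z)))"
proof -
  define orb where "orb \<phi> = (\<lambda>g. \<phi> g x0) ` carrier G" for \<phi> :: "'a \<Rightarrow> 'c \<Rightarrow> 'c"
  define S where "S = Sigma {Z. x0 \<in> Z \<and> Z \<subseteq> A} (\<lambda>Z. trans_actions G F Z x0 \<times> actions G F (A - Z))"
  have "bij_betw (\<lambda>\<phi>. (orb \<phi>, (\<lambda>g. restrict_perm (orb \<phi>) (\<phi> g)), (\<lambda>g. restrict_perm (A - orb \<phi>) (\<phi> g))))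
    (actions G F A) S"
  proof (rule bij_betwI[where g = "\<lambda>(Z, \<phi>, \<psi>). (\<lambda>g. \<phi> g \<circ> \<psi> g)"])
    show "(\<lambda>\<phi>. (orb \<phi>, (\<lambda>g. restrict_perm (orb \<phi>) (\<phi> g)), (\<lambda>g. restrict_perm (A - orb \<phi>) (\<phi> g))))
      \<in> actions G F A \<rightarrow> S"
    proof
      fix \<phi> assume \<phi>: "\<phi> \<in> actions G F A"
      have o1: "orb \<phi> \<subseteq> A" using actionsD(5)[OF \<phi> _ A(2)] by (auto simp: orb_def)
      have o2: "x0 \<in> orb \<phi>" using action_one[OF \<phi>, of x0] by (auto simp: orb_def image_iff intro!: bexI[of
      _ "\<one>"])
      have o3: "\<phi> g x \<in> orb \<phi>" if "g \<in> carrier G" "x \<in> orb \<phi>" for g x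
        using that actionsD(3)[OF \<phi>, of g, symmetric] by (auto simp: orb_def)
      have o4: "\<phi> g x \<in> A - orb \<phi>" if "g \<in> carrier G" "x \<in> A - orb \<phi>" for g x
        using that o3[of "inv g" "\<phi> g x"] action_inv(1)[OF \<phi>, of g x] actionsD(5)[OF \<phi>, of g x] by auto
      have "(\<lambda>g. restrict_perm (orb \<phi>) (\<phi> g)) \<in> trans_actions G F (orb \<phi>) x0"
        using restrict_perm_action[OF is_group \<phi> o1 o3] o2
        by (auto simp: trans_actions_def restrict_perm_def) (auto simp: orb_def)
      moreover have "(\<lambda>g. restrict_perm (A - orb \<phi>) (\<phi> g)) \<in> actions G F (A - orb \<phi>)"
        using restrict_perm_action[OF is_group \<phi> _ o4] by auto
      ultimately show "(orb \<phi>, (\<lambda>g. restrict_perm (orb \<phi>) (\<phi> g)), (\<lambda>g. restrict_perm (A - orb \<phi>) (\<phi> g))) \<in> S"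
        using o1 o2 by (auto simp: S_def)
    qed
    show "(\<lambda>(Z, \<phi>, \<psi>). (\<lambda>g. \<phi> g \<circ> \<psi> g)) \<in> S \<rightarrow> actions G F A"
    proof -
      have "(\<lambda>g. \<phi> g \<circ> \<psi> g) \<in> actions G F A"
        if "Z \<subseteq> A" "\<phi> \<in> actions G F Z" "\<psi> \<in> actions G F (A - Z)" for Z \<phi> \<psi>
        using comp_actions(1)[OF that(2,3)] that(1) by (simp add: Un_absorb1)
      then show ?thesis by (auto simp: S_def trans_actions_def)
    qed
    show "(\<lambda>(Z, \<phi>, \<psi>). (\<lambda>g. \<phi> g \<circ> \<psi> g)) (orb \<phi>, (\<lambda>g. restrict_perm (orb \<phi>) (\<phi> g)), (\<lambda>g. restrict_perm (A
        - orb \<phi>) (\<phi> g))) = \<phi>"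
      if \<phi>: "\<phi> \<in> actions G F A" for \<phi>
    proof -
      have o3: "\<phi> g x \<in> orb \<phi>" if "g \<in> carrier G" "x \<in> orb \<phi>" for g x
        using that actionsD(3)[OF \<phi>, of g, symmetric] by (auto simp: orb_def)
      have o4: "\<phi> g x \<in> A - orb \<phi>" if "g \<in> carrier G" "x \<in> A - orb \<phi>" for g x
        using that o3[of "inv g" "\<phi> g x"] action_inv(1)[OF \<phi>, of g x] actionsD(5)[OF \<phi>, of g x] by auto
      have o1: "orb \<phi> \<subseteq> A" using actionsD(5)[OF \<phi> _ A(2)] by (auto simp: orb_def)
      have "restrict_perm (orb \<phi>) (\<phi> g) (restrict_perm (A - orb \<phi>) (\<phi> g) x) = \<phi> g x" for g x
        using o1 o4[of g x] actionsD(1,2)[OF \<phi>, of g]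
        by (cases "g \<in> carrier G") (auto simp: restrict_perm_def permutes_not_in)
      then show ?thesis by (simp add: fun_eq_iff)
    qed
    show "(\<lambda>\<phi>. (orb \<phi>, (\<lambda>g. restrict_perm (orb \<phi>) (\<phi> g)), (\<lambda>g. restrict_perm (A - orb \<phi>) (\<phi> g))))
       (case p of (Z, \<phi>, \<psi>) \<Rightarrow> (\<lambda>g. \<phi> g \<circ> \<psi> g)) = p" if pS: "p \<in> S" for p
    proof -
      obtain Z \<phi> \<psi> where p: "p = (Z, \<phi>, \<psi>)" "x0 \<in> Z" "Z \<subseteq> A" "\<phi> \<in> trans_actions G F Z x0"
        "\<psi> \<in> actions G F (A - Z)"
        using pS by (auto simp: S_def)
      then have \<phi>: "\<phi> \<in> actions G F Z" by (simp add: trans_actions_def)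
      have disj: "Z \<inter> (A - Z) = {}" by blast
      note c = comp_actions[OF \<phi> p(5) disj]
      have orb: "orb (\<lambda>g. \<phi> g \<circ> \<psi> g) = Z"
      proof -
        have "orb (\<lambda>g. \<phi> g \<circ> \<psi> g) = (\<lambda>g. \<phi> g x0) ` carrier G"
          unfolding orb_def using c(2)[OF _ p(2)] by (intro image_cong) auto
        then show ?thesis using p(4) by (simp add: trans_actions_def)
      qed
      have "restrict_perm Z (\<lambda>a. \<phi> g (\<psi> g a)) x = \<phi> g x" for g x
        using c(2)[of g x] permutes_not_in[OF actionsD(1)[OF \<phi>, of g], of x]
          actionsD(2)[OF \<phi>, of g] actionsD(2)[OF p(5), of g]
        by (cases "g \<in> carrier G"; cases "x \<in> Z") (simp_all add: restrict_perm_def)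
      moreover have "restrict_perm (A - Z) (\<lambda>a. \<phi> g (\<psi> g a)) x = \<psi> g x" for g x
        using c(3)[of g x] permutes_not_in[OF actionsD(1)[OF p(5), of g], of x]
          actionsD(2)[OF \<phi>, of g] actionsD(2)[OF p(5), of g]
        by (cases "g \<in> carrier G"; cases "x \<in> A - Z") (simp_all add: restrict_perm_def)
      ultimately show ?thesis using p(1) orb by (simp add: fun_eq_iff o_def)
    qed
  qed
  then have "card (actions G F A) = card S" by (rule bij_betw_same_card)
  also have "\<dots> = (\<Sum>Z | x0 \<in> Z \<and> Z \<subseteq> A. card (trans_actions G F Z x0 \<times> actions G F (A - Z)))"
    unfolding S_def
  proof (rule card_SigmaI)
    show "finite {Z. x0 \<in> Z \<and> Z \<subseteq> A}" using A by auto
    show "\<forall>a\<in>{Z. x0 \<in> Z \<and> Z \<subseteq> A}. finite (trans_actions G F a x0 \<times> actions G F (A - a))"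
    proof (intro ballI finite_cartesian_product)
      fix Z assume "Z \<in> {Z. x0 \<in> Z \<and> Z \<subseteq> A}"
      then have "finite Z" using A finite_subset by auto
      then show "finite (trans_actions G F Z x0)"
        by (intro finite_subset[OF _ fin[of Z]]) (auto simp: trans_actions_def)
      show "finite (actions G F (A - Z))" using A fin by simp
    qed
  qed
  finally show ?thesis by (simp add: card_cartesian_product)
qed

lemma sum_pointed_subsets:
  assumes A: "finite A" "x0 \<in> A"
  shows "(\<Sum>Z | x0 \<in> Z \<and> Z \<subseteq> A. f (card Z)) = (\<Sum>k<card A. ((card A - 1) choose k) * (f (Suc k) :: nat))"
proof -
  have "(\<Sum>Z | x0 \<in> Z \<and> Z \<subseteq> A. f (card Z)) = (\<Sum>B\<in>Pow (A - {x0}). f (Suc (card B)))"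
  proof (rule sum.reindex_bij_witness[where i = "insert x0" and j = "\<lambda>Z. Z - {x0}"])
    fix B assume "B \<in> {Z. x0 \<in> Z \<and> Z \<subseteq> A}"
    then show "f (Suc (card (B - {x0}))) = f (card B)"
      using A finite_subset[of B A] card_Suc_Diff1[of B x0] by simp
  qed (use A in auto)
  also have "\<dots> = (\<Sum>k\<le>card (A - {x0}). \<Sum>B\<in>{B\<in>Pow (A - {x0}). card B = k}. f (Suc (card B)))"
  proof (intro sum.group[symmetric])
    show "card ` Pow (A - {x0}) \<subseteq> {..card (A - {x0})}"
      using A by (auto simp del: card_Diff_insert card_Diff_singleton intro!: card_mono)
  qed (use A in auto)
  also have "\<dots> = (\<Sum>k\<le>card (A - {x0}). (card (A - {x0}) choose k) * f (Suc k))"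
    using A by (intro sum.cong refl) (simp add: n_subsets flip: n_subsets[of "A - {x0}"])
  also have "{..card (A - {x0})} = {..<card A}"
    using A by (auto simp: card_Diff_singleton) (metis Suc_pred card_gt_0_iff empty_iff less_Suc_eq_le)+
  finally show ?thesis using A by simp
qed

text \<open>The choice of \<open>F\<close> as the family of all subgroups gives M. Hall's recurrence; the families used below
  separate the subgroups according to whether they contain a given central element.\<close>
lemma (in group) card_actions_recurrence:
  fixes h :: "nat \<Rightarrow> nat"
  assumes fin: "\<And>B::'c set. finite B \<Longrightarrow> finite (actions G F B)"
    and h: "\<And>B::'c set. finite B \<Longrightarrow> card (actions G F B) = h (card B)"
    and F: "\<And>H g. H \<in> F \<Longrightarrow> g \<in> carrier G \<Longrightarrow> (\<lambda>h. g \<otimes> h \<otimes> inv g) ` H \<in> F"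
    and inf: "infinite (UNIV :: 'c set)"
  shows "h (Suc n) = (\<Sum>k\<le>n. (n choose k) * (fact k *
      card {H\<in>F. subgroup H G \<and> card (rcosets H) = Suc k} * h (n - k)))"
    and "finite {H\<in>F. subgroup H G \<and> card (rcosets H) = Suc n}"
proof -
  obtain A :: "'c set" where A: "card A = Suc n" "finite A"
    using infinite_arbitrarily_large[OF inf] by blast
  then obtain x0 where x0: "x0 \<in> A" by (metis card_eq_SucD insertI1)
  show "finite {H\<in>F. subgroup H G \<and> card (rcosets H) = Suc n}"
    using card_trans_actions(1)[OF A(2) x0 fin[OF A(2)] F] A(1) by simp
  have "h (Suc n) = card (actions G F A)" using h A by simp
  also have "\<dots> = (\<Sum>Z | x0 \<in> Z \<and> Z \<subseteq> A. card (trans_actions G F Z x0) * card (actions G F (A - Z)))"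
    using card_actions_orbit[OF A(2) x0 fin] .
  also have "\<dots> = (\<Sum>Z | x0 \<in> Z \<and> Z \<subseteq> A. fact (card Z - 1) *
      card {H\<in>F. subgroup H G \<and> card (rcosets H) = card Z} * h (Suc n - card Z))"
  proof (rule sum.cong[OF refl])
    fix Z assume "Z \<in> {Z. x0 \<in> Z \<and> Z \<subseteq> A}"
    then have Z: "x0 \<in> Z" "Z \<subseteq> A" "finite Z" using A finite_subset by auto
    then show "card (trans_actions G F Z x0) * card (actions G F (A - Z)) = fact (card Z - 1) *
      card {H\<in>F. subgroup H G \<and> card (rcosets H) = card Z} * h (Suc n - card Z)"
      using card_trans_actions(2)[OF Z(3,1) fin[OF Z(3)] F] h[of "A - Z"] A by (simp add: card_Diff_subset)
  qed
  also have "\<dots> = (\<Sum>k<Suc n. (n choose k) * (fact k *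
      card {H\<in>F. subgroup H G \<and> card (rcosets H) = Suc k} * h (n - k)))"
    using sum_pointed_subsets[OF A(2) x0, of "\<lambda>c. fact (c - 1) *
      card {H\<in>F. subgroup H G \<and> card (rcosets H) = c} * h (Suc n - c)"] A(1) by simp
  finally show "h (Suc n) = (\<Sum>k\<le>n. (n choose k) * (fact k *
      card {H\<in>F. subgroup H G \<and> card (rcosets H) = Suc k} * h (n - k)))"
    by (simp add: lessThan_Suc_atMost)
qed

section \<open>The modular group\<close>

text \<open>Explicit entries let the simplifier multiply and compare matrices; an arbitrary matrix
  is brought to this form by \<open>mat2_collapse\<close>.\<close>

definition mat2 :: "int \<Rightarrow> int \<Rightarrow> int \<Rightarrow> int \<Rightarrow> int ^ 2 ^ 2" where
  "mat2 a b c d = (\<chi> i j. if i = 1 then if j = 1 then a else b else if j = 1 then c else d)"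

lemma mat2_collapse: "M = mat2 (M$1$1) (M$1$2) (M$2$1) (M$2$2)"
  by (simp add: mat2_def vec_eq_iff forall_2)

lemma mat2_eq_iff [simp]: "mat2 a b c d = mat2 a' b' c' d' \<longleftrightarrow> a = a' \<and> b = b' \<and> c = c' \<and> d = d'"
  by (auto simp: mat2_def vec_eq_iff forall_2)

lemma mat2_mult [simp]: "mat2 a b c d ** mat2 a' b' c' d' =
    mat2 (a * a' + b * c') (a * b' + b * d') (c * a' + d * c') (c * b' + d * d')"
  by (simp add: mat2_def vec_eq_iff forall_2 matrix_matrix_mult_def sum_2)

lemma det_mat2 [simp]: "det (mat2 a b c d) = a * d - b * c"
  by (simp add: mat2_def det_2)

lemma mat_1_eq_mat2: "mat 1 = mat2 1 0 0 1"
  by (simp add: mat2_def vec_eq_iff forall_2 mat_def)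

abbreviation SS :: "int ^ 2 ^ 2" where "SS \<equiv> mat2 0 (-1) 1 0"
abbreviation UU :: "int ^ 2 ^ 2" where "UU \<equiv> mat2 0 (-1) 1 1"

section \<open>Words in the generators and their normal forms\<close>

context
  fixes a b :: "'a \<Rightarrow> 'a"
begin

inductive presented :: "int ^ 2 ^ 2 \<Rightarrow> ('a \<Rightarrow> 'a) \<Rightarrow> bool" where
  presented_one: "presented (mat 1) id"
| presented_S: "presented M p \<Longrightarrow> presented (SS ** M) (a \<circ> p)"
| presented_U: "presented M p \<Longrightarrow> presented (UU ** M) (b \<circ> p)"

text \<open>The letters are S^3 U = -SU and S^3 U^2 = -SU^2, that is, the two elementary matrices
  with nonnegative entries; the sign is supplied by S^2 = -1.\<close>

inductive positive_word :: "int ^ 2 ^ 2 \<Rightarrow> ('a \<Rightarrow> 'a) \<Rightarrow> bool" where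
  positive_one: "positive_word (mat 1) id"
| positive_L: "positive_word M p \<Longrightarrow> positive_word (mat2 1 1 0 1 ** M) (a \<circ> a \<circ> a \<circ> b \<circ> p)"
| positive_R: "positive_word M p \<Longrightarrow> positive_word (mat2 1 0 1 1 ** M) (a \<circ> a \<circ> a \<circ> b \<circ> b \<circ> p)"

lemma presented_mult: "presented M p \<Longrightarrow> presented N q \<Longrightarrow> presented (M ** N) (p \<circ> q)"
  by (induction rule: presented.induct)
     (auto simp: matrix_mul_assoc[symmetric] o_assoc[symmetric] simp del: mat2_mult intro: presented.intros)

text \<open>Nonnegativity takes the place of a ping-pong argument: no cancellation can occur in the
  entries, so a nonempty word keeps a nonzero entry off the diagonal and cannot evaluate to the
  identity matrix.\<close>

lemma positive_word_entries:
  "positive_word M p \<Longrightarrow> \<exists>x y z w. M = mat2 x y z w \<and> x \<ge> 1 \<and> y \<ge> 0 \<and> z \<ge> 0 \<and> w \<ge> 1 \<and> (y + z \<ge> 1 \<or> p = id)"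
proof (induction rule: positive_word.induct)
  case positive_one
  then show ?case by (auto simp: mat_1_eq_mat2)
next
  case (positive_L M p)
  then obtain x y z w where "M = mat2 x y z w" "x \<ge> 1" "y \<ge> 0" "z \<ge> 0" "w \<ge> 1" by auto
  then show ?case by (intro exI[of _ "x + z"] exI[of _ "y + w"] exI[of _ z] exI[of _ w]) auto
next
  case (positive_R M p)
  then obtain x y z w where "M = mat2 x y z w" "x \<ge> 1" "y \<ge> 0" "z \<ge> 0" "w \<ge> 1" by auto
  then show ?case by (intro exI[of _ x] exI[of _ y] exI[of _ "x + z"] exI[of _ "y + w"]) auto
qed

lemma presented_SS: "presented SS a" and presented_UU: "presented UU b"
  using presented_S[OF presented_one] presented_U[OF presented_one] by simp_all

lemma presented_S_iff: "(\<exists>p. presented (SS ** M) p) \<longleftrightarrow> (\<exists>p. presented M p)"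
proof
  assume "\<exists>p. presented (SS ** M) p"
  then obtain p where "presented (SS ** (SS ** (SS ** (SS ** M)))) (a \<circ> (a \<circ> (a \<circ> p)))"
    by (blast intro: presented_S)
  moreover have "SS ** (SS ** (SS ** (SS ** M))) = M"
    by (subst (1 2) mat2_collapse[of M]) simp
  ultimately show "\<exists>p. presented M p" by auto
qed (blast intro: presented_S)

text \<open>The translation T with upper right entry 1 is S^3 U, and its inverse is S^2 U^2 S; so
  both are words, and \<open>k\<close> can be any integer.\<close>

lemma presented_shift_iff: "(\<exists>p. presented (mat2 1 k 0 1 ** M) p) \<longleftrightarrow> (\<exists>p. presented M p)"
proof -
  let ?P = "\<lambda>M. \<exists>p. presented M p"
  have L: "?P (mat2 1 1 0 1 ** M) \<longleftrightarrow> ?P M" for M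
  proof
    assume "?P M"
    then obtain p where "presented (SS ** (SS ** (SS ** (UU ** M)))) (a \<circ> (a \<circ> (a \<circ> (b \<circ> p))))"
      by (blast intro: presented.intros)
    moreover have "SS ** (SS ** (SS ** (UU ** M))) = mat2 1 1 0 1 ** M"
      by (subst (1 2) mat2_collapse[of M]) (simp add: algebra_simps)
    ultimately show "?P (mat2 1 1 0 1 ** M)" by auto
  next
    assume "?P (mat2 1 1 0 1 ** M)"
    then obtain p where "presented (UU ** (UU ** (SS ** (mat2 1 1 0 1 ** M)))) (b \<circ> (b \<circ> (a \<circ> p)))"
      by (blast intro: presented.intros)
    then have "presented (SS ** (SS ** (UU ** (UU ** (SS ** (mat2 1 1 0 1 ** M)))))) (a \<circ> (a \<circ> (b \<circ> (b \<circ> (a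
        \<circ> p)))))"
      by (blast intro: presented.intros)
    \<comment> \<open>U^2 S inverts T only up to the sign U^3 = -1, and the prefix S^2 corrects it.
      The disjunction leaves the sign to the simplifier, either alternative being
      sufficient.\<close>
    moreover have "SS ** (SS ** (UU ** (UU ** (SS ** (mat2 1 1 0 1 ** M))))) = M \<or>
      UU ** (UU ** (SS ** (mat2 1 1 0 1 ** M))) = M"
      by (subst (1 2 3 4) mat2_collapse[of M]) (simp add: algebra_simps)
    ultimately show "?P M" using \<open>presented (UU ** (UU ** (SS ** (mat2 1 1 0 1 ** M)))) _\<close> by auto
  qed
  have nat: "?P (mat2 1 (int n) 0 1 ** M) \<longleftrightarrow> ?P M" for n M
  proof (induction n)
    case 0
    then show ?case by (simp flip: mat_1_eq_mat2)
  next
    case (Suc n)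
    have "mat2 1 (int (Suc n)) 0 1 ** M = mat2 1 1 0 1 ** (mat2 1 (int n) 0 1 ** M)"
      by (simp add: matrix_mul_assoc add.commute)
    then show ?case using L Suc by simp
  qed
  show ?thesis
  proof (cases "k \<ge> 0")
    case True
    then show ?thesis using nat[of "nat k"] by simp
  next
    case False
    have "mat2 1 (- k) 0 1 ** (mat2 1 k 0 1 ** M) = M"
      by (simp add: matrix_mul_assoc flip: mat_1_eq_mat2)
    then show ?thesis using nat[of "nat (- k)" "mat2 1 k 0 1 ** M"] False by simp
  qed
qed

text \<open>Euclid's algorithm on the first column: a power of T reduces the upper entry modulo the
  lower one and S exchanges them up to sign. When the lower entry is 0, the matrix is a translation
  up to sign.\<close>

lemma presented_total: "det M = 1 \<Longrightarrow> \<exists>p. presented M p"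
proof (induction "nat \<bar>M$2$1\<bar>" arbitrary: M rule: less_induct)
  case less
  obtain x y z w where M: "M = mat2 x y z w" using mat2_collapse by blast
  then have z: "M$2$1 = z" by (simp add: mat2_def)
  show ?case
  proof (cases "z = 0")
    case True
    then have "x * w = 1" using less.prems M by simp
    then have "(x = 1 \<and> w = 1) \<or> (x = -1 \<and> w = -1)" using zmult_eq_1_iff by blast
    then have "M = mat2 1 y 0 1 ** mat 1 \<or> M = mat2 1 (- y) 0 1 ** (SS ** (SS ** mat 1))"
      using M True by (auto simp: mat_1_eq_mat2)
    then show ?thesis
      using presented_shift_iff[of _ "mat 1"] presented_shift_iff[of _ "SS ** (SS ** mat 1)"]
        presented_S[OF presented_S[OF presented_one]] presented_one by metis
  next
    case False
    define q where "q = x div z"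
    let ?N = "SS ** (mat2 1 (- q) 0 1 ** M)"
    have N: "?N = mat2 (- z) (- w) (x - q * z) (y - q * w)" by (simp add: M)
    have "?N $ 2 $ 1 = x mod z"
      unfolding N by (simp add: mat2_def q_def minus_div_mult_eq_mod)
    then have "nat \<bar>?N$2$1\<bar> < nat \<bar>M$2$1\<bar>" using False z abs_mod_less[of z x] by simp
    moreover have "det ?N = 1" using less.prems M by (simp add: N algebra_simps)
    ultimately have "\<exists>p. presented ?N p" by (rule less.hyps)
    then show ?thesis using presented_S_iff presented_shift_iff by blast
  qed
qed

context
  assumes aabbb: "a (a x) = b (b (b x))" and aaaa: "a (a (a (a x))) = x"
begin

text \<open>S^-1 = S^3 and U^-1 = S^2 U^2 are words, and by the two relations the same words in
  \<open>a\<close>, \<open>b\<close> invert \<open>a\<close> and \<open>b\<close>. Uniqueness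
  therefore needs to be shown only over the identity matrix.\<close>

lemma presented_left_inverse: "presented M p \<Longrightarrow> \<exists>N r. presented N r \<and> N ** M = mat 1 \<and> r \<circ> p = id"
proof (induction rule: presented.induct)
  case presented_one
  then show ?case using presented.presented_one by fastforce
next
  case (presented_S M p)
  then obtain N r where N: "presented N r" "N ** M = mat 1" "r \<circ> p = id" by blast
  have "presented (SS ** (SS ** SS)) (a \<circ> (a \<circ> a))" by (intro presented.intros presented_SS)
  then have "presented (N ** mat2 0 1 (-1) 0) (r \<circ> (a \<circ> (a \<circ> a)))" using N(1) presented_mult by simp
  moreover have "N ** mat2 0 1 (-1) 0 ** (SS ** M) = mat 1"
    by (simp only: matrix_mul_assoc[symmetric] N(2)[symmetric])
       (simp add: matrix_mul_assoc flip: mat_1_eq_mat2)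
  moreover have "r \<circ> (a \<circ> (a \<circ> a)) \<circ> (a \<circ> p) = id" using N(3) aaaa by (simp add: fun_eq_iff)
  ultimately show ?case by blast
next
  case (presented_U M p)
  then obtain N r where N: "presented N r" "N ** M = mat 1" "r \<circ> p = id" by blast
  have "presented (SS ** (SS ** (UU ** UU))) (a \<circ> (a \<circ> (b \<circ> b)))" by (intro presented.intros presented_UU)
  then have "presented (N ** mat2 1 1 (-1) 0) (r \<circ> (a \<circ> (a \<circ> (b \<circ> b))))" using N(1) presented_mult by simp
  moreover have "N ** mat2 1 1 (-1) 0 ** (UU ** M) = mat 1"
    by (simp only: matrix_mul_assoc[symmetric] N(2)[symmetric])
       (simp add: matrix_mul_assoc flip: mat_1_eq_mat2)
  moreover have "r \<circ> (a \<circ> (a \<circ> (b \<circ> b))) \<circ> (b \<circ> p) = id"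
    using N(3) aaaa by (simp add: fun_eq_iff flip: aabbb)
  ultimately show ?case by blast
qed

text \<open>Every element is \<open>\<plusminus> U^i W S^j\<close> with \<open>i < 3\<close>, \<open>j < 2\<close> and \<open>W\<close> a product of the two matrices \<open>- S U\<close> and
  \<open>- S U^2\<close>, whose entries are nonnegative.\<close>
definition normal_form :: "int ^ 2 ^ 2 \<Rightarrow> ('a \<Rightarrow> 'a) \<Rightarrow> bool" where
  "normal_form M p \<longleftrightarrow> (\<exists>(Z, z) \<in> {(mat 1, id), (mat2 (-1) 0 0 (-1), a \<circ> a)}.
     \<exists>(P, u) \<in> {(mat 1, id), (UU, b), (UU ** UU, b \<circ> b)}. \<exists>(Q, s) \<in> {(mat 1, id), (SS, a)}.
     \<exists>W w. positive_word W w \<and> M = Z ** (P ** (W ** Q)) \<and> p = z \<circ> (u \<circ> (w \<circ> s)))"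

lemma commute_central: "b (a (a x)) = a (a (b x))"
  by (simp add: aabbb)

lemma normal_formI:
  assumes "(Z, z) \<in> {(mat 1, id), (mat2 (-1) 0 0 (-1), a \<circ> a)}" "(P, u) \<in> {(mat 1, id), (UU, b), (UU ** UU,
      b \<circ> b)}"
    "(Q, s) \<in> {(mat 1, id), (SS, a)}" "positive_word W w" "M = Z ** (P ** (W ** Q))" "p = z \<circ> (u \<circ> (w \<circ> s))"
  shows "normal_form M p"
  unfolding normal_form_def using assms by blast

lemma normal_form_neg:
  assumes "normal_form M p"
  shows "normal_form (mat2 (-1) 0 0 (-1) ** M) (a \<circ> (a \<circ> p))"
proof -
  obtain Z z P u Q s W w where nf: "(Z, z) \<in> {(mat 1, id), (mat2 (-1) 0 0 (-1), a \<circ> a)}"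
    "(P, u) \<in> {(mat 1, id), (UU, b), (UU ** UU, b \<circ> b)}" "(Q, s) \<in> {(mat 1, id), (SS, a)}"
    "positive_word W w" "M = Z ** (P ** (W ** Q))" "p = z \<circ> (u \<circ> (w \<circ> s))"
    using assms unfolding normal_form_def by blast
  from nf(1) consider "Z = mat 1" "z = id" | "Z = mat2 (-1) 0 0 (-1)" "z = a \<circ> a" by blast
  then show ?thesis
  proof cases
    case 1
    show ?thesis
      by (rule normal_formI[OF _ nf(2-4), of "mat2 (-1) 0 0 (-1)" "a \<circ> a"]) (use nf 1 in \<open>simp_all add:
      o_assoc\<close>)
  next
    case 2
    show ?thesis
      by (rule normal_formI[OF _ nf(2-4), of "mat 1" id])
        (use nf 2 aaaa in \<open>simp_all add: fun_eq_iff matrix_mul_assoc flip: mat_1_eq_mat2\<close>)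
  qed
qed

lemma normal_form_U:
  assumes "normal_form M p"
  shows "normal_form (UU ** M) (b \<circ> p)"
proof -
  obtain Z z P u Q s W w where nf: "(Z, z) \<in> {(mat 1, id), (mat2 (-1) 0 0 (-1), a \<circ> a)}"
    "(P, u) \<in> {(mat 1, id), (UU, b), (UU ** UU, b \<circ> b)}" "(Q, s) \<in> {(mat 1, id), (SS, a)}"
    "positive_word W w" "M = Z ** (P ** (W ** Q))" "p = z \<circ> (u \<circ> (w \<circ> s))"
    using assms unfolding normal_form_def by blast
  obtain x1 x2 x3 x4 where X: "W ** Q = mat2 x1 x2 x3 x4" using mat2_collapse by blast
  from nf(2) consider "P = mat 1" "u = id" | "P = UU" "u = b" | "P = UU ** UU" "u = b \<circ> b" by blast
  then show ?thesis
  proof cases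
    case 1
    show ?thesis
      by (rule normal_formI[OF nf(1) _ nf(3,4), of UU b])
        (use nf(1,5,6) 1 X commute_central in \<open>auto simp: mat_1_eq_mat2 fun_eq_iff\<close>)
  next
    case 2
    show ?thesis
      by (rule normal_formI[OF nf(1) _ nf(3,4), of "UU ** UU" "b \<circ> b"])
        (use nf(1,5,6) 2 X commute_central in \<open>auto simp: mat_1_eq_mat2 fun_eq_iff\<close>)
  next
    case 3
    \<comment> \<open>The power of U has reached U^3 = -1, so the prefix disappears and the sign
      changes.\<close>
    have "normal_form (Z ** (mat 1 ** (W ** Q))) (z \<circ> (id \<circ> (w \<circ> s)))"
      by (rule normal_formI[OF nf(1) _ nf(3,4), of "mat 1" id]) simp_all
    then have "normal_form (mat2 (-1) 0 0 (-1) ** (Z ** (mat 1 ** (W ** Q)))) (a \<circ> (a \<circ> (z \<circ> (id \<circ> (w \<circ> s)))))"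
      by (rule normal_form_neg)
    also have "mat2 (-1) 0 0 (-1) ** (Z ** (mat 1 ** (W ** Q))) = UU ** M"
      using nf(1,5) 3 X by (auto simp: mat_1_eq_mat2)
    also have "a \<circ> (a \<circ> (z \<circ> (id \<circ> (w \<circ> s)))) = b \<circ> p"
      using nf(1,6) 3 by (auto simp: fun_eq_iff commute_central) (simp_all add: commute_central flip: aabbb)
    finally show ?thesis .
  qed
qed

text \<open>If the prefix is U or U^2, then S merges with it into a new letter, up to sign. If there
  is no prefix, S cancels the S^3 at the start of the first letter and leaves U or U^2 as prefix;
  for the empty word S meets the suffix.\<close>

lemma normal_form_S:
  assumes "normal_form M p"
  shows "normal_form (SS ** M) (a \<circ> p)"
proof -
  obtain Z z P u Q s W w where nf: "(Z, z) \<in> {(mat 1, id), (mat2 (-1) 0 0 (-1), a \<circ> a)}"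
    "(P, u) \<in> {(mat 1, id), (UU, b), (UU ** UU, b \<circ> b)}" "(Q, s) \<in> {(mat 1, id), (SS, a)}"
    "positive_word W w" "M = Z ** (P ** (W ** Q))" "p = z \<circ> (u \<circ> (w \<circ> s))"
    using assms unfolding normal_form_def by blast
  have Z: "Z = mat2 1 0 0 1 \<or> Z = mat2 (-1) 0 0 (-1)" "z = id \<or> z = a \<circ> a" using nf(1) by (auto simp:
      mat_1_eq_mat2)
  obtain x1 x2 x3 x4 where X: "W ** Q = mat2 x1 x2 x3 x4" using mat2_collapse by blast
  \<comment> \<open>Since SU and SU^2 are the negatives of the two letters and SS = -1, these cases
    reverse the sign.\<close>
  have neg: "normal_form (SS ** M) (a \<circ> p)"
    if "positive_word W' w'" "(P', u') \<in> {(mat 1, id), (UU, b), (UU ** UU, b \<circ> b)}"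
      "(Q', s') \<in> {(mat 1, id), (SS, a)}"
      "SS ** M = mat2 (-1) 0 0 (-1) ** (Z ** (P' ** (W' ** Q')))" "a \<circ> p = a \<circ> (a \<circ> (z \<circ> (u' \<circ> (w' \<circ> s'))))"
    for W' w' P' u' Q' s'
    using normal_form_neg[OF normal_formI[OF nf(1) that(2,3,1) refl refl]] that(4,5) by simp
  from nf(2) consider "P = mat 1" "u = id" | "P = UU" "u = b" | "P = UU ** UU" "u = b \<circ> b" by blast
  then show ?thesis
  proof cases
    case 1
    from nf(4) show ?thesis
    proof cases
      case positive_one
      from nf(3) consider "Q = mat 1" "s = id" | "Q = SS" "s = a" by blast
      then show ?thesis
      proof cases
        assume Q: "Q = mat 1" "s = id"
        show ?thesis
          by (rule normal_formI[OF nf(1) _ _ positive_word.positive_one, of "mat 1" id SS a])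
            (use nf(5,6) Z 1 Q positive_one in \<open>auto simp: mat_1_eq_mat2 fun_eq_iff\<close>)
      next
        assume Q: "Q = SS" "s = a"
        show ?thesis
          by (rule neg[OF positive_word.positive_one, of "mat 1" id "mat 1" id])
            (use nf(5,6) Z 1 Q positive_one in \<open>auto simp: mat_1_eq_mat2 fun_eq_iff\<close>)
      qed
    next
      case (positive_L W' w')
      obtain y1 y2 y3 y4 where Y: "W' ** Q = mat2 y1 y2 y3 y4" using mat2_collapse by blast
      have "normal_form (Z ** (UU ** (W' ** Q))) (z \<circ> (b \<circ> (w' \<circ> s)))"
        by (rule normal_formI[OF nf(1) _ nf(3) positive_L(3)]) auto
      also have "Z ** (UU ** (W' ** Q)) = SS ** M"
        using nf(5) Z 1 Y by (auto simp: positive_L mat_1_eq_mat2 simp flip: matrix_mul_assoc)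
      also have "z \<circ> (b \<circ> (w' \<circ> s)) = a \<circ> p"
        using nf(6) Z 1 aaaa by (auto simp: positive_L fun_eq_iff)
      finally show ?thesis .
    next
      case (positive_R W' w')
      obtain y1 y2 y3 y4 where Y: "W' ** Q = mat2 y1 y2 y3 y4" using mat2_collapse by blast
      have "normal_form (Z ** ((UU ** UU) ** (W' ** Q))) (z \<circ> ((b \<circ> b) \<circ> (w' \<circ> s)))"
        by (rule normal_formI[OF nf(1) _ nf(3) positive_R(3)]) auto
      also have "Z ** ((UU ** UU) ** (W' ** Q)) = SS ** M"
        using nf(5) Z 1 Y by (auto simp: positive_R mat_1_eq_mat2 simp flip: matrix_mul_assoc)
      also have "z \<circ> ((b \<circ> b) \<circ> (w' \<circ> s)) = a \<circ> p"
        using nf(6) Z 1 aaaa by (auto simp: positive_R fun_eq_iff)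
      finally show ?thesis .
    qed
  next
    case 2
    show ?thesis
      by (rule neg[OF positive_L[OF nf(4)] _ nf(3), of "mat 1" id])
        (use nf(5,6) Z 2 X aaaa in \<open>auto simp: mat_1_eq_mat2 fun_eq_iff simp flip: matrix_mul_assoc\<close>)
  next
    case 3
    show ?thesis
      by (rule neg[OF positive_R[OF nf(4)] _ nf(3), of "mat 1" id])
        (use nf(5,6) Z 3 X aaaa in \<open>auto simp: mat_1_eq_mat2 fun_eq_iff simp flip: matrix_mul_assoc\<close>)
  qed
qed

lemma presented_normal_form: "presented M p \<Longrightarrow> normal_form M p"
proof (induction rule: presented.induct)
  case presented_one
  show ?case
    by (rule normal_formI[OF _ _ _ positive_one, of "mat 1" id "mat 1" id "mat 1" id]) auto
qed (blast intro: normal_form_S normal_form_U)+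

text \<open>If a normal form evaluates to the identity matrix, its positive part is \<plusminus>
  U^-i S^-j. Among these matrices only the identity has nonnegative entries and a positive diagonal,
  so prefix, suffix and sign are trivial, and the positive word is empty by its off-diagonal
  entries.\<close>

lemma presented_one_imp_id:
  assumes "presented (mat 1) p"
  shows "p = id"
proof -
  obtain Z z P u Q s W w where nf: "(Z, z) \<in> {(mat 1, id), (mat2 (-1) 0 0 (-1), a \<circ> a)}"
    "(P, u) \<in> {(mat 1, id), (UU, b), (UU ** UU, b \<circ> b)}" "(Q, s) \<in> {(mat 1, id), (SS, a)}"
    "positive_word W w" "mat 1 = Z ** (P ** (W ** Q))" "p = z \<circ> (u \<circ> (w \<circ> s))"
    using presented_normal_form[OF assms] unfolding normal_form_def by blast
  obtain x1 x2 x3 x4 where X: "W = mat2 x1 x2 x3 x4" "x1 \<ge> 1" "x2 \<ge> 0" "x3 \<ge> 0" "x4 \<ge> 1"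
      "x2 + x3 \<ge> 1 \<or> w = id"
    using positive_word_entries[OF nf(4)] by blast
  show ?thesis
    using nf(1-3,5,6) X by (auto simp: mat_1_eq_mat2)
qed

text \<open>A left inverse \<open>r\<close> of \<open>p\<close> is also one of \<open>q\<close>,
  because \<open>r \<circ> q\<close> lies over the identity matrix; and \<open>r\<close> itself can
  be cancelled, having a left inverse.\<close>

lemma presented_unique:
  assumes "presented M p" "presented M q"
  shows "p = q"
proof -
  obtain N r where N: "presented N r" "N ** M = mat 1" "r \<circ> p = id"
    using presented_left_inverse[OF assms(1)] by blast
  have rq: "r \<circ> q = id" using presented_one_imp_id presented_mult[OF N(1) assms(2)] N(2) by simp
  obtain N' r' where N': "presented N' r'" "N' ** N = mat 1" "r' \<circ> r = id"
    using presented_left_inverse[OF N(1)] by blast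
  have "p = (r' \<circ> r) \<circ> p" "q = (r' \<circ> r) \<circ> q" using N'(3) by auto
  then show ?thesis using N(3) rq by (metis o_assoc)
qed

end
end

text \<open>The presentation \<open>\<langle>S, U | S^4, S^2 = U^3\<rangle>\<close> of the modular group.\<close>
lemma bij_betw_actions_SL2Z:
  fixes A :: "'a set"
  shows "bij_betw (\<lambda>\<phi>. (\<phi> SS, \<phi> UU)) (actions SL2Z UNIV A)
     {(a, b). a permutes A \<and> b permutes A \<and> a \<circ> a = b \<circ> b \<circ> b \<and> a \<circ> a \<circ> (a \<circ> a) = id}"
proof -
  interpret group SL2Z by (rule group_SL2Z)
  have carrier: "carrier SL2Z = {M. det M = 1}" and mult: "x \<otimes>\<^bsub>SL2Z\<^esub> y = x ** y"
      and one: "\<one>\<^bsub>SL2Z\<^esub> = mat 1" for x y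
    by (simp_all add: SL2Z_def)
  \<comment> \<open>Totality makes the choice possible; uniqueness shows below that it is
    multiplicative and has the right values on the generators.\<close>
  define ext where "ext = (\<lambda>(a :: 'a \<Rightarrow> 'a, b) M. if det M = 1 then SOME p. presented a b M p else id)"
  have pres: "presented (\<phi> SS) (\<phi> UU) M p \<Longrightarrow> det M = 1 \<and> p = \<phi> M" if \<phi>: "\<phi> \<in> actions SL2Z UNIV A" for \<phi> M p
  proof (induction rule: presented.induct)
    case presented_one
    then show ?case using action_one[OF \<phi>] by (auto simp: one mat_1_eq_mat2)
  next
    case (presented_S M p)
    then show ?case using actionsD(3)[OF \<phi>, of SS M] by (auto simp: carrier mult det_mul fun_eq_iff)
  next
    case (presented_U M p)
    then show ?case using actionsD(3)[OF \<phi>, of UU M] by (auto simp: carrier mult det_mul fun_eq_iff)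
  qed
  show ?thesis
  proof (rule bij_betwI[where g = ext])
    show "(\<lambda>\<phi>. (\<phi> SS, \<phi> UU)) \<in> actions SL2Z UNIV A \<rightarrow>
       {(a, b). a permutes A \<and> b permutes A \<and> a \<circ> a = b \<circ> b \<circ> b \<and> a \<circ> a \<circ> (a \<circ> a) = id}"
    proof
      fix \<phi> :: "int ^ 2 ^ 2 \<Rightarrow> 'a \<Rightarrow> 'a" assume \<phi>: "\<phi> \<in> actions SL2Z UNIV A"
      have "\<phi> (SS ** SS) x = \<phi> SS (\<phi> SS x)" "\<phi> (UU ** (UU ** UU)) x = \<phi> UU (\<phi> UU (\<phi> UU x))"
        "\<phi> (SS ** (SS ** (SS ** SS))) x = \<phi> SS (\<phi> SS (\<phi> SS (\<phi> SS x)))" for x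
        using actionsD(3)[OF \<phi>] by (auto simp: carrier mult simp del: mat2_mult simp: det_mul)
      then show "(\<phi> SS, \<phi> UU) \<in> {(a, b). a permutes A \<and> b permutes A \<and> a \<circ> a = b \<circ> b \<circ> b \<and> a \<circ> a \<circ> (a \<circ> a)
      = id}"
        using actionsD(1)[OF \<phi>] action_one[OF \<phi>] by (simp add: carrier fun_eq_iff one mat_1_eq_mat2)
    qed
    show "ext \<in> {(a, b). a permutes A \<and> b permutes A \<and> a \<circ> a = b \<circ> b \<circ> b \<and> a \<circ> a \<circ> (a \<circ> a) = id} \<rightarrow>
       actions SL2Z UNIV A" (is "_ \<in> ?P \<rightarrow> _")
    proof
      fix ab assume "ab \<in> ?P"
      then obtain a b where ab: "ab = (a, b)" and perm: "a permutes A" "b permutes A"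
        and eqs: "a \<circ> a = b \<circ> b \<circ> b" "a \<circ> a \<circ> (a \<circ> a) = id"
        by blast
      have rel: "a (a x) = b (b (b x))" "a (a (a (a x))) = x" for x
        using fun_cong[OF eqs(1), of x] fun_cong[OF eqs(2), of x] unfolding o_apply id_apply .
      have ext: "presented a b M (ext ab M)" if "det M = 1" for M
        using someI_ex[OF presented_total[OF that, of a b]] that by (simp add: ext_def ab)
      have "p permutes A" if "presented a b M p" for M p
        using that perm by (induction rule: presented.induct) (auto intro: permutes_id permutes_compose)
      then have "ext ab M permutes A" if "det M = 1" for M using ext that by blast
      moreover have "ext ab (M ** N) = ext ab M \<circ> ext ab N" if "det M = 1" "det N = 1" for M N
        by (rule presented_unique[of a b]) (use that rel in \<open>auto intro!: ext presented_mult simp: det_mul\<close>)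
      ultimately show "ext ab \<in> actions SL2Z UNIV A"
        by (auto simp: actions_def carrier mult) (simp add: ext_def ab)
    qed
    show "ext (\<phi> SS, \<phi> UU) = \<phi>" if \<phi>: "\<phi> \<in> actions SL2Z UNIV A" for \<phi>
    proof
      fix M show "ext (\<phi> SS, \<phi> UU) M = \<phi> M"
      proof (cases "det M = 1")
        case True
        then have "presented (\<phi> SS) (\<phi> UU) M (ext (\<phi> SS, \<phi> UU) M)"
          using someI_ex[OF presented_total[OF True, of "\<phi> SS" "\<phi> UU"]] by (simp add: ext_def)
        then show ?thesis using pres[OF \<phi>] by blast
      next
        case False
        then show ?thesis using actionsD(2)[OF \<phi>, of M] by (simp add: ext_def carrier)
      qed
    qed
    show "(ext p SS, ext p UU) = p" if p: "p \<in> ?P" for p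
    proof -
      obtain a b where ab: "p = (a, b)" and eqs: "a \<circ> a = b \<circ> b \<circ> b" "a \<circ> a \<circ> (a \<circ> a) = id"
        using p by blast
      have rel: "a (a x) = b (b (b x))" "a (a (a (a x))) = x" for x
        using fun_cong[OF eqs(1), of x] fun_cong[OF eqs(2), of x] unfolding o_apply id_apply .
      have "presented a b SS (ext p SS)" "presented a b UU (ext p UU)"
        using someI_ex[OF presented_total[of _ a b]] by (simp_all add: ext_def ab)
      then show ?thesis
        using presented_unique[OF rel] presented_SS[of a b] presented_UU[of a b] ab by blast
    qed
  qed
qed

section \<open>Counting roots of permutations\<close>

text \<open>\<open>Q\<close> is used only as the trivial condition and as \<open>(\<noteq>)\<close>,
  which excludes fixed points; with these two choices the same notion covers all five kinds of
  permutations to be counted.\<close>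

definition perm_roots :: "('a \<Rightarrow> 'a \<Rightarrow> bool) \<Rightarrow> nat \<Rightarrow> ('a \<Rightarrow> 'a) \<Rightarrow> 'a set \<Rightarrow> ('a \<Rightarrow> 'a) set" where
  "perm_roots Q k z A = {f. f permutes A \<and> (\<forall>x\<in>A. Q x (f x)) \<and> f ^^ k = z}"

lemma finite_perm_roots: "finite A \<Longrightarrow> finite (perm_roots Q k z A)"
  using finite_permutations[of A] by (rule rev_finite_subset) (auto simp: perm_roots_def)

text \<open>Once a cycle of the root is prescribed, the rest of the root is an arbitrary root on the
  remaining points. This is the inductive step of all the counts below, which differ only in the
  cycles possible at a chosen point.\<close>

lemma card_perm_roots_extending:
  assumes cs: "set cs \<subseteq> A" and z: "\<And>x. x \<notin> A \<Longrightarrow> z x = x"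
    and k: "\<And>x. x \<in> set cs \<Longrightarrow> (cycle_of_list cs ^^ k) x = z x"
    and Q: "\<And>x. x \<in> set cs \<Longrightarrow> Q x (cycle_of_list cs x)"
  shows "card {f \<in> perm_roots Q k z A. \<forall>x\<in>set cs. f x = cycle_of_list cs x} =
    card (perm_roots Q k (restrict_perm (A - set cs) z) (A - set cs))"
proof -
  define B c where "B = set cs" and "c = cycle_of_list cs"
  have c: "c permutes B" unfolding B_def c_def by (rule cycle_permutes)
  have BA: "B \<subseteq> A" using cs by (simp add: B_def)
  have cB: "(c ^^ j) x \<in> B" if "x \<in> B" for x j
    using that permutes_in_image[OF c] by (induction j) auto
  have "bij_betw (restrict_perm (A - B)) {f \<in> perm_roots Q k z A. \<forall>x\<in>B. f x = c x}
     (perm_roots Q k (restrict_perm (A - B) z) (A - B))"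
  proof (rule bij_betwI[where g = "\<lambda>g. c \<circ> g"])
    show "restrict_perm (A - B) \<in> {f \<in> perm_roots Q k z A. \<forall>x\<in>B. f x = c x} \<rightarrow>
       perm_roots Q k (restrict_perm (A - B) z) (A - B)"
    proof
      fix f assume "f \<in> {f \<in> perm_roots Q k z A. \<forall>x\<in>B. f x = c x}"
      then have f: "f permutes A" "\<And>x. x \<in> A \<Longrightarrow> Q x (f x)" "f ^^ k = z" "\<And>x. x \<in> B \<Longrightarrow> f x = c x"
        by (auto simp: perm_roots_def)
      have "f ` B = c ` B" using f(4) by (intro image_cong) auto
      then have "f ` B = B" using permutes_image[OF c] by simp
      then have im: "f ` (A - B) = A - B"
        using permutes_image[OF f(1)] image_set_diff[OF permutes_inj[OF f(1)]] by simp
      then have "bij_betw f (A - B) (A - B)"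
        using permutes_inj[OF f(1)] by (auto simp: bij_betw_def intro: inj_on_subset)
      then have perm: "restrict_perm (A - B) f permutes (A - B)" by (rule restrict_perm_permutes)
      have "(restrict_perm (A - B) f ^^ j) x = (if x \<in> A - B then (f ^^ j) x else x) \<and>
          (x \<in> A - B \<longrightarrow> (f ^^ j) x \<in> A - B)" for j x
        using im by (induction j) (auto simp: restrict_perm_def)
      then have "restrict_perm (A - B) f ^^ k = restrict_perm (A - B) z"
        using f(3) by (auto simp: fun_eq_iff restrict_perm_def)
      then show "restrict_perm (A - B) f \<in> perm_roots Q k (restrict_perm (A - B) z) (A - B)"
        using perm f(2) by (auto simp: perm_roots_def) (simp add: restrict_perm_def)
    qed
    show "(\<lambda>g. c \<circ> g) \<in> perm_roots Q k (restrict_perm (A - B) z) (A - B) \<rightarrow>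
       {f \<in> perm_roots Q k z A. \<forall>x\<in>B. f x = c x}"
    proof
      fix g assume "g \<in> perm_roots Q k (restrict_perm (A - B) z) (A - B)"
      then have g: "g permutes (A - B)" "\<And>x. x \<in> A - B \<Longrightarrow> Q x (g x)" "g ^^ k = restrict_perm (A - B) z"
        by (auto simp: perm_roots_def)
      have gB: "g x = x" if "x \<in> B" for x using permutes_not_in[OF g(1)] that by auto
      have cn: "c x = x" if "x \<notin> B" for x using permutes_not_in[OF c] that by auto
      have gAB: "g x \<in> A - B" if "x \<in> A - B" for x using permutes_in_image[OF g(1)] that by blast
      have cg: "c (g x) = g x" if "x \<in> A - B" for x using cn gAB[OF that] by blast
      have perm: "c \<circ> g permutes A"
        using permutes_compose[of g A c] permutes_subset[OF g(1)] permutes_subset[OF c BA] by auto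
      have "((c \<circ> g) ^^ j) x = (c ^^ j) x" if "x \<in> B" for j x
        using that gB cB by (induction j) auto
      moreover have "((c \<circ> g) ^^ j) x = (g ^^ j) x \<and> (g ^^ j) x \<in> A - B" if "x \<in> A - B" for j x
        using that gAB cg by (induction j) auto
      moreover have "((c \<circ> g) ^^ j) x = x" if "x \<notin> A" for j x
        using that permutes_not_in[OF perm that] by (induction j) auto
      ultimately have "(c \<circ> g) ^^ k = z"
        using g(3) k z BA unfolding B_def[symmetric] c_def[symmetric] fun_eq_iff restrict_perm_def
        by (metis DiffI)
      moreover have "Q x ((c \<circ> g) x)" if "x \<in> A" for x
        using that Q[of x] g(2)[of x] cg[of x] gB[of x] unfolding B_def[symmetric] c_def[symmetric]
        by (cases "x \<in> B") auto
      ultimately show "c \<circ> g \<in> {f \<in> perm_roots Q k z A. \<forall>x\<in>B. f x = c x}"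
        using perm gB by (auto simp: perm_roots_def)
    qed
    show "c \<circ> restrict_perm (A - B) f = f" if "f \<in> {f \<in> perm_roots Q k z A. \<forall>x\<in>B. f x = c x}" for f
    proof
      fix x
      have f: "f permutes A" "\<And>x. x \<in> B \<Longrightarrow> f x = c x"
        using that by (auto simp: perm_roots_def)
      have "f x \<notin> B" if "x \<notin> B"
      proof
        assume "f x \<in> B"
        then obtain y where "y \<in> B" "f x = c y" using permutes_image[OF c] by blast
        then have "f x = f y" using f(2) by simp
        then show False using permutes_inj[OF f(1)] \<open>y \<in> B\<close> that by (auto dest: injD)
      qed
      then show "(c \<circ> restrict_perm (A - B) f) x = f x"
        using f(2)[of x] permutes_not_in[OF f(1), of x] permutes_not_in[OF c, of x] permutes_not_in[OF c,
        of "f x"] BA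
        by (cases "x \<in> B"; cases "x \<in> A") (auto simp: restrict_perm_def)
    qed
    show "restrict_perm (A - B) (c \<circ> g) = g" if "g \<in> perm_roots Q k (restrict_perm (A - B) z) (A - B)" for g
    proof
      fix x
      have g: "g permutes (A - B)" using that by (auto simp: perm_roots_def)
      show "restrict_perm (A - B) (c \<circ> g) x = g x"
        using permutes_in_image[OF g, of x] permutes_not_in[OF g, of x] permutes_not_in[OF c, of "g x"]
        by (auto simp: restrict_perm_def)
    qed
  qed
  then show ?thesis unfolding B_def c_def by (rule bij_betw_same_card)
qed

lemma card_eq_sum_fibres:
  assumes "finite S" "finite I" "\<And>f. f \<in> S \<Longrightarrow> \<kappa> f \<in> I"
  shows "card S = (\<Sum>i\<in>I. card {f\<in>S. \<kappa> f = i})"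
  using sum.group[of S I \<kappa> "\<lambda>_. 1 :: nat"] assms by (simp add: image_subset_iff)

text \<open>Where truncation in an argument matters, the factor in front of the call is 0, except for odd
  arguments of the last two functions, where there is no fixed point free involution to take roots of.\<close>
fun involution_count :: "nat \<Rightarrow> nat" where
  "involution_count n = (if n = 0 then 1 else involution_count (n - 1) + (n - 1) * involution_count (n - 2))"

fun cube_root_count :: "nat \<Rightarrow> nat" where
  "cube_root_count n = (if n = 0 then 1 else cube_root_count (n - 1) + (n - 1) * (n
      - 2) * cube_root_count (n - 3))"

fun matching_count :: "nat \<Rightarrow> nat" where
  "matching_count n = (if n = 0 then 1 else (n - 1) * matching_count (n - 2))"

fun matching_sqrt_count :: "nat \<Rightarrow> nat" where
  "matching_sqrt_count n = (if n = 0 then 1 else (n - 2) * matching_sqrt_count (n - 4))"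

fun matching_cube_root_count :: "nat \<Rightarrow> nat" where
  "matching_cube_root_count n = (if n = 0 then 1 else
     matching_cube_root_count (n - 2) + (n - 2) * (n - 4) * matching_cube_root_count (n - 6))"

declare involution_count.simps [simp del] cube_root_count.simps [simp del] matching_count.simps [simp del]
  matching_sqrt_count.simps [simp del] matching_cube_root_count.simps [simp del]

lemma perm_roots_empty [simp]: "perm_roots Q k id {} = {id}"
  by (auto simp: perm_roots_def)

lemma restrict_perm_id [simp]: "restrict_perm A id = id"
  by (auto simp: restrict_perm_def)

lemma funpow_2_3: "f ^^ 2 = f \<circ> f" "f ^^ 3 = f \<circ> f \<circ> f"
  by (auto simp: numeral_2_eq_2 numeral_3_eq_3)

lemma cycle_of_list_4:
  "distinct [a, b, c, d] \<Longrightarrow> cycle_of_list [a, b, c, d] a = b \<and> cycle_of_list [a, b, c, d] b = c \<and>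
     cycle_of_list [a, b, c, d] c = d \<and> cycle_of_list [a, b, c, d] d = a"
  by (auto simp: transpose_def)

lemma cycle_of_list_6:
  "distinct [a, b, c, d, e, f] \<Longrightarrow> cycle_of_list [a, b, c, d, e, f] a = b \<and> cycle_of_list [a, b, c, d, e, f]
      b = c \<and>
     cycle_of_list [a, b, c, d, e, f] c = d \<and> cycle_of_list [a, b, c, d, e, f] d = e \<and>
     cycle_of_list [a, b, c, d, e, f] e = f \<and> cycle_of_list [a, b, c, d, e, f] f = a"
  by (auto simp: transpose_def)

lemma card_involutions:
  "finite A \<Longrightarrow> card (perm_roots (\<lambda>_ _. True) 2 id A) = involution_count (card A)"
proof (induction "card A" arbitrary: A rule: less_induct)
  case less
  show ?case
  proof (cases "A = {}")
    case True
    then show ?thesis by (simp add: involution_count.simps)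
  next
    case False
    then obtain x where x: "x \<in> A" by blast
    let ?S = "perm_roots (\<lambda>_ _. True) 2 id A"
    have fin: "finite ?S" using finite_perm_roots less.prems .
    have "card ?S = (\<Sum>y\<in>A. card {f\<in>?S. f x = y})"
      using x less.prems fin by (intro card_eq_sum_fibres) (auto simp: perm_roots_def permutes_in_image)
    also have "\<dots> = card {f\<in>?S. f x = x} + (\<Sum>y\<in>A - {x}. card {f\<in>?S. f x = y})"
      using x less.prems by (simp add: sum.remove)
    also have "{f\<in>?S. f x = x} = {f\<in>?S. \<forall>y\<in>set [x]. f y = cycle_of_list [x] y}" by auto
    also have "card \<dots> = involution_count (card A - 1)"
      using less.hyps[of "A - {x}"] less.prems x False
      by (subst card_perm_roots_extending) (auto simp: card_gt_0_iff)
    also have "(\<Sum>y\<in>A - {x}. card {f\<in>?S. f x = y}) = (\<Sum>y\<in>A - {x}. involution_count (card A - 2))"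
    proof (rule sum.cong[OF refl])
      fix y assume y: "y \<in> A - {x}"
      have "{f\<in>?S. f x = y} = {f\<in>?S. \<forall>u\<in>set [x, y]. f u = cycle_of_list [x, y] u}"
        by (auto simp: perm_roots_def funpow_2_3 fun_eq_iff)
      also have "card \<dots> = card (perm_roots (\<lambda>_ _. True) 2 (restrict_perm (A - set [x, y]) id) (A - set [x, y]))"
        using x y by (intro card_perm_roots_extending) (auto simp: funpow_2_3)
      also have "\<dots> = involution_count (card A - 2)"
      proof -
        have "card (A - set [x, y]) = card A - 2"
          using less.prems x y by (subst card_Diff_subset) auto
        moreover have "card (A - set [x, y]) < card A"
          using less.prems x by (intro psubset_card_mono) auto
        ultimately show ?thesis using less.hyps[of "A - set [x, y]"] less.prems by simp
      qed
      finally show "card {f\<in>?S. f x = y} = involution_count (card A - 2)" .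
    qed
    finally show ?thesis
      using less.prems x False by (simp add: involution_count.simps[of "card A"] id_def)
  qed
qed

lemma card_fixpoint_free_involutions:
  "finite A \<Longrightarrow> card (perm_roots (\<noteq>) 2 id A) = matching_count (card A)"
proof (induction "card A" arbitrary: A rule: less_induct)
  case less
  show ?case
  proof (cases "A = {}")
    case True
    then show ?thesis by (simp add: matching_count.simps)
  next
    case False
    then obtain x where x: "x \<in> A" by blast
    let ?S = "perm_roots (\<noteq>) 2 id A"
    have fin: "finite ?S" using finite_perm_roots less.prems .
    have "card ?S = (\<Sum>y\<in>A - {x}. card {f\<in>?S. f x = y})"
      using x less.prems fin by (intro card_eq_sum_fibres) (auto simp: perm_roots_def permutes_in_image)
    also have "\<dots> = (\<Sum>y\<in>A - {x}. matching_count (card A - 2))"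
    proof (rule sum.cong[OF refl])
      fix y assume y: "y \<in> A - {x}"
      have "{f\<in>?S. f x = y} = {f\<in>?S. \<forall>u\<in>set [x, y]. f u = cycle_of_list [x, y] u}"
        by (auto simp: perm_roots_def funpow_2_3 fun_eq_iff)
      also have "card \<dots> = card (perm_roots (\<noteq>) 2 (restrict_perm (A - set [x, y]) id) (A - set [x, y]))"
        using x y by (intro card_perm_roots_extending) (auto simp: funpow_2_3)
      also have "\<dots> = matching_count (card A - 2)"
      proof -
        have "card (A - set [x, y]) = card A - 2"
          using less.prems x y by (subst card_Diff_subset) auto
        moreover have "card (A - set [x, y]) < card A"
          using less.prems x by (intro psubset_card_mono) auto
        ultimately show ?thesis using less.hyps[of "A - set [x, y]"] less.prems by simp
      qed
      finally show "card {f\<in>?S. f x = y} = matching_count (card A - 2)" .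
    qed
    finally show ?thesis
      using less.prems x False by (simp add: matching_count.simps[of "card A"])
  qed
qed

text \<open>A chosen point \<open>x\<close> is fixed or lies on a 3-cycle, which is described by the
  ordered pair of its other points in the order in which they follow \<open>x\<close>.\<close>

lemma card_cube_roots_id:
  "finite A \<Longrightarrow> card (perm_roots (\<lambda>_ _. True) 3 id A) = cube_root_count (card A)"
proof (induction "card A" arbitrary: A rule: less_induct)
  case less
  show ?case
  proof (cases "A = {}")
    case True
    then show ?thesis by (simp add: cube_root_count.simps)
  next
    case False
    then obtain x where x: "x \<in> A" by blast
    let ?S = "perm_roots (\<lambda>_ _. True) 3 id A"
    let ?I = "Sigma (A - {x}) (\<lambda>y. A - {x, y})"
    have fin: "finite ?S" using finite_perm_roots less.prems .
    have "(f x, f (f x)) \<in> insert (x, x) ?I" if f: "f \<in> ?S" for f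
    proof -
      have p: "f permutes A" and 3: "f (f (f y)) = y" for y
        using f by (auto simp: perm_roots_def funpow_2_3 fun_eq_iff)
      have "f x \<in> A" "f (f x) \<in> A" using p x by (auto simp: permutes_in_image)
      then show ?thesis using 3 by auto metis+
    qed
    then have "card ?S = (\<Sum>i\<in>insert (x, x) ?I. card {f\<in>?S. (f x, f (f x)) = i})"
      using x less.prems fin by (intro card_eq_sum_fibres) auto
    also have "\<dots> = card {f\<in>?S. (f x, f (f x)) = (x, x)} + (\<Sum>i\<in>?I. card {f\<in>?S. (f x, f (f x)) = i})"
      using less.prems by (subst sum.insert) auto
    also have "{f\<in>?S. (f x, f (f x)) = (x, x)} = {f\<in>?S. \<forall>y\<in>set [x]. f y = cycle_of_list [x] y}" by auto
    also have "card \<dots> = cube_root_count (card A - 1)"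
      using less.hyps[of "A - {x}"] less.prems x False
      by (subst card_perm_roots_extending) (auto simp: card_gt_0_iff)
    also have "(\<Sum>i\<in>?I. card {f\<in>?S. (f x, f (f x)) = i}) = (\<Sum>i\<in>?I. cube_root_count (card A - 3))"
    proof (rule sum.cong[OF refl])
      fix i assume "i \<in> ?I"
      then obtain y w where i: "i = (y, w)" "y \<in> A" "w \<in> A" "y \<noteq> x" "w \<noteq> x" "y \<noteq> w" by auto
      have "{f\<in>?S. (f x, f (f x)) = i} = {f\<in>?S. \<forall>u\<in>set [x, y, w]. f u = cycle_of_list [x, y, w] u}"
        using i by (auto simp: perm_roots_def funpow_2_3 fun_eq_iff transpose_def)
      also have "card \<dots> = card (perm_roots (\<lambda>_ _. True) 3 (restrict_perm (A - set [x, y, w]) id) (A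
      - set [x, y, w]))"
        using x i by (intro card_perm_roots_extending) (auto simp: funpow_2_3 transpose_def)
      also have "\<dots> = cube_root_count (card A - 3)"
      proof -
        have "card (A - set [x, y, w]) = card A - 3"
          using less.prems x i by (subst card_Diff_subset) auto
        moreover have "card (A - set [x, y, w]) < card A"
          using less.prems x by (intro psubset_card_mono) auto
        ultimately show ?thesis using less.hyps[of "A - set [x, y, w]"] less.prems by simp
      qed
      finally show "card {f\<in>?S. (f x, f (f x)) = i} = cube_root_count (card A - 3)" .
    qed
    also have "\<dots> = (card A - 1) * (card A - 2) * cube_root_count (card A - 3)"
    proof -
      have "card (A - {x, y}) = card A - 2" if "y \<in> A - {x}" for y
        using that x less.prems by (subst card_Diff_subset) auto
      then have "card ?I = (card A - 1) * (card A - 2)"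
        using less.prems x by (simp add: card_SigmaI)
      then show ?thesis by simp
    qed
    finally show ?thesis
      using less.prems x False by (simp add: cube_root_count.simps[of "card A"] id_def)
  qed
qed

lemma fixpoint_free_involution_Diff:
  assumes z: "z \<in> perm_roots (\<noteq>) 2 id A" and B: "z ` B \<subseteq> B" "B \<subseteq> A"
  shows "restrict_perm (A - B) z \<in> perm_roots (\<noteq>) 2 id (A - B)"
proof -
  have p: "z permutes A" "\<And>x. x \<in> A \<Longrightarrow> z x \<noteq> x" and zz: "\<And>x. z (z x) = x"
    using z by (auto simp: perm_roots_def funpow_2_3 fun_eq_iff)
  have *: "z x \<in> A - B" if "x \<in> A - B" for x
    using that B(1) zz[of x] permutes_in_image[OF p(1), of x] by (metis DiffD1 DiffD2 DiffI image_subset_iff)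
  have "bij_betw z (A - B) (A - B)"
    by (rule bij_betwI[where g = z]) (use * zz in auto)
  then have "restrict_perm (A - B) z permutes (A - B)" by (rule restrict_perm_permutes)
  then show ?thesis
    using p(2) p(2)[symmetric] * zz
    by (auto simp: perm_roots_def funpow_2_3 fun_eq_iff) (auto simp: restrict_perm_def)
qed

text \<open>A square root \<open>f\<close> of \<open>z\<close> commutes with \<open>z\<close>, so
  the image \<open>y\<close> of \<open>x\<close> determines the whole 4-cycle x, y, z x, z y. Here
  \<open>y\<close> may be any point other than x and z x.\<close>

lemma card_sqrt_matching:
  "finite A \<Longrightarrow> z \<in> perm_roots (\<noteq>) 2 id A \<Longrightarrow>
    card (perm_roots (\<lambda>_ _. True) 2 z A) = matching_sqrt_count (card A)"
proof (induction "card A" arbitrary: A z rule: less_induct)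
  case less
  have z: "z permutes A" "\<And>x. x \<in> A \<Longrightarrow> z x \<noteq> x" and zz: "\<And>x. z (z x) = x"
    using less.prems by (auto simp: perm_roots_def funpow_2_3 fun_eq_iff)
  show ?case
  proof (cases "A = {}")
    case True
    then have "z = id" using z(1) by simp
    then show ?thesis using True by (simp add: matching_sqrt_count.simps)
  next
    case False
    then obtain x where x: "x \<in> A" by blast
    have zA: "z y \<in> A \<longleftrightarrow> y \<in> A" for y using permutes_in_image[OF z(1)] .
    have zi: "z y = z w \<longleftrightarrow> y = w" for y w using zz by metis
    let ?S = "perm_roots (\<lambda>_ _. True) 2 z A"
    have fin: "finite ?S" using finite_perm_roots less.prems(1) .
    have "f x \<in> A - {x, z x}" if f: "f \<in> ?S" for f
    proof -
      have p: "f permutes A" and 2: "f (f y) = z y" for y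
        using f by (auto simp: perm_roots_def funpow_2_3 fun_eq_iff)
      have "f x \<in> A" using p x by (auto simp: permutes_in_image)
      moreover have "f x \<noteq> x" using 2[of x] z(2)[OF x] by auto
      moreover have "f x \<noteq> z x"
        using 2[of x] \<open>f x \<noteq> x\<close> permutes_inj[OF p] by (metis injD)
      ultimately show ?thesis by auto
    qed
    then have "card ?S = (\<Sum>y\<in>A - {x, z x}. card {f\<in>?S. f x = y})"
      using less.prems fin by (intro card_eq_sum_fibres) auto
    also have "\<dots> = (\<Sum>y\<in>A - {x, z x}. matching_sqrt_count (card A - 4))"
    proof (rule sum.cong[OF refl])
      fix y assume "y \<in> A - {x, z x}"
      then have y: "y \<in> A" "y \<noteq> x" "y \<noteq> z x" by auto
      let ?B = "[x, y, z x, z y]"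
      have dist: "x \<noteq> z x" "y \<noteq> z y" "z y \<noteq> x" using z(2) x y zz by metis+
      define c where "c = cycle_of_list ?B"
      have c: "c x = y" "c y = z x" "c (z x) = z y" "c (z y) = x"
        using cycle_of_list_4[of x y "z x" "z y"] dist y zi unfolding c_def by auto
      have 1: "{f\<in>?S. f x = y} = {f\<in>?S. \<forall>u\<in>set ?B. f u = c u}"
      proof (intro Collect_cong conj_cong refl)
        fix f assume f: "f \<in> ?S"
        have ff: "f (f u) = z u" for u using f by (auto simp: perm_roots_def funpow_2_3 fun_eq_iff)
        then have "f (z u) = z (f u)" for u by metis
        then show "f x = y \<longleftrightarrow> (\<forall>u\<in>set ?B. f u = c u)"
          using c ff[of x] ff[of "z x"] zz by auto
      qed
      have 2: "card {f\<in>?S. \<forall>u\<in>set ?B. f u = c u} =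
          card (perm_roots (\<lambda>_ _. True) 2 (restrict_perm (A - set ?B) z) (A - set ?B))"
        unfolding c_def
      proof (rule card_perm_roots_extending)
        show "set ?B \<subseteq> A" using x y by (simp add: zA)
        show "(cycle_of_list ?B ^^ 2) u = z u" if "u \<in> set ?B" for u
          using that c unfolding c_def[symmetric] by (auto simp: funpow_2_3 zz)
      qed (auto simp: permutes_not_in[OF z(1)])
      have 3: "card (perm_roots (\<lambda>_ _. True) 2 (restrict_perm (A - set ?B) z) (A - set ?B)) =
          matching_sqrt_count (card A - 4)"
      proof -
        have "card (A - set ?B) = card A - 4"
          using less.prems(1) x y dist zi by (subst card_Diff_subset) (auto simp: zA)
        moreover have "card (A - set ?B) < card A"
          using less.prems(1) x by (intro psubset_card_mono) auto
        moreover have "restrict_perm (A - set ?B) z \<in> perm_roots (\<noteq>) 2 id (A - set ?B)"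
          by (rule fixpoint_free_involution_Diff[OF less.prems(2)]) (use x y zz in \<open>auto simp: zA\<close>)
        ultimately show ?thesis using less.hyps[of "A - set ?B"] less.prems(1) by simp
      qed
      show "card {f\<in>?S. f x = y} = matching_sqrt_count (card A - 4)"
        by (simp only: 1 2 3)
    qed
    also have "\<dots> = (card A - 2) * matching_sqrt_count (card A - 4)"
      using less.prems(1) x z(2)[OF x] by (simp add: card_Diff_subset zA numeral_2_eq_2)
    finally show ?thesis
      using less.prems x False by (simp add: matching_sqrt_count.simps[of "card A"])
  qed
qed

text \<open>A cube root \<open>f\<close> of \<open>z\<close> commutes with \<open>z\<close> and so
  permutes the 2-cycles of \<open>z\<close>, with cube the identity there. Either the 2-cycle of
  \<open>x\<close> is preserved, and then \<open>f\<close> swaps its points, or three 2-cycles are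
  joined to a 6-cycle x, y, w, z x, z y, z w, with n - 2 choices for \<open>y\<close> and n - 4 for
  \<open>w\<close>.\<close>

lemma card_cube_root_matching:
  "finite A \<Longrightarrow> z \<in> perm_roots (\<noteq>) 2 id A \<Longrightarrow>
    card (perm_roots (\<lambda>_ _. True) 3 z A) = matching_cube_root_count (card A)"
proof (induction "card A" arbitrary: A z rule: less_induct)
  case less
  have z: "z permutes A" "\<And>x. x \<in> A \<Longrightarrow> z x \<noteq> x" and zz: "\<And>x. z (z x) = x"
    using less.prems by (auto simp: perm_roots_def funpow_2_3 fun_eq_iff)
  show ?case
  proof (cases "A = {}")
    case True
    then have "z = id" using z(1) by simp
    then show ?thesis using True by (simp add: matching_cube_root_count.simps)
  next
    case False
    then obtain x where x: "x \<in> A" by blast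
    have zA: "z y \<in> A \<longleftrightarrow> y \<in> A" for y using permutes_in_image[OF z(1)] .
    have zi: "z y = z w \<longleftrightarrow> y = w" for y w using zz by metis
    let ?S = "perm_roots (\<lambda>_ _. True) 3 z A"
    let ?I = "Sigma (A - {x, z x}) (\<lambda>y. A - {x, z x, y, z y})"
    have fin: "finite ?S" using finite_perm_roots less.prems(1) .
    have fz: "f (z y) = z (f y)" if f: "f \<in> ?S" for f y
    proof -
      have "f (f (f y)) = z y" for y
        using f by (auto simp: perm_roots_def funpow_2_3 fun_eq_iff)
      then show ?thesis by metis
    qed
    have "(f x, f (f x)) \<in> insert (z x, x) ?I" if f: "f \<in> ?S" for f
    proof -
      have p: "f permutes A" and 3: "f (f (f y)) = z y" for y
        using f by (auto simp: perm_roots_def funpow_2_3 fun_eq_iff)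
      note inj = injD[OF permutes_inj[OF p]]
      have A: "f x \<in> A" "f (f x) \<in> A" using p x by (auto simp: permutes_in_image)
      have 1: "f x \<noteq> x" using 3[of x] z(2)[OF x] by auto
      show ?thesis
      proof (cases "f x = z x")
        case True
        then have "f (f x) = x" using fz[OF f, of x] zz by simp
        then show ?thesis using True by simp
      next
        case False
        have "f (f x) \<noteq> x" using 3[of x] False by auto
        moreover have "f (f x) \<noteq> z x" using 3[of x] 1 inj by metis
        moreover have "f (f x) \<noteq> f x" using inj 1 by metis
        moreover have "f (f x) \<noteq> z (f x)"
          using fz[OF f, of x] inj[of "f x" "z x"] False by metis
        ultimately show ?thesis using A 1 False by auto
      qed
    qed
    then have "card ?S = (\<Sum>i\<in>insert (z x, x) ?I. card {f\<in>?S. (f x, f (f x)) = i})"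
      using less.prems fin by (intro card_eq_sum_fibres) auto
    also have "\<dots> = card {f\<in>?S. (f x, f (f x)) = (z x, x)} + (\<Sum>i\<in>?I. card {f\<in>?S. (f x, f (f x)) = i})"
      using less.prems by (subst sum.insert) auto
    also have "{f\<in>?S. (f x, f (f x)) = (z x, x)} = {f\<in>?S. \<forall>y\<in>set [x, z x]. f y = cycle_of_list [x, z x] y}"
      by auto
    also have "card \<dots> = matching_cube_root_count (card A - 2)"
    proof -
      let ?B = "[x, z x]"
      have "card {f\<in>?S. \<forall>y\<in>set ?B. f y = cycle_of_list ?B y} =
          card (perm_roots (\<lambda>_ _. True) 3 (restrict_perm (A - set ?B) z) (A - set ?B))"
        using x permutes_not_in[OF z(1)]
        by (intro card_perm_roots_extending) (auto simp: funpow_2_3 transpose_def zz zA)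
      moreover have "card (A - set ?B) = card A - 2"
        using less.prems(1) x z(2)[OF x] by (subst card_Diff_subset) (auto simp: zA)
      moreover have "card (A - set ?B) < card A"
        using less.prems(1) x by (intro psubset_card_mono) auto
      moreover have "restrict_perm (A - set ?B) z \<in> perm_roots (\<noteq>) 2 id (A - set ?B)"
        by (rule fixpoint_free_involution_Diff[OF less.prems(2)]) (use x zz in \<open>auto simp: zA\<close>)
      ultimately show ?thesis using less.hyps[of "A - set ?B"] less.prems(1) by simp
    qed
    also have "(\<Sum>i\<in>?I. card {f\<in>?S. (f x, f (f x)) = i}) = (\<Sum>i\<in>?I. matching_cube_root_count (card A - 6))"
    proof (rule sum.cong[OF refl])
      fix i assume "i \<in> ?I"
      then obtain y w where i: "i = (y, w)" and y: "y \<in> A" "y \<noteq> x" "y \<noteq> z x"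
        and w: "w \<in> A" "w \<noteq> x" "w \<noteq> z x" "w \<noteq> y" "w \<noteq> z y" by auto
      have dist: "x \<noteq> z x" "y \<noteq> z y" "w \<noteq> z w" "z y \<noteq> x" "z w \<noteq> x" "z w \<noteq> y"
        using z(2) x y w zz by metis+
      let ?B = "[x, y, w, z x, z y, z w]"
      define c where "c = cycle_of_list ?B"
      have c: "c x = y" "c y = w" "c w = z x" "c (z x) = z y" "c (z y) = z w" "c (z w) = x"
        using cycle_of_list_6[of x y w "z x" "z y" "z w"] dist y w zi unfolding c_def by auto
      have 1: "{f\<in>?S. (f x, f (f x)) = i} = {f\<in>?S. \<forall>u\<in>set ?B. f u = c u}"
      proof (intro Collect_cong conj_cong refl)
        fix f assume f: "f \<in> ?S"
        have "f (f (f x)) = z x" using f by (auto simp: perm_roots_def funpow_2_3 fun_eq_iff)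
        then show "(f x, f (f x)) = i \<longleftrightarrow> (\<forall>u\<in>set ?B. f u = c u)"
          using c fz[OF f] by (auto simp: i zz)
      qed
      have 2: "card {f\<in>?S. \<forall>u\<in>set ?B. f u = c u} =
          card (perm_roots (\<lambda>_ _. True) 3 (restrict_perm (A - set ?B) z) (A - set ?B))"
        unfolding c_def
      proof (rule card_perm_roots_extending)
        show "set ?B \<subseteq> A" using x y w by (simp add: zA)
        show "(cycle_of_list ?B ^^ 3) u = z u" if "u \<in> set ?B" for u
          using that c unfolding c_def[symmetric] by (auto simp: funpow_2_3 zz)
      qed (auto simp: permutes_not_in[OF z(1)])
      have 3: "card (perm_roots (\<lambda>_ _. True) 3 (restrict_perm (A - set ?B) z) (A - set ?B)) =
          matching_cube_root_count (card A - 6)"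
      proof -
        have "card (A - set ?B) = card A - 6"
          using less.prems(1) x y w dist zi by (subst card_Diff_subset) (auto simp: zA)
        moreover have "card (A - set ?B) < card A"
          using less.prems(1) x by (intro psubset_card_mono) auto
        moreover have "restrict_perm (A - set ?B) z \<in> perm_roots (\<noteq>) 2 id (A - set ?B)"
          by (rule fixpoint_free_involution_Diff[OF less.prems(2)]) (use x y w zz in \<open>auto simp: zA\<close>)
        ultimately show ?thesis using less.hyps[of "A - set ?B"] less.prems(1) by simp
      qed
      show "card {f\<in>?S. (f x, f (f x)) = i} = matching_cube_root_count (card A - 6)"
        by (simp only: 1 2 3)
    qed
    also have "\<dots> = card ?I * matching_cube_root_count (card A - 6)"
      by simp
    also have "card ?I = (\<Sum>y\<in>A - {x, z x}. card (A - {x, z x, y, z y}))"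
      using less.prems(1) by (intro card_SigmaI) auto
    also have "\<dots> = (\<Sum>y\<in>A - {x, z x}. card A - 4)"
    proof (rule sum.cong[OF refl])
      fix y assume "y \<in> A - {x, z x}"
      then have y: "y \<in> A" "y \<noteq> x" "y \<noteq> z x" by auto
      have "x \<noteq> z x" "y \<noteq> z y" "z y \<noteq> x" using z(2) x y zz by metis+
      then show "card (A - {x, z x, y, z y}) = card A - 4"
        using less.prems(1) x y zi by (subst card_Diff_subset) (auto simp: zA)
    qed
    also have "\<dots> = (card A - 2) * (card A - 4)"
      using less.prems(1) x z(2)[OF x] by (simp add: card_Diff_subset zA numeral_2_eq_2)
    finally show ?thesis
      using less.prems x False by (simp add: matching_cube_root_count.simps[of "card A"])
  qed
qed

section \<open>Generating functions\<close>

unbundle no vec_syntax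

text \<open>The differential equations hold for rational generating functions, but the logarithmic
  derivatives have integer coefficients. Injectivity of this map returns the resulting equations to
  integral series, where congruences make sense.\<close>

definition fps_of_int_fps :: "int fps \<Rightarrow> 'a::comm_ring_1 fps" where
  "fps_of_int_fps f = Abs_fps (\<lambda>n. of_int (f $ n))"

lemma fps_of_int_fps_nth [simp]: "fps_of_int_fps f $ n = of_int (f $ n)"
  by (simp add: fps_of_int_fps_def)

lemma fps_of_int_fps_simps:
  "fps_of_int_fps (f + g) = fps_of_int_fps f + fps_of_int_fps g"
  "fps_of_int_fps (f - g) = fps_of_int_fps f - fps_of_int_fps g"
  "fps_of_int_fps (- f) = - fps_of_int_fps f"
  "fps_of_int_fps (f * g) = fps_of_int_fps f * fps_of_int_fps g"
  "fps_of_int_fps (fps_deriv f) = fps_deriv (fps_of_int_fps f)"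
  "fps_of_int_fps fps_X = fps_X"
  "fps_of_int_fps 0 = 0" "fps_of_int_fps 1 = 1" "fps_of_int_fps (numeral k) = numeral k"
  by (simp_all add: fps_eq_iff fps_mult_nth fps_X_def fps_numeral_nth)

lemma fps_of_int_fps_power: "fps_of_int_fps (f ^ n) = fps_of_int_fps f ^ n"
  by (induction n) (simp_all add: fps_of_int_fps_simps)

lemma fps_of_int_fps_eq_0_iff: "fps_of_int_fps f = (0 :: 'a::{comm_ring_1, ring_char_0} fps) \<longleftrightarrow> f = 0"
  by (auto simp: fps_eq_iff)

text \<open>After division by n! the binomial convolution becomes a Cauchy product. The shift by one
  makes the series of \<open>s\<close> exactly the logarithmic derivative.\<close>

lemma fps_deriv_egf:
  fixes h s :: "nat \<Rightarrow> nat"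
  assumes "\<And>n. h (Suc n) = (\<Sum>k\<le>n. (n choose k) * (fact k * s (Suc k) * h (n - k)))"
  shows "fps_deriv (Abs_fps (\<lambda>n. of_nat (h n) / fact n)) =
    fps_of_int_fps (Abs_fps (\<lambda>n. int (s (Suc n)))) * (Abs_fps (\<lambda>n. of_nat (h n) / fact n) :: rat fps)"
proof (rule fps_ext)
  fix n
  have "fps_deriv (Abs_fps (\<lambda>n. of_nat (h n) / fact n)) $ n = (of_nat (h (Suc n)) / fact n :: rat)"
    by (simp del: of_nat_Suc)
  also have "\<dots> = (\<Sum>k\<le>n. of_nat (s (Suc k)) * (of_nat (h (n - k)) / fact (n - k)))"
    unfolding assms of_nat_sum sum_divide_distrib
  proof (rule sum.cong[OF refl])
    fix k assume "k \<in> {..n}"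
    then have "of_nat (n choose k) * (fact k * fact (n - k)) = (fact n :: rat)"
      by (simp add: binomial_fact)
    then show "of_nat ((n choose k) * (fact k * s (Suc k) * h (n - k))) / fact n =
        (of_nat (s (Suc k)) * (of_nat (h (n - k)) / fact (n - k)) :: rat)"
      by (simp add: field_simps)
  qed
  also have "\<dots> = (fps_of_int_fps (Abs_fps (\<lambda>n. int (s (Suc n)))) * Abs_fps (\<lambda>n. of_nat (h n) / fact n)) $ n"
    by (simp add: fps_mult_nth atLeast0AtMost)
  finally show "fps_deriv (Abs_fps (\<lambda>n. of_nat (h n) / fact n)) $ n =
    (fps_of_int_fps (Abs_fps (\<lambda>n. int (s (Suc n)))) * (Abs_fps (\<lambda>n. of_nat (h n) / fact n) :: rat fps)) $ n" .
qed

section \<open>The differential equation for P\<close>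

text \<open>All terms are combinations of i0, i1 and of c0, c1, c2, so the products lie in a space
  of dimension 6 over the rational functions in n and satisfy linear relations. This one has leading
  coefficient 1, which later becomes the invertible coefficient -1 of the derivative. Its nested
  factors n + 8, n + 7, ... cancel against the factorials of the exponential generating
  function.\<close>

lemma product_recurrence:
  fixes n :: rat
  assumes i: "i2 = i1 + (n + 1) * i0" "i3 = i2 + (n + 2) * i1" "i4 = i3 + (n + 3) * i2"
      "i5 = i4 + (n + 4) * i3" "i6 = i5 + (n + 5) * i4" "i7 = i6 + (n + 6) * i5"
      "i8 = i7 + (n + 7) * i6" "i9 = i8 + (n + 8) * i7"
    and c: "c3 = c2 + (n + 2) * (n + 1) * c0" "c4 = c3 + (n + 3) * (n + 2) * c1"
      "c5 = c4 + (n + 4) * (n + 3) * c2" "c6 = c5 + (n + 5) * (n + 4) * c3"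
      "c7 = c6 + (n + 6) * (n + 5) * c4" "c8 = c7 + (n + 7) * (n + 6) * c5"
      "c9 = c8 + (n + 8) * (n + 7) * c6"
  shows "i9 * c9 = i8 * c8 + (n + 8) * (i7 * c7
     + (n + 7) * ((4 * n + 28) * (i6 * c6)
     + (n + 6) * ((2 * n + 14) * (i5 * c5)
     + (n + 5) * (- i4 * c4
     + (n + 4) * (((n + 3) * (n + 2) + 4 * (n + 3) + 4) * (i3 * c3)
     + (n + 3) * ((- 2 * (n + 2) - 2) * (i2 * c2)
     + (n + 2) * (n + 1) * ((- n * (n - 1) - 4 * n - 2) * (i0 * c0))))))))"
  unfolding i c by algebra

abbreviation hP :: "nat \<Rightarrow> nat" where "hP n \<equiv> involution_count n * cube_root_count n"

lemma involution_count_rec: "involution_count (n + 2) = involution_count (n + 1) + (n + 1) * involution_count n"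
  by (subst involution_count.simps) simp

lemma cube_root_count_rec:
  "cube_root_count (n + 3) = cube_root_count (n + 2) + (n + 2) * (n + 1) * cube_root_count n"
  by (subst cube_root_count.simps) (simp add: numeral_eq_Suc)

lemma hP_recurrence:
  fixes n :: nat
  defines "h \<equiv> \<lambda>j. of_nat (hP (n + j)) :: rat" and "N \<equiv> of_nat n"
  shows "h 9 = h 8 + (N + 8) * (h 7
     + (N + 7) * ((4 * N + 28) * h 6
     + (N + 6) * ((2 * N + 14) * h 5
     + (N + 5) * (- h 4
     + (N + 4) * (((N + 3) * (N + 2) + 4 * (N + 3) + 4) * h 3
     + (N + 3) * ((- 2 * (N + 2) - 2) * h 2
     + (N + 2) * (N + 1) * ((- N * (N - 1) - 4 * N - 2) * h 0)))))))"
proof -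
  define i c where "i = (\<lambda>j. of_nat (involution_count (n + j)) :: rat)"
      and "c = (\<lambda>j. of_nat (cube_root_count (n + j)) :: rat)"
  have i: "i (j + 2) = i (j + 1) + (N + of_nat j + 1) * i j" for j
    using involution_count_rec[of "n + j"] by (simp add: i_def N_def algebra_simps)
  have c: "c (j + 3) = c (j + 2) + (N + of_nat j + 2) * (N + of_nat j + 1) * c j" for j
    using cube_root_count_rec[of "n + j"] by (simp add: c_def N_def algebra_simps)
  have i2: "i 2 = i 1 + (N + 1) * i 0" using i[of 0] by (simp add: algebra_simps numeral_2_eq_2)
  have i3: "i 3 = i 2 + (N + 2) * i 1" using i[of 1] by (simp add: algebra_simps del: One_nat_def)
  have i4: "i 4 = i 3 + (N + 3) * i 2" using i[of 2] by (simp add: algebra_simps del: One_nat_def)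
  have i5: "i 5 = i 4 + (N + 4) * i 3" using i[of 3] by (simp add: algebra_simps del: One_nat_def)
  have i6: "i 6 = i 5 + (N + 5) * i 4" using i[of 4] by (simp add: algebra_simps del: One_nat_def)
  have i7: "i 7 = i 6 + (N + 6) * i 5" using i[of 5] by (simp add: algebra_simps del: One_nat_def)
  have i8: "i 8 = i 7 + (N + 7) * i 6" using i[of 6] by (simp add: algebra_simps del: One_nat_def)
  have i9: "i 9 = i 8 + (N + 8) * i 7" using i[of 7] by (simp add: algebra_simps del: One_nat_def)
  have c3: "c 3 = c 2 + (N + 2) * (N + 1) * c 0" using c[of 0] by (simp add: algebra_simps numeral_2_eq_2)
  have c4: "c 4 = c 3 + (N + 3) * (N + 2) * c 1" using c[of 1] by (simp add: algebra_simps del: One_nat_def)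
  have c5: "c 5 = c 4 + (N + 4) * (N + 3) * c 2" using c[of 2] by (simp add: algebra_simps del: One_nat_def)
  have c6: "c 6 = c 5 + (N + 5) * (N + 4) * c 3" using c[of 3] by (simp add: algebra_simps del: One_nat_def)
  have c7: "c 7 = c 6 + (N + 6) * (N + 5) * c 4" using c[of 4] by (simp add: algebra_simps del: One_nat_def)
  have c8: "c 8 = c 7 + (N + 7) * (N + 6) * c 5" using c[of 5] by (simp add: algebra_simps del: One_nat_def)
  have c9: "c 9 = c 8 + (N + 8) * (N + 7) * c 6" using c[of 6] by (simp add: algebra_simps del: One_nat_def)
  have "i 9 * c 9 = i 8 * c 8 + (N + 8) * (i 7 * c 7
     + (N + 7) * ((4 * N + 28) * (i 6 * c 6)
     + (N + 6) * ((2 * N + 14) * (i 5 * c 5)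
     + (N + 5) * (- i 4 * c 4
     + (N + 4) * (((N + 3) * (N + 2) + 4 * (N + 3) + 4) * (i 3 * c 3)
     + (N + 3) * ((- 2 * (N + 2) - 2) * (i 2 * c 2)
     + (N + 2) * (N + 1) * ((- N * (N - 1) - 4 * N - 2) * (i 0 * c 0))))))))"
    by (rule product_recurrence[OF i2 i3 i4 i5 i6 i7 i8 i9 c3 c4 c5 c6 c7 c8 c9])
  then show ?thesis by (simp add: h_def i_def c_def)
qed

lemma numeral_mult_fps_nth: "fps_nth (numeral k * f) n = numeral k * fps_nth f n"
  by (simp add: numeral_fps_const)

lemma X2_deriv2_nth: "fps_nth (fps_X ^ 2 * fps_deriv (fps_deriv P)) k = of_nat k * (of_nat k
    - 1) * fps_nth (P :: rat fps) k"
proof (cases "k < 2")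
  case True
  then have "k = 0 \<or> k = 1" by auto
  then show ?thesis by (auto simp: fps_X_power_mult_nth)
next
  case False
  then obtain j where "k = j + 2" by (metis add.commute le_Suc_ex not_less)
  then show ?thesis by (simp add: fps_X_power_mult_nth numeral_2_eq_2 algebra_simps)
qed

lemma inverse_fact_Suc: "m = n + 1 \<Longrightarrow> 1 / fact n = (of_nat n + 1) * (1 / fact m :: rat)"
  by (simp add: divide_simps)

lemma less_8_cases: "N < (8::nat) \<Longrightarrow> N = 0 \<or> N = 1 \<or> N = 2 \<or> N = 3 \<or> N = 4 \<or> N = 5 \<or> N = 6 \<or> N = 7"
  by auto

text \<open>The coefficient of z^(n+8) is \<open>hP_recurrence\<close> divided by (n + 8)!. The
  first eight coefficients are compared numerically.\<close>

lemma hP_ode: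
  fixes P :: "rat fps"
  defines "P \<equiv> Abs_fps (\<lambda>n. of_nat (hP n) / fact n)"
  shows "(fps_X ^ 7 - fps_X ^ 10) * fps_deriv (fps_deriv P) +
    (-1 + 4 * fps_X ^ 3 + 2 * fps_X ^ 4 + 4 * fps_X ^ 6 - 2 * fps_X ^ 7 - 4 * fps_X ^ 9) * fps_deriv P +
    (1 + fps_X + 4 * fps_X ^ 2 + 4 * fps_X ^ 3 - fps_X ^ 4 + 4 * fps_X ^ 5 - 2 * fps_X ^ 6
        - 2 * fps_X ^ 8) * P = 0"
    (is "?L = 0")
proof (rule fps_ext)
  fix N
  show "?L $ N = 0 $ N"
  proof (cases "N < 8")
    case True
    have i: "involution_count 0 = 1" "involution_count 1 = 1" "involution_count (Suc 0) = 1"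
        "involution_count 2 = 2" "involution_count 3 = 4"
      "involution_count 4 = 10" "involution_count 5 = 26" "involution_count 6 = 76" "involution_count 7 =
      232" "involution_count 8 = 764"
      by (simp_all add: involution_count.simps)
    have c: "cube_root_count 0 = 1" "cube_root_count 1 = 1" "cube_root_count (Suc 0) = 1" "cube_root_count
        2 = 1" "cube_root_count 3 = 3"
      "cube_root_count 4 = 9" "cube_root_count 5 = 21" "cube_root_count 6 = 81" "cube_root_count 7 = 351"
      "cube_root_count 8 = 1233"
      by (simp_all add: cube_root_count.simps)
    from True show ?thesis
      by (auto dest!: less_8_cases simp: P_def ring_distribs fps_X_power_mult_nth mult.assoc i c fact_numeral
          numeral_mult_fps_nth simp del: One_nat_def)
  next
    case False
    then obtain n where N: "N = n + 8" by (metis add.commute le_Suc_ex not_less)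
    \<comment> \<open>All reciprocal factorials are expressed through this one, after which
      \<open>algebra\<close> can compare with the recurrence.\<close>
    define g :: rat where "g = 1 / fact (n + 8)"
    define x :: rat where "x = of_nat n"
    define r :: "nat \<Rightarrow> rat" where "r = (\<lambda>j. 1 / fact j)"
    have r: "r j = (of_nat j + 1) * r m" if "m = j + 1" for j m
      unfolding r_def using inverse_fact_Suc[OF that] .
    have rg: "r (n + 8) = g" by (simp add: r_def g_def)
    have g: "r (n + 8) = g" "r (n + 7) = (x + 8) * g" "r (n + 6) = (x + 7) * r (n + 7)" "r (n + 5) = (x
        + 6) * r (n + 6)"
       "r (n + 4) = (x + 5) * r (n + 5)" "r (n + 3) = (x + 4) * r (n + 4)" "r (n + 2) = (x + 3) * r (n + 3)"
       "r n = (x + 1) * ((x + 2) * r (n + 2))" "g = (x + 9) * r (n + 9)"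
      using r[of "n + 8" "n + 7"] r[of "n + 7" "n + 6"] r[of "n + 6" "n + 5"] r[of "n + 5" "n + 4"]
        r[of "n + 4" "n + 3"] r[of "n + 3" "n + 2"] r[of "n + 2" "n + 1"] r[of "n + 1" n] r[of "n + 9" "n + 8"]
      by (simp_all add: rg x_def add.assoc)
    define h where "h = (\<lambda>j. of_nat (hP (n + j)) :: rat)"
    have Pn: "P $ (n + j) = h j * r (n + j)" for j
      by (simp add: P_def h_def r_def)
    have "?L $ N = (x + 3) * (x + 2) * P $ (n + 3) - x * (x - 1) * P $ n
      - (x + 9) * P $ (n + 9) + 4 * (x + 6) * P $ (n + 6) + 2 * (x + 5) * P $ (n + 5) + 4 * (x
      + 3) * P $ (n + 3)
      - 2 * (x + 2) * P $ (n + 2) - 4 * x * P $ n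
      + P $ (n + 8) + P $ (n + 7) + 4 * P $ (n + 6) + 4 * P $ (n + 5) - P $ (n + 4) + 4 * P $ (n + 3)
      - 2 * P $ (n + 2) - 2 * P $ n"
    proof -
      \<comment> \<open>The coefficients k(k - 1) P_k of z^2 P'' involve no shift of the index,
        which avoids case distinctions for small exponents.\<close>
      define W where "W = fps_X ^ 2 * fps_deriv (fps_deriv P)"
      have W: "W $ k = of_nat k * (of_nat k - 1) * P $ k" for k
        unfolding W_def by (rule X2_deriv2_nth)
      have "(fps_X ^ 7 - fps_X ^ 10) * fps_deriv (fps_deriv P) = fps_X ^ 5 * W - fps_X ^ 8 * W"
        by (simp add: W_def left_diff_distrib mult.assoc[symmetric] flip: power_add)
      then show ?thesis
        unfolding N by (simp add: ring_distribs fps_X_power_mult_nth mult.assoc numeral_mult_fps_nth W x_def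
            del: fps_deriv_nth) (simp add: algebra_simps numeral_3_eq_3)
    qed
    also have "\<dots> = 0"
    proof -
      have h9: "h 9 = h 8 + (x + 8) * (h 7 + (x + 7) * ((4 * x + 28) * h 6 + (x + 6) * ((2 * x + 14) * h 5
         + (x + 5) * (- h 4 + (x + 4) * (((x + 3) * (x + 2) + 4 * (x + 3) + 4) * h 3
         + (x + 3) * ((- 2 * (x + 2) - 2) * h 2 + (x + 2) * (x + 1) * ((- x * (x - 1) - 4 * x - 2) * h 0)))))))"
        using hP_recurrence[of n] by (simp add: h_def x_def)
      have "(x + 9) * P $ (n + 9) = h 9 * g" "P $ (n + 8) = h 8 * g" "P $ n = h 0 * r n"
        using g(1,9) Pn[of 8] Pn[of 9] Pn[of 0] by simp_all
      then show ?thesis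
        using Pn[of 2] Pn[of 3] Pn[of 4] Pn[of 5] Pn[of 6] Pn[of 7]
        unfolding g(2-8) h9 by algebra
    qed
    finally show ?thesis by simp
  qed
qed

text \<open>P' = SP gives P'' = (S' + S^2) P, and P, with constant term 1, can be cancelled.\<close>

lemma P_riccati:
  fixes s :: "nat \<Rightarrow> nat"
  assumes s: "\<And>n. hP (Suc n) = (\<Sum>k\<le>n. (n choose k) * (fact k * s (Suc k) * hP (n - k)))"
  defines "S \<equiv> Abs_fps (\<lambda>n. int (s (Suc n)))"
  shows "(fps_X ^ 7 - fps_X ^ 10) * (fps_deriv S + S ^ 2) +
    (-1 + 4 * fps_X ^ 3 + 2 * fps_X ^ 4 + 4 * fps_X ^ 6 - 2 * fps_X ^ 7 - 4 * fps_X ^ 9) * S +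
    (1 + fps_X + 4 * fps_X ^ 2 + 4 * fps_X ^ 3 - fps_X ^ 4 + 4 * fps_X ^ 5 - 2 * fps_X ^ 6 - 2 * fps_X ^ 8) = 0"
    (is "?L = 0")
proof -
  define P where "P = (Abs_fps (\<lambda>n. of_nat (hP n) / fact n) :: rat fps)"
  define \<sigma> where "\<sigma> = (fps_of_int_fps S :: rat fps)"
  have P1: "fps_deriv P = \<sigma> * P"
    unfolding P_def \<sigma>_def S_def using fps_deriv_egf[of hP s, OF s] .
  have P2: "fps_deriv (fps_deriv P) = (fps_deriv \<sigma> + \<sigma> ^ 2) * P"
    by (simp add: P1 algebra_simps power2_eq_square)
  have "P $ 0 = 1" by (simp add: P_def involution_count.simps cube_root_count.simps)
  then have P0: "P \<noteq> 0" by auto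
  have "fps_of_int_fps ?L * P = (0 :: rat fps)"
    using hP_ode[folded P_def, unfolded P2, unfolded P1]
    by (simp add: fps_of_int_fps_simps fps_of_int_fps_power \<sigma>_def[symmetric] algebra_simps)
  then have "fps_of_int_fps ?L = (0 :: rat fps)" using P0 by simp
  then show ?thesis by (simp only: fps_of_int_fps_eq_0_iff)
qed

section \<open>The differential equation for Q\<close>

abbreviation hQ :: "nat \<Rightarrow> nat" where
  "hQ n \<equiv> matching_count n * matching_sqrt_count n * matching_cube_root_count n"

lemma matching_count_odd: "matching_count (2 * k + 1) = 0"
  by (induction k) (simp_all add: matching_count.simps)

lemma matching_sqrt_count_2: "matching_sqrt_count (4 * k + 2) = 0"
  by (induction k) (simp_all add: matching_sqrt_count.simps)

lemma matching_count_even: "matching_count (2 * k) * 2 ^ k * fact k = fact (2 * k)"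
proof (induction k)
  case (Suc k)
  have "matching_count (2 * Suc k) = (2 * k + 1) * matching_count (2 * k)"
    by (subst matching_count.simps) simp
  then have "matching_count (2 * Suc k) * 2 ^ Suc k * fact (Suc k) =
      (2 * k + 2) * (2 * k + 1) * (matching_count (2 * k) * 2 ^ k * fact k)"
    by (simp add: algebra_simps)
  also have "\<dots> = fact (2 * Suc k)"
    unfolding Suc by (simp add: algebra_simps)
  finally show ?case .
qed (simp add: matching_count.simps)

lemma matching_sqrt_count_4: "matching_sqrt_count (4 * m) * fact m = fact (2 * m)"
proof (induction m)
  case (Suc m)
  have "matching_sqrt_count (4 * Suc m) = (4 * m + 2) * matching_sqrt_count (4 * m)"
    by (subst matching_sqrt_count.simps) simp
  then have "matching_sqrt_count (4 * Suc m) * fact (Suc m) =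
      (2 * m + 2) * (2 * m + 1) * (matching_sqrt_count (4 * m) * fact m)"
    by (simp add: algebra_simps)
  also have "\<dots> = fact (2 * Suc m)"
    unfolding Suc by (simp add: algebra_simps)
  finally show ?case .
qed (simp add: matching_sqrt_count.simps)

lemma hQ_eq_0: "\<not> 4 dvd n \<Longrightarrow> hQ n = 0"
proof -
  assume "\<not> 4 dvd n"
  then have "n mod 4 = 1 \<or> n mod 4 = 2 \<or> n mod 4 = 3" by presburger
  then have "n = 2 * (2 * (n div 4)) + 1 \<or> n = 4 * (n div 4) + 2 \<or> n = 2 * (2 * (n div 4) + 1) + 1"
    by presburger
  then show ?thesis
    by (metis matching_count_odd matching_sqrt_count_2 mult_zero_left mult_zero_right)
qed

text \<open>Choosing a fixed point free involution and a square root of it is choosing a permutation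
  with all cycles of length 4, and of these there are (4m)! / (4^m m!). Only the cube roots remain
  to be counted.\<close>

lemma hQ_4: "of_nat (hQ (4 * m)) / fact (4 * m) = (of_nat (matching_cube_root_count (4 * m)) / (4 ^ m *
    fact m) :: rat)"
proof -
  have p2: "(2::nat) ^ (2 * m) = 4 ^ m" by (simp add: power_mult)
  have "(matching_count (4 * m) * 2 ^ (2 * m) * fact (2 * m)) * (matching_sqrt_count (4 * m) * fact m)
      = fact (4 * m) * fact (2 * m)"
    using matching_count_even[of "2 * m"] matching_sqrt_count_4[of m] by simp
  then have "(matching_count (4 * m) * matching_sqrt_count (4 * m) * (4 ^ m * fact m)) * fact (2 * m) =
      fact (4 * m) * (fact (2 * m) :: nat)"
    unfolding p2 by (simp add: algebra_simps)
  then have "matching_count (4 * m) * matching_sqrt_count (4 * m) * (4 ^ m * fact m) = fact (4 * m)"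
    by (metis fact_nonzero mult_right_cancel)
  then have "of_nat (matching_count (4 * m) * matching_sqrt_count (4 * m) * (4 ^ m * fact m)) = (of_nat
      (fact (4 * m)) :: rat)"
    by (rule arg_cong)
  then have "of_nat (matching_count (4 * m)) * of_nat (matching_sqrt_count (4 * m)) * (4 ^ m * fact m) =
      (fact (4 * m) :: rat)"
    by simp
  then show ?thesis by (simp add: field_simps)
qed

text \<open>The Euler operator z d/dz. It multiplies the n-th coefficient by n, hence keeps
  exponents in place and vanishes modulo 8 on series in z^8.\<close>

definition fps_theta :: "'a::comm_ring_1 fps \<Rightarrow> 'a fps" where
  "fps_theta f = fps_X * fps_deriv f"

lemma fps_theta_nth: "fps_nth (fps_theta f) n = of_nat n * fps_nth f n"
  by (cases n) (simp_all add: fps_theta_def)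

lemma fps_theta_mult: "fps_theta (f * g) = fps_theta f * g + f * fps_theta g"
  by (simp add: fps_theta_def algebra_simps)

lemma fps_theta_add: "fps_theta (f + g) = fps_theta f + fps_theta g"
  by (simp add: fps_theta_def algebra_simps)

lemma fps_of_int_fps_theta: "fps_of_int_fps (fps_theta f) = fps_theta (fps_of_int_fps f)"
  by (simp add: fps_theta_def fps_of_int_fps_simps)

lemma matching_cube_root_count_rec:
  "matching_cube_root_count (2 * k + 6) = matching_cube_root_count (2 * k + 4) +
     (2 * k + 4) * (2 * k + 2) * matching_cube_root_count (2 * k)"
  by (subst matching_cube_root_count.simps) (simp add: algebra_simps)

text \<open>Only sizes divisible by 4 contribute to Q, whereas the recurrence moves in steps of 2;
  this eliminates the terms in between. The separated factors 2(x + 6), 4(x + 6)(x + 4), ... cancel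
  against the weights 4^m m!.\<close>

lemma matching_cube_root_count_identity:
  fixes x :: rat
  assumes "d3 = d2 + (2 * x + 4) * (2 * x + 2) * d0" "d4 = d3 + (2 * x + 6) * (2 * x + 4) * d1"
    "d5 = d4 + (2 * x + 8) * (2 * x + 6) * d2" "d6 = d5 + (2 * x + 10) * (2 * x + 8) * d3"
    "d7 = d6 + (2 * x + 12) * (2 * x + 10) * d4" "d8 = d7 + (2 * x + 14) * (2 * x + 12) * d5"
  shows "d8 = (1 + 12 * (x + 6) - 4 * (x + 6) ^ 2) * d6 + 6 * (x + 5) * (2 * (x + 6)) * d4
     + 12 * (x + 5) * (x + 3) * (4 * (x + 6) * (x + 4)) * d2
     + 8 * (x + 5) * (x + 3) * (x + 1) * (8 * (x + 6) * (x + 4) * (x + 2)) * d0"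
  unfolding assms by algebra

lemma q_recurrence:
  fixes m :: nat
  defines "q \<equiv> \<lambda>j. of_nat (hQ (4 * (m + j))) / fact (4 * (m + j)) :: rat" and "M \<equiv> of_nat m"
  shows "4 * (M + 4) * q 4 = (1 + 24 * (M + 3) - 16 * (M + 3) ^ 2) * q 3 + 6 * (2 * M + 5) * q 2
     + 12 * (2 * M + 5) * (2 * M + 3) * q 1 + 8 * (2 * M + 5) * (2 * M + 3) * (2 * M + 1) * q 0"
proof -
  define d where "d j = (of_nat (matching_cube_root_count (4 * m + 2 * j)) :: rat)" for j
  have d: "d (j + 3) = d (j + 2) + (4 * M + 2 * of_nat j + 4) * (4 * M + 2 * of_nat j + 2) * d j" for j
  proof -
    define e where "e = matching_cube_root_count"
    have "4 * m + 2 * (j + 3) = 2 * (2 * m + j) + 6" "4 * m + 2 * (j + 2) = 2 * (2 * m + j) + 4" "4 * m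
        + 2 * j = 2 * (2 * m + j)"
      by auto
    then have "e (4 * m + 2 * (j + 3)) = e (4 * m + 2 * (j + 2)) + (4 * m + 2 * j + 4) * (4 * m + 2 * j
        + 2) * e (4 * m + 2 * j)"
      unfolding e_def using matching_cube_root_count_rec[of "2 * m + j"] by metis
    then have "(of_nat (e (4 * m + 2 * (j + 3))) :: rat) =
        of_nat (e (4 * m + 2 * (j + 2)) + (4 * m + 2 * j + 4) * (4 * m + 2 * j + 2) * e (4 * m + 2 * j))"
      by (simp only:)
    then show ?thesis
      by (simp only: d_def M_def of_nat_add of_nat_mult of_nat_numeral flip: e_def)
  qed
  have d3: "d 3 = d 2 + (2 * (2 * M) + 4) * (2 * (2 * M) + 2) * d 0" using d[of 0] by (simp add: numeral_2_eq_2)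
  have d4: "d 4 = d 3 + (2 * (2 * M) + 6) * (2 * (2 * M) + 4) * d 1" using d[of 1] by (simp add:
      algebra_simps del: One_nat_def)
  have d5: "d 5 = d 4 + (2 * (2 * M) + 8) * (2 * (2 * M) + 6) * d 2" using d[of 2] by (simp add: algebra_simps)
  have d6: "d 6 = d 5 + (2 * (2 * M) + 10) * (2 * (2 * M) + 8) * d 3" using d[of 3] by (simp add: algebra_simps)
  have d7: "d 7 = d 6 + (2 * (2 * M) + 12) * (2 * (2 * M) + 10) * d 4" using d[of 4] by (simp add:
      algebra_simps)
  have d8: "d 8 = d 7 + (2 * (2 * M) + 14) * (2 * (2 * M) + 12) * d 5" using d[of 5] by (simp add:
      algebra_simps)
  note id = matching_cube_root_count_identity[OF d3 d4 d5 d6 d7 d8]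
  define g :: rat where "g = 1 / (4 ^ (m + 4) * fact (m + 4))"
  define r :: "nat \<Rightarrow> rat" where "r j = 1 / (4 ^ j * fact j)" for j
  have r: "r j = 4 * (of_nat j + 1) * r k" if "k = j + 1" for j k
    using that by (simp add: r_def divide_simps)
  have g: "r (m + 4) = g" "r (m + 3) = 4 * (M + 4) * g" "r (m + 2) = 4 * (M + 3) * r (m + 3)"
    "r (m + 1) = 4 * (M + 2) * r (m + 2)" "r (m + 0) = 4 * (M + 1) * r (m + 1)"
    using r[of "m + 4" "m + 3"] r[of "m + 3" "m + 2"] r[of "m + 2" "m + 1"] r[of "m + 1" m]
    by (simp_all add: M_def g_def add.assoc r_def[of "m + 4"])
  have q: "q j = d (2 * j) * r (m + j)" for j
    unfolding q_def hQ_4 by (simp add: d_def r_def algebra_simps)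
  have "q 4 = d 8 * r (m + 4)" "q 3 = d 6 * r (m + 3)" "q 2 = d 4 * r (m + 2)" "q 1 = d 2 * r (m
      + 1)" "q 0 = d 0 * r (m + 0)"
    using q[of 4] q[of 3] q[of 2] q[of 1] q[of 0] by simp_all
  then show ?thesis unfolding g id by algebra
qed

text \<open>The polynomials in the Euler operator are the expanded products of n + 2, n + 6 and n +
  10 that appear in \<open>q_recurrence\<close> for n divisible by 4. Other exponents contribute
  nothing, and the exponents 0, 4, 8, 12 are compared numerically.\<close>

lemma hQ_ode:
  fixes Q :: "rat fps"
  defines "Q \<equiv> Abs_fps (\<lambda>n. of_nat (hQ n) / fact n)"
  defines "Q1 \<equiv> fps_theta Q" and "Q2 \<equiv> fps_theta (fps_theta Q)" and "Q3 \<equiv> fps_theta (fps_theta (fps_theta Q))"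
  shows "Q1 = fps_X ^ 4 * (Q + 6 * Q1 - Q2) + 3 * (fps_X ^ 8 * (Q1 + 2 * Q)) + 3 * (fps_X ^ 12 * (Q2
      + 8 * Q1 + 12 * Q))
     + fps_X ^ 16 * (Q3 + 18 * Q2 + 92 * Q1 + 120 * Q)" (is "_ = ?R")
proof (rule fps_ext)
  fix N
  have nth: "Q $ n = of_nat (hQ n) / fact n" for n by (simp add: Q_def)
  have nth0: "Q $ n = 0" if "\<not> 4 dvd n" for n using hQ_eq_0[OF that] by (simp add: Q_def)
  have R: "?R $ N = (if N < 4 then 0 else (1 + 6 * of_nat (N - 4) - of_nat (N - 4) ^ 2) * Q $ (N - 4))
      + (if N < 8 then 0 else 3 * (of_nat (N - 8) + 2) * Q $ (N - 8))
      + (if N < 12 then 0 else 3 * (of_nat (N - 12) + 6) * (of_nat (N - 12) + 2) * Q $ (N - 12))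
      + (if N < 16 then 0 else (of_nat (N - 16) + 10) * (of_nat (N - 16) + 6) * (of_nat (N - 16)
      + 2) * Q $ (N - 16))"
    by (simp add: Q1_def Q2_def Q3_def fps_X_power_mult_nth numeral_mult_fps_nth fps_theta_nth del: of_nat_diff)
       (simp add: algebra_simps power2_eq_square del: of_nat_diff)
  have L: "Q1 $ N = of_nat N * Q $ N" by (simp add: Q1_def fps_theta_nth)
  show "Q1 $ N = ?R $ N"
  proof (cases "4 dvd N")
    case False
    have "\<not> 4 dvd N - 4" if "\<not> N < 4" using that False by presburger
    moreover have "\<not> 4 dvd N - 8" if "\<not> N < 8" using that False by presburger
    moreover have "\<not> 4 dvd N - 12" if "\<not> N < 12" using that False by presburger
    moreover have "\<not> 4 dvd N - 16" if "\<not> N < 16" using that False by presburger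
    ultimately show ?thesis unfolding L R using nth0 False by simp
  next
    case True
    then obtain k where k: "N = 4 * k" by blast
    show ?thesis
    proof (cases "k < 4")
      case True
      then have "k = 0 \<or> k = 1 \<or> k = 2 \<or> k = 3" by auto
      moreover have "matching_count 0 = 1" "matching_count 4 = 3" "matching_count 8 = 105" "matching_count
      12 = 10395"
        by (simp_all add: matching_count.simps)
      moreover have "matching_sqrt_count 0 = 1" "matching_sqrt_count 4 = 2" "matching_sqrt_count 8 = 12"
      "matching_sqrt_count 12 = 120"
        by (simp_all add: matching_sqrt_count.simps)
      moreover have "matching_cube_root_count 0 = 1" "matching_cube_root_count 4 = 1"
        "matching_cube_root_count 8 = 33" "matching_cube_root_count 12 = 801"
        by (simp_all add: matching_cube_root_count.simps)
      ultimately show ?thesis unfolding L R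
        by (auto simp: k nth fact_numeral)
    next
      case False
      then obtain m where m: "k = m + 4" by (metis add.commute le_Suc_ex not_less)
      have N: "\<not> N < 4" "\<not> N < 8" "\<not> N < 12" "\<not> N < 16" "N - 4 = 4 * (m + 3)" "N - 8 = 4 * (m + 2)"
        "N - 12 = 4 * (m + 1)" "N - 16 = 4 * (m + 0)" "N = 4 * (m + 4)"
        using k m by auto
      show ?thesis
        unfolding L R N(1-8) if_False nth unfolding N(9) using q_recurrence[of m]
        by (simp add: algebra_simps power2_eq_square)
    qed
  qed
qed

text \<open>With \<theta> the Euler operator, T = \<theta>Q / Q, so \<theta>^2 Q and \<theta>^3 Q
  are Q times \<theta>T + T^2 and \<theta>^2 T + 3T \<theta>T + T^3; then Q is cancelled. The extra
  factor z in T comes from \<theta> replacing the derivative.\<close>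

lemma Q_riccati:
  fixes s :: "nat \<Rightarrow> nat"
  assumes s: "\<And>n. hQ (Suc n) = (\<Sum>k\<le>n. (n choose k) * (fact k * s (Suc k) * hQ (n - k)))"
  defines "T \<equiv> fps_X * Abs_fps (\<lambda>n. int (s (Suc n)))"
  defines "T1 \<equiv> fps_theta T" and "T2 \<equiv> fps_theta (fps_theta T)"
  shows "T = fps_X ^ 4 * (1 + 6 * T - T1 - T ^ 2) + 3 * fps_X ^ 8 * (T + 2) + 3 * fps_X ^ 12 * (T1
      + T ^ 2 + 8 * T + 12)
     + fps_X ^ 16 * (T2 + 3 * T * T1 + T ^ 3 + 18 * (T1 + T ^ 2) + 92 * T + 120)" (is "_ = ?R")
proof -
  define Q where "Q = (Abs_fps (\<lambda>n. of_nat (hQ n) / fact n) :: rat fps)"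
  define t where "t = (fps_of_int_fps T :: rat fps)"
  define t1 where "t1 = fps_theta t"
  define t2 where "t2 = fps_theta t1"
  have Q1: "fps_theta Q = t * Q"
    unfolding Q_def t_def T_def fps_theta_def using fps_deriv_egf[of hQ s, OF s]
    by (simp add: fps_of_int_fps_simps algebra_simps)
  have Q2: "fps_theta (t * Q) = (t1 + t ^ 2) * Q"
    by (simp add: fps_theta_mult Q1 t1_def algebra_simps power2_eq_square)
  have Q3: "fps_theta ((t1 + t ^ 2) * Q) = (t2 + 3 * t * t1 + t ^ 3) * Q"
    by (simp add: fps_theta_mult fps_theta_add Q1 power2_eq_square power3_eq_cube flip: t1_def t2_def)
      (simp add: algebra_simps)
  have "Q $ 0 = 1" by (simp add: Q_def matching_count.simps matching_sqrt_count.simps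
      matching_cube_root_count.simps)
  then have Q0: "Q \<noteq> 0" by auto
  have "fps_of_int_fps (T - ?R) * Q = (0 :: rat fps)"
  proof -
    have "fps_of_int_fps (T - ?R) = t - (fps_X ^ 4 * (1 + 6 * t - t1 - t ^ 2) + 3 * fps_X ^ 8 * (t + 2)
       + 3 * fps_X ^ 12 * (t1 + t ^ 2 + 8 * t + 12)
       + fps_X ^ 16 * (t2 + 3 * t * t1 + t ^ 3 + 18 * (t1 + t ^ 2) + 92 * t + 120))"
      by (simp add: fps_of_int_fps_simps fps_of_int_fps_power T1_def T2_def fps_of_int_fps_theta flip:
      t_def t1_def t2_def)
    then show ?thesis
      using hQ_ode[folded Q_def, unfolded Q1, unfolded Q2, unfolded Q3] by algebra
  qed
  then have "fps_of_int_fps (T - ?R) = (0 :: rat fps)" using Q0 by simp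
  then show ?thesis by (simp only: fps_of_int_fps_eq_0_iff right_minus_eq)
qed

lemma fps_theta_X [simp]: "fps_theta fps_X = fps_X"
  and fps_theta_X_power [simp]: "fps_theta (fps_X ^ n) = of_nat n * fps_X ^ n"
  and fps_theta_numeral [simp]: "fps_theta (numeral k) = 0"
  and fps_theta_1 [simp]: "fps_theta 1 = 0"
  and fps_theta_diff: "fps_theta (f - g) = fps_theta f - fps_theta g"
  by (simp_all add: fps_eq_iff fps_theta_nth fps_X_power_nth fps_numeral_nth fps_X_nth algebra_simps
      fps_of_nat[symmetric] del: fps_of_nat)

section \<open>Power series modulo an integer\<close>

text \<open>Congruences between coefficients become divisibility in the ring of integral series,
  where they can be handled by ring identities.\<close>

lemma numeral_dvd_fps_iff: "(numeral k :: int fps) dvd f \<longleftrightarrow> (\<forall>n. numeral k dvd f $ n)"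
proof
  assume "(numeral k :: int fps) dvd f"
  then show "\<forall>n. numeral k dvd f $ n" by (auto simp: dvd_def numeral_fps_const)
next
  assume "\<forall>n. numeral k dvd f $ n"
  then have "f = numeral k * Abs_fps (\<lambda>n. f $ n div numeral k)"
    by (simp add: fps_eq_iff numeral_fps_const)
  then show "numeral k dvd f" by (rule dvdI)
qed

lemma numeral_dvd_X_power_mult_iff: "(numeral k :: int fps) dvd fps_X ^ n * f \<longleftrightarrow> numeral k dvd f"
proof
  assume *: "numeral k dvd fps_X ^ n * f"
  show "numeral k dvd f"
    unfolding numeral_dvd_fps_iff
  proof
    fix m
    have "(fps_X ^ n * f) $ (n + m) = f $ m" by (simp add: fps_X_power_mult_nth)
    then show "numeral k dvd f $ m" using * unfolding numeral_dvd_fps_iff by metis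
  qed
qed simp

text \<open>The factor \<open>fps_X\<close> makes every coefficient of \<open>d\<close> depend, modulo 8, on the earlier ones only.\<close>
lemma dvd_of_contraction:
  fixes d a b c r :: "int fps"
  assumes d: "d = fps_X * (a * d + b * fps_theta d + c * fps_theta (fps_theta d)) + 8 * r"
  shows "8 dvd d"
proof -
  have "8 dvd d $ n" for n
  proof (induction n rule: less_induct)
    case (less n)
    define g where "g = a * d + b * fps_theta d + c * fps_theta (fps_theta d)"
    have "d $ n = (fps_X * g) $ n + 8 * r $ n"
      by (subst d) (simp add: numeral_fps_const g_def)
    moreover have "8 dvd (fps_X * g) $ n"
    proof (cases n)
      case (Suc m)
      have "8 dvd g $ m"
        using less Suc unfolding g_def
        by (auto simp: fps_mult_nth fps_theta_nth intro!: dvd_add dvd_sum dvd_mult)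
      then show ?thesis using Suc by simp
    qed simp
    ultimately show ?case by simp
  qed
  then show ?thesis by (simp add: numeral_dvd_fps_iff)
qed

section \<open>Tails of the series \<Phi> and their relations\<close>

lemma fps_compose_X_square_nth: "(f oo fps_X ^ 2) $ n = (if even n then (f :: int fps) $ (n div 2) else 0)"
proof -
  have "(f oo fps_X ^ 2) $ n = (\<Sum>i=0..n. if n = 2 * i then f $ i else 0)"
    unfolding fps_compose_nth by (intro sum.cong) (auto simp: power_mult[symmetric] fps_X_power_nth)
  also have "\<dots> = (\<Sum>i=0..n. if i = n div 2 then (if even n then f $ (n div 2) else 0) else 0)"
    by (intro sum.cong) auto
  finally show ?thesis by (subst (asm) sum.delta) auto
qed

text \<open>The Frobenius map modulo 2: in the square the products with indices i and n - i pair up,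
  and the square in the middle has the parity of its base.\<close>

lemma square_cong_compose: "2 dvd f ^ 2 - (f oo fps_X ^ 2 :: int fps)"
  unfolding numeral_dvd_fps_iff
proof
  fix n
  define g where "g i = f $ i * f $ (n - i)" for i
  have sq: "(f ^ 2) $ n = (\<Sum>i\<in>{..n}. g i)"
    by (simp add: power2_eq_square fps_mult_nth g_def atLeast0AtMost)
  have refl: "(\<Sum>i\<in>{i. i \<le> n \<and> n < 2 * i}. g i) = (\<Sum>i\<in>{i. i \<le> n \<and> 2 * i < n}. g i)"
    by (rule sum.reindex_bij_witness[where i = "\<lambda>i. n - i" and j = "\<lambda>i. n - i"]) (auto simp: g_def)
  have "{..n} = {i. i \<le> n \<and> 2 * i < n} \<union> {i. i \<le> n \<and> n < 2 * i} \<union> {i. 2 * i = n}" by auto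
  then have "(f ^ 2) $ n = (\<Sum>i\<in>{i. i \<le> n \<and> 2 * i < n} \<union> {i. i \<le> n \<and> n < 2 * i} \<union> {i. 2 * i = n}. g i)"
    using sq by simp
  also have "\<dots> = 2 * (\<Sum>i\<in>{i. i \<le> n \<and> 2 * i < n}. g i) + (\<Sum>i\<in>{i. 2 * i = n}. g i)"
    using refl by (subst sum.union_disjoint, (auto intro: finite_subset[of _ "{..n}"])[3])+ simp
  also have "(\<Sum>i\<in>{i. 2 * i = n}. g i) = (if even n then (f $ (n div 2)) ^ 2 else 0)"
  proof (cases "even n")
    case True
    then obtain j where j: "n = 2 * j" by blast
    then have "{i. 2 * i = n} = {j}" by auto
    then show ?thesis using j by (simp add: g_def power2_eq_square)
  next
    case False
    then have "{i. 2 * i = n} = {}" by auto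
    then show ?thesis using False by simp
  qed
  finally have "(f ^ 2 - (f oo fps_X ^ 2)) $ n = 2 * (\<Sum>i\<in>{i. i \<le> n \<and> 2 * i < n}. g i) +
      (if even n then (f $ (n div 2)) ^ 2 - f $ (n div 2) else 0)"
    by (simp add: fps_compose_X_square_nth)
  moreover have "2 dvd x ^ 2 - (x :: int)" for x by simp
  ultimately show "2 dvd (f ^ 2 - (f oo fps_X ^ 2)) $ n" by simp
qed

text \<open>\<open>\<Phi>(z) = z + z^2 + \<dots> + z^(2^(k-1)) + z^(2^k) \<Phi>_k(z)\<close> for the following series \<open>\<Phi>_k\<close>.\<close>
definition Phi_tail :: "nat \<Rightarrow> int fps" where
  "Phi_tail k = Abs_fps (\<lambda>m. if \<exists>j\<ge>k. m + 2 ^ k = 2 ^ j then 1 else 0)"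

lemma Phi_tail_Suc: "Phi_tail k = 1 + fps_X ^ (2 ^ k) * Phi_tail (Suc k)"
proof (rule fps_ext)
  fix m :: nat
  have *: "(\<exists>j\<ge>k. m + 2 ^ k = 2 ^ j) \<longleftrightarrow> m = 0 \<or> (m \<ge> 2 ^ k \<and> (\<exists>j\<ge>Suc k. m - 2 ^ k + 2 ^ Suc k = 2 ^ j))"
  proof
    assume "\<exists>j\<ge>k. m + 2 ^ k = 2 ^ j"
    then obtain j where j: "j \<ge> k" "m + 2 ^ k = 2 ^ j" by blast
    show "m = 0 \<or> (m \<ge> 2 ^ k \<and> (\<exists>j\<ge>Suc k. m - 2 ^ k + 2 ^ Suc k = 2 ^ j))"
    proof (cases "j = k")
      case False
      then have "Suc k \<le> j" using j by simp
      then have "(2::nat) ^ Suc k \<le> 2 ^ j" by (intro power_increasing) auto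
      then have "m \<ge> 2 ^ k" using j by simp
      then show ?thesis using j \<open>Suc k \<le> j\<close> by (intro disjI2 conjI exI[of _ j]) auto
    qed (use j in simp)
  next
    assume "m = 0 \<or> (m \<ge> 2 ^ k \<and> (\<exists>j\<ge>Suc k. m - 2 ^ k + 2 ^ Suc k = 2 ^ j))"
    then show "\<exists>j\<ge>k. m + 2 ^ k = 2 ^ j"
    proof (elim disjE conjE exE)
      fix j assume "2 ^ k \<le> m" "Suc k \<le> j" "m - 2 ^ k + 2 ^ Suc k = 2 ^ j"
      then show ?thesis by (intro exI[of _ j]) auto
    qed auto
  qed
  show "Phi_tail k $ m = (1 + fps_X ^ (2 ^ k) * Phi_tail (Suc k)) $ m"
    using * by (auto simp: Phi_tail_def fps_X_power_mult_nth)
qed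

lemma Phi_fps_eq_tail: "Phi_fps = fps_X + fps_X ^ 2 + fps_X ^ 4 + fps_X ^ 8 * Phi_tail 3"
proof -
  have "Phi_fps = fps_X * Phi_tail 0"
  proof (rule fps_ext)
    fix m
    show "Phi_fps $ m = (fps_X * Phi_tail 0) $ m"
      by (cases m) (auto simp: Phi_fps_def Phi_tail_def)
  qed
  also have "\<dots> = fps_X + fps_X ^ 2 + fps_X ^ 4 + fps_X ^ 8 * Phi_tail 3"
  proof -
    have "Phi_tail 0 = 1 + fps_X * Phi_tail 1" "Phi_tail 1 = 1 + fps_X ^ 2 * Phi_tail 2"
      "Phi_tail 2 = 1 + fps_X ^ 4 * Phi_tail 3"
      using Phi_tail_Suc[of 0] Phi_tail_Suc[of 1] Phi_tail_Suc[of 2] by (simp_all add: eval_nat_numeral)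
    then show ?thesis by algebra
  qed
  finally show ?thesis .
qed

text \<open>With \<open>y = z^N \<Phi>_k\<close>, \<open>N = 2^k\<close>, the substitution \<open>z \<mapsto> z^2\<close> maps \<open>y\<close> to \<open>y - z^N\<close>. As it agrees with
  squaring modulo 2, \<open>y^2 + y + z^N = 2 E\<close> for an integral series \<open>E\<close>; applying it to this equation gives
  \<open>E^2\<close> modulo 2. Below, \<open>E = z^N \<epsilon>\<close>.\<close>
lemma Phi_tail_relations:
  assumes k: "3 \<le> k"
  obtains \<epsilon> r u v where "fps_X ^ (2 ^ k) * Phi_tail k ^ 2 = 2 * \<epsilon> - Phi_tail k - 1"
    "fps_X ^ (2 ^ k) * \<epsilon> ^ 2 = \<epsilon> - 1 - fps_X ^ (2 ^ k) * Phi_tail k + fps_X ^ (2 ^ k) + 2 * r"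
    "fps_theta (Phi_tail k) = 8 * u" "fps_theta \<epsilon> = 4 * v"
proof -
  define N :: nat where "N = 2 ^ k"
  define V :: "int fps" where "V = fps_X ^ N"
  define p where "p = Phi_tail k"
  have N8: "8 dvd N" using le_imp_power_dvd[OF k, of 2] by (simp add: N_def)
  have V0: "V \<noteq> 0" by (simp add: V_def)
  have X2: "(fps_X ^ 2 :: int fps) $ 0 = 0" by simp
  have VX2: "V oo fps_X ^ 2 = V ^ 2"
    unfolding V_def fps_X_power_compose[OF X2] by (simp add: mult.commute flip: power_mult)
  have comp: "(V * p) oo fps_X ^ 2 = V * p - V"
  proof (rule fps_ext)
    fix n
    have "(V * p) $ m = (if \<exists>j\<ge>k. m = 2 ^ j then 1 else 0)" for m
    proof -
      have "N \<le> m \<and> (\<exists>j\<ge>k. m - N + N = 2 ^ j) \<longleftrightarrow> (\<exists>j\<ge>k. m = 2 ^ j)"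
        by (auto simp: N_def)
      then show ?thesis by (auto simp: V_def p_def Phi_tail_def fps_X_power_mult_nth N_def[symmetric])
    qed
    moreover have "(even n \<and> (\<exists>j\<ge>k. n div 2 = 2 ^ j)) \<longleftrightarrow> (\<exists>j\<ge>k. n = 2 ^ j) \<and> n \<noteq> N"
    proof
      assume "even n \<and> (\<exists>j\<ge>k. n div 2 = 2 ^ j)"
      then obtain j where j: "j \<ge> k" "n = 2 * 2 ^ j" by (metis dvd_mult_div_cancel)
      then show "(\<exists>j\<ge>k. n = 2 ^ j) \<and> n \<noteq> N"
        by (auto simp: N_def power_Suc[symmetric] simp del: power_Suc intro!: exI[of _ "Suc j"])
    next
      assume "(\<exists>j\<ge>k. n = 2 ^ j) \<and> n \<noteq> N"
      then obtain j where j: "j \<ge> k" "n = 2 ^ j" "j \<noteq> k" by (auto simp: N_def)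
      then obtain i where "j = Suc i" "i \<ge> k" by (cases j) auto
      then show "even n \<and> (\<exists>j\<ge>k. n div 2 = 2 ^ j)" using j by auto
    qed
    moreover have "\<exists>j\<ge>k. N = 2 ^ j" by (auto simp: N_def)
    ultimately show "((V * p) oo fps_X ^ 2) $ n = (V * p - V) $ n"
      by (auto simp: fps_compose_X_square_nth) (auto simp: V_def fps_X_power_nth)
  qed
  \<comment> \<open>Adding twice V p changes the sign of V p, so that V can be factored out.\<close>
  have "2 dvd ((V * p) ^ 2 - (V * p - V)) + 2 * (V * p)"
    using square_cong_compose[of "V * p"] unfolding comp by (rule dvd_add) simp
  also have "((V * p) ^ 2 - (V * p - V)) + 2 * (V * p) = fps_X ^ N * (V * p ^ 2 + p + 1)"
    by (simp add: V_def algebra_simps power2_eq_square)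
  finally have "2 dvd V * p ^ 2 + p + 1"
    using numeral_dvd_X_power_mult_iff by blast
  then obtain \<epsilon> where \<epsilon>: "V * p ^ 2 + p + 1 = 2 * \<epsilon>" by blast
  \<comment> \<open>The substitution z |-> z^2 is a ring homomorphism, so it may be applied to the
    integral equation 2 V \<epsilon> = (V p)^2 + V p + V; the factor 2 cancels afterwards.\<close>
  have "2 * (V * \<epsilon> oo fps_X ^ 2) = (2 * (V * \<epsilon>)) oo fps_X ^ 2"
    by (simp only: mult_2 fps_compose_add_distrib)
  also have "2 * (V * \<epsilon>) = (V * p) ^ 2 + V * p + V"
    unfolding mult.left_commute[of 2] \<epsilon>[symmetric] by (simp add: algebra_simps power2_eq_square)
  also have "\<dots> oo fps_X ^ 2 = (V * p - V) ^ 2 + (V * p - V) + V ^ 2"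
    by (simp only: fps_compose_add_distrib fps_compose_power[OF X2, symmetric] comp VX2)
  also have "\<dots> = 2 * (V * \<epsilon> - V - V ^ 2 * p + V ^ 2)"
    using \<epsilon> by algebra
  finally have "2 * (V * \<epsilon> oo fps_X ^ 2) = 2 * (V * \<epsilon> - V - V ^ 2 * p + V ^ 2)" .
  then have E2: "V * \<epsilon> oo fps_X ^ 2 = V * \<epsilon> - V - V ^ 2 * p + V ^ 2"
    by (rule iffD1[OF mult_left_cancel, rotated]) simp
  have "2 dvd (V * \<epsilon>) ^ 2 - (V * \<epsilon> - V - V ^ 2 * p + V ^ 2)"
    using square_cong_compose[of "V * \<epsilon>"] unfolding E2 .
  also have "(V * \<epsilon>) ^ 2 - (V * \<epsilon> - V - V ^ 2 * p + V ^ 2) = fps_X ^ N * (V * \<epsilon> ^ 2 - (\<epsilon> - 1 - V * p + V))"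
    by (simp add: V_def algebra_simps power2_eq_square)
  finally have "2 dvd V * \<epsilon> ^ 2 - (\<epsilon> - 1 - V * p + V)"
    using numeral_dvd_X_power_mult_iff by blast
  then obtain r where r: "V * \<epsilon> ^ 2 - (\<epsilon> - 1 - V * p + V) = 2 * r" by blast
  \<comment> \<open>The exponents in p are 2^j - 2^k with j, k \<ge> 3, all divisible by 8.\<close>
  have "8 dvd fps_theta p"
    unfolding numeral_dvd_fps_iff
  proof
    fix n
    have "8 dvd n" if ex: "\<exists>j\<ge>k. n + N = 2 ^ j"
    proof -
      obtain j where j: "j \<ge> k" "n + N = 2 ^ j" using ex by blast
      have "(8::nat) dvd 2 ^ j" using le_imp_power_dvd[of 3 j 2] j k by simp
      then show "8 dvd n" using N8 j(2) by (metis dvd_add_left_iff)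
    qed
    then have "8 dvd int n" if "\<exists>j\<ge>k. n + N = 2 ^ j"
      using that by (metis int_dvd_int_iff of_nat_numeral)
    then show "8 dvd fps_theta p $ n"
      by (simp add: fps_theta_nth p_def Phi_tail_def N_def)
  qed
  then obtain u where u: "fps_theta p = 8 * u" by blast
  obtain n where n: "N = 8 * n" using N8 by blast
  \<comment> \<open>As V is a power of z^8, the Euler operator sends 2 \<epsilon> to a multiple of
    8; halving loses one factor 2, which leaves divisibility by 4.\<close>
  have "2 * fps_theta \<epsilon> = fps_theta (V * p ^ 2 + p + 1)"
    unfolding \<epsilon> by (simp add: fps_theta_mult)
  also have "\<dots> = 8 * (of_nat n * V * p ^ 2 + 2 * V * p * u + u)"
    by (simp add: fps_theta_mult fps_theta_add power2_eq_square u V_def n algebra_simps)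
  finally have "2 * fps_theta \<epsilon> = 2 * (4 * (of_nat n * V * p ^ 2 + 2 * V * p * u + u))"
    by simp
  then have "fps_theta \<epsilon> = 4 * (of_nat n * V * p ^ 2 + 2 * V * p * u + u)"
    by (rule iffD1[OF mult_left_cancel, rotated]) simp
  then obtain w where w: "fps_theta \<epsilon> = 4 * w" by blast
  show ?thesis
    by (rule that[of \<epsilon> r u w]) (use \<epsilon> r u w in \<open>simp_all add: V_def N_def p_def algebra_simps\<close>)
qed

section \<open>The Riccati equations modulo 8\<close>

text \<open>Here \<open>p\<close> and \<open>e\<close> stand for \<open>\<Phi>_k\<close> and \<open>\<epsilon>\<close>, with \<open>k = 3\<close> for \<open>P\<close> and \<open>k = 4\<close> for \<open>Q\<close>; these tails are
  long enough for no negative powers of \<open>z\<close> to appear. The coefficients were found by solving linear systems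
  modulo 8 for the initial terms of the two series.\<close>
definition P_solution :: "'a::comm_ring_1 \<Rightarrow> 'a \<Rightarrow> 'a \<Rightarrow> 'a" where
  "P_solution X p e =
     (1 + 4 * X + 4 * X ^ 2 + 4 * X ^ 4 + 2 * X ^ 6 + 2 * X ^ 8 + 4 * X ^ 9 + 4 * X ^ 11
        + 4 * X ^ 14 + 4 * X ^ 17 + 4 * X ^ 20)
     + (6 * X + 6 * X ^ 4 + 4 * X ^ 5 + 4 * X ^ 8 + 4 * X ^ 10) * e
     + (7 * X + 3 * X ^ 4 + 2 * X ^ 5 + 2 * X ^ 8 + 4 * X ^ 9 + 2 * X ^ 10 + 4 * X ^ 12 + 4 * X ^ 14
        + 4 * X ^ 16) * p
     + (4 * X ^ 9 + 4 * X ^ 12) * (p * e)"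

definition Q_solution :: "'a::comm_ring_1 \<Rightarrow> 'a \<Rightarrow> 'a \<Rightarrow> 'a" where
  "Q_solution X p e = (4 * X ^ 4) + (6 * X ^ 4 + 4 * X ^ 12) * e + (7 * X ^ 4 + 2 * X ^ 12
      + 4 * X ^ 20) * p + (4 * X ^ 20) * (p * e)"

text \<open>The explicit multiples of the relations between \<open>p\<close> and \<open>e\<close> come from reducing the left-hand side with
  respect to them; the quotient by 8 is what remains.\<close>
lemma P_solution_residue:
  fixes X p e f t u :: "int fps"
  assumes p_sq: "X ^ 8 * p ^ 2 = 2 * e - p - 1" and e_sq: "X ^ 8 * e ^ 2 = e - 1 - X ^ 8 * p + X ^ 8 + 2 * f"
    and t: "t =
     (4 * X + 8 * X ^ 2 + 16 * X ^ 4 + 12 * X ^ 6 + 16 * X ^ 8 + 36 * X ^ 9 + 44 * X ^ 11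
        + 56 * X ^ 14 + 68 * X ^ 17 + 80 * X ^ 20)
     + (6 * X + 24 * X ^ 4 + 20 * X ^ 5 + 32 * X ^ 8 + 40 * X ^ 10) * e
     + (7 * X + 12 * X ^ 4 + 10 * X ^ 5 + 16 * X ^ 8 + 36 * X ^ 9 + 20 * X ^ 10 + 48 * X ^ 12
        + 56 * X ^ 14 + 64 * X ^ 16) * p
     + (36 * X ^ 9 + 48 * X ^ 12) * (p * e) + 8 * u"
  shows "8 dvd (X ^ 6 - X ^ 9) * (t + X * P_solution X p e ^ 2)
      + (-1 + 4 * X ^ 3 + 2 * X ^ 4 + 4 * X ^ 6 - 2 * X ^ 7 - 4 * X ^ 9) * P_solution X p e
      + (1 + X + 4 * X ^ 2 + 4 * X ^ 3 - X ^ 4 + 4 * X ^ 5 - 2 * X ^ 6 - 2 * X ^ 8)"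
    (is "_ dvd ?R")
proof -
  have R: "?R = 8 * ((- (X) + X * f - X * p + X ^ 3 + X ^ 4 + X ^ 4 * f + 3 * X ^ 4 * e + 3 * X ^ 4 * p
      + 3 * X ^ 5
        + 2 * X ^ 5 * e + X ^ 5 * p + X ^ 6 + 4 * X ^ 7 + X ^ 7 * f + 7 * X ^ 7 * e + 6 * X ^ 7 * p
        + 3 * X ^ 8 + 4 * X ^ 8 * e + X ^ 8 * p + 2 * X ^ 9 + 8 * X ^ 9 * e + 4 * X ^ 9 * e ^ 2
        + 6 * X ^ 9 * p + 10 * X ^ 9 * p * e + 6 * X ^ 9 * p ^ 2 + 5 * X ^ 10 + X ^ 10 * f
        + 9 * X ^ 10 * e + 5 * X ^ 10 * p - 2 * X ^ 11 + 6 * X ^ 11 * e + X ^ 11 * p + 6 * X ^ 12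
        + 8 * X ^ 12 * e + 4 * X ^ 12 * e ^ 2 + 4 * X ^ 12 * p + 6 * X ^ 12 * p * e - X ^ 12 * p ^ 2
        - 3 * X ^ 13 + 6 * X ^ 13 * e ^ 2 - 3 * X ^ 13 * p + 11 * X ^ 13 * p * e + 3 * X ^ 13 * p ^ 2
        + 3 * X ^ 14 + 9 * X ^ 14 * e + 5 * X ^ 14 * p + 5 * X ^ 15 - 6 * X ^ 15 * e
        - 5 * X ^ 15 * e ^ 2 - 2 * X ^ 15 * p * e - 4 * X ^ 15 * p ^ 2 - 3 * X ^ 16 + 9 * X ^ 16 * e
        + 6 * X ^ 16 * e ^ 2 + 6 * X ^ 16 * p + 7 * X ^ 16 * p * e + X ^ 16 * p ^ 2 + 12 * X ^ 17
        + 2 * X ^ 17 * e ^ 2 + 8 * X ^ 17 * p + 12 * X ^ 17 * p * e + 6 * X ^ 17 * p * e ^ 2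
        + 7 * X ^ 17 * p ^ 2 + 7 * X ^ 17 * p ^ 2 * e - 6 * X ^ 18 + X ^ 18 * e ^ 2 + 5 * X ^ 18 * p
        + 11 * X ^ 18 * p * e + 2 * X ^ 18 * p ^ 2 + 3 * X ^ 19 - 6 * X ^ 19 * e ^ 2 + 2 * X ^ 19 * p
        - 11 * X ^ 19 * p * e - 4 * X ^ 19 * p ^ 2 + 3 * X ^ 20 - 6 * X ^ 20 * e + 2 * X ^ 20 * e ^ 2
        + 7 * X ^ 20 * p + 12 * X ^ 20 * p * e + 6 * X ^ 20 * p * e ^ 2 + 3 * X ^ 20 * p ^ 2
        + 3 * X ^ 20 * p ^ 2 * e - 3 * X ^ 21 + 4 * X ^ 21 * e - 6 * X ^ 21 * p - 8 * X ^ 21 * p * e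
        + 4 * X ^ 21 * p * e ^ 2 + 2 * X ^ 21 * p ^ 2 * e + 3 * X ^ 22 - 4 * X ^ 22 * e
        - 2 * X ^ 22 * e ^ 2 + 12 * X ^ 22 * p + 5 * X ^ 22 * p * e + 6 * X ^ 22 * p ^ 2
        - 2 * X ^ 23 * e ^ 2 - 9 * X ^ 23 * p - 12 * X ^ 23 * p * e - 6 * X ^ 23 * p * e ^ 2
        - 8 * X ^ 23 * p ^ 2 - 7 * X ^ 23 * p ^ 2 * e + 3 * X ^ 24 - 6 * X ^ 24 * e
        - 6 * X ^ 24 * e ^ 2 - 2 * X ^ 24 * p + 2 * X ^ 24 * p * e + 4 * X ^ 24 * p * e ^ 2
        + 7 * X ^ 24 * p ^ 2 + 2 * X ^ 24 * p ^ 2 * e + 2 * X ^ 25 * e - X ^ 25 * p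
        + 4 * X ^ 25 * p * e - 2 * X ^ 25 * p ^ 2 + 4 * X ^ 25 * p ^ 2 * e
        + 2 * X ^ 25 * p ^ 2 * e ^ 2 + 3 * X ^ 26 + 4 * X ^ 26 * e - 2 * X ^ 26 * e ^ 2
        - 7 * X ^ 26 * p - 4 * X ^ 26 * p * e - 2 * X ^ 26 * p * e ^ 2 - X ^ 26 * p ^ 2 * e + X ^ 27
        - 4 * X ^ 27 * e + 2 * X ^ 27 * e ^ 2 + 4 * X ^ 27 * p + 2 * X ^ 27 * p * e
        - 4 * X ^ 27 * p * e ^ 2 - 6 * X ^ 27 * p ^ 2 - 2 * X ^ 27 * p ^ 2 * e - 2 * X ^ 28
        + 2 * X ^ 28 * e - 4 * X ^ 28 * e ^ 2 - 9 * X ^ 28 * p - 8 * X ^ 28 * p * e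
        + 4 * X ^ 28 * p ^ 2 * e + 2 * X ^ 28 * p ^ 2 * e ^ 2 - 10 * X ^ 29 - 4 * X ^ 29 * e
        + 2 * X ^ 29 * p - X ^ 30 - 2 * X ^ 30 * e ^ 2 - 10 * X ^ 30 * p * e - 4 * X ^ 30 * p * e ^ 2
        - 2 * X ^ 30 * p ^ 2 + 2 * X ^ 30 * p ^ 2 * e - 4 * X ^ 31 - 6 * X ^ 31 * e - 9 * X ^ 31 * p
        - 4 * X ^ 31 * p ^ 2 * e - 2 * X ^ 31 * p ^ 2 * e ^ 2 - 2 * X ^ 32 + 4 * X ^ 32 * p
        - 8 * X ^ 32 * p * e - 4 * X ^ 32 * p * e ^ 2 + 2 * X ^ 32 * p ^ 2 * e - 4 * X ^ 33 * p
        + 4 * X ^ 33 * p * e + 2 * X ^ 33 * p ^ 2 - 4 * X ^ 34 - 6 * X ^ 34 * e - X ^ 34 * p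
        - 8 * X ^ 34 * p * e - 6 * X ^ 34 * p ^ 2 - 4 * X ^ 34 * p ^ 2 * e
        - 2 * X ^ 34 * p ^ 2 * e ^ 2 + 2 * X ^ 35 - 4 * X ^ 35 * e - 6 * X ^ 35 * p
        + 2 * X ^ 35 * p ^ 2 - 2 * X ^ 36 - 4 * X ^ 36 * p * e - 6 * X ^ 36 * p ^ 2
        - 4 * X ^ 36 * p ^ 2 * e + 4 * X ^ 37 * p ^ 2 - 4 * X ^ 38 * e - 2 * X ^ 38 * p
        - 6 * X ^ 38 * p ^ 2 - 4 * X ^ 38 * p ^ 2 * e - 4 * X ^ 39 - 4 * X ^ 39 * p
        - 4 * X ^ 39 * p * e + 2 * X ^ 39 * p ^ 2 - 4 * X ^ 40 * e - 2 * X ^ 40 * p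
        - 4 * X ^ 40 * p ^ 2 - 2 * X ^ 41 - 4 * X ^ 42 * p - 4 * X ^ 42 * p * e - 2 * X ^ 42 * p ^ 2
        - 2 * X ^ 44 - 4 * X ^ 44 * p - 4 * X ^ 46 * p - 2 * X ^ 47 - 2 * X ^ 50)
      + (X ^ 6 - X ^ 9) * u)
      + (X + X ^ 4 + 4 * X ^ 5 - X ^ 7 + 4 * X ^ 8 + 4 * X ^ 9 + 3 * X ^ 10 + 4 * X ^ 11 + 4 * X ^ 12
        + 4 * X ^ 14 + 4 * X ^ 15 + 4 * X ^ 16 + 4 * X ^ 18 + 4 * X ^ 19 + 4 * X ^ 22)
        * (X ^ 8 * p ^ 2 - (2 * e - p - 1))
      + (4 * X + 4 * X ^ 4 + 4 * X ^ 7 + 4 * X ^ 10)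
        * (X ^ 8 * e ^ 2 - (e - 1 - X ^ 8 * p + X ^ 8 + 2 * f))"
    unfolding t P_solution_def by algebra
  have "X ^ 8 * p ^ 2 - (2 * e - p - 1) = 0" "X ^ 8 * e ^ 2 - (e - 1 - X ^ 8 * p + X ^ 8 + 2 * f) = 0"
    using p_sq e_sq by simp_all
  then show ?thesis
    unfolding R by (simp only: mult_zero_left mult_zero_right add_0_right diff_zero dvd_triv_left)
qed

text \<open>\<open>t\<close> and \<open>t'\<close> stand for the first and second Euler derivative
  of the candidate; \<open>u\<close> and \<open>u'\<close> collect the multiples of 8 that result
  from differentiating p and e.\<close>

lemma Q_solution_residue:
  fixes X p e f t t' u u' :: "int fps"
  assumes p_sq: "X ^ 16 * p ^ 2 = 2 * e - p - 1" and e_sq: "X ^ 16 * e ^ 2 = e - 1 - X ^ 16 * p + X ^ 16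
      + 2 * f"
    and t: "t = (16 * X ^ 4) + (24 * X ^ 4 + 48 * X ^ 12) * e + (28 * X ^ 4 + 24 * X ^ 12
        + 80 * X ^ 20) * p + (80 * X ^ 20) * (p * e) + 8 * u"
    and t': "t' = (64 * X ^ 4) + (96 * X ^ 4 + 576 * X ^ 12) * e + (112 * X ^ 4 + 288 * X ^ 12
        + 1600 * X ^ 20) * p + (1600 * X ^ 20) * (p * e) + 8 * u'"
  shows "8 dvd X ^ 4 * (1 + 6 * Q_solution X p e - t - Q_solution X p e ^ 2)
      + 3 * X ^ 8 * (Q_solution X p e + 2)
      + 3 * X ^ 12 * (t + Q_solution X p e ^ 2 + 8 * Q_solution X p e + 12)
      + X ^ 16 * (t' + 3 * Q_solution X p e * t + Q_solution X p e ^ 3 + 18 * (t + Q_solution X p e ^ 2)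
        + 92 * Q_solution X p e + 120) - Q_solution X p e"
    (is "_ dvd ?R")
proof -
  have R: "?R = 8 * ((- (X ^ 4) + X ^ 4 * f - X ^ 4 * p + 2 * X ^ 8 + X ^ 8 * e + 2 * X ^ 8 * p + 4 * X ^ 12
        - 5 * X ^ 12 * e - 3 * X ^ 12 * e ^ 2 - 5 * X ^ 12 * p + X ^ 12 * p * f - 11 * X ^ 12 * p * e
        - 6 * X ^ 12 * p ^ 2 + 33 * X ^ 16 + 24 * X ^ 16 * e + 30 * X ^ 16 * p + 96 * X ^ 20
        + 151 * X ^ 20 * e + 8 * X ^ 20 * e ^ 2 + 176 * X ^ 20 * p + 20 * X ^ 20 * p * e
        + 15 * X ^ 20 * p ^ 2 + 60 * X ^ 24 + 210 * X ^ 24 * e + 135 * X ^ 24 * e ^ 2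
        + 218 * X ^ 24 * p + 308 * X ^ 24 * p * e + 184 * X ^ 24 * p ^ 2 + 8 * X ^ 28
        + 274 * X ^ 28 * e + 70 * X ^ 28 * e ^ 2 + 27 * X ^ 28 * e ^ 3 + 159 * X ^ 28 * p
        + 145 * X ^ 28 * p * e + 89 * X ^ 28 * p * e ^ 2 + 76 * X ^ 28 * p ^ 2
        + 102 * X ^ 28 * p ^ 2 * e + 43 * X ^ 28 * p ^ 3 + 168 * X ^ 32 * e + 252 * X ^ 32 * e ^ 2
        + 126 * X ^ 32 * p + 462 * X ^ 32 * p * e + 147 * X ^ 32 * p ^ 2 + 24 * X ^ 36 * e
        + 78 * X ^ 36 * e ^ 2 + 54 * X ^ 36 * e ^ 3 + 450 * X ^ 36 * p + 578 * X ^ 36 * p * e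
        + 167 * X ^ 36 * p * e ^ 2 + 62 * X ^ 36 * p ^ 2 + 155 * X ^ 36 * p ^ 2 * e
        + 37 * X ^ 36 * p ^ 3 + 108 * X ^ 40 * e ^ 2 + 216 * X ^ 40 * p + 648 * X ^ 40 * p * e
        + 324 * X ^ 40 * p * e ^ 2 + 405 * X ^ 40 * p ^ 2 + 378 * X ^ 40 * p ^ 2 * e
        + 24 * X ^ 44 * e ^ 2 + 36 * X ^ 44 * e ^ 3 + 24 * X ^ 44 * p + 132 * X ^ 44 * p * e
        + 216 * X ^ 44 * p * e ^ 2 + 54 * X ^ 44 * p * e ^ 3 + 94 * X ^ 44 * p ^ 2
        + 263 * X ^ 44 * p ^ 2 * e + 124 * X ^ 44 * p ^ 2 * e ^ 2 + 84 * X ^ 44 * p ^ 3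
        + 73 * X ^ 44 * p ^ 3 * e + 264 * X ^ 48 * p * e + 264 * X ^ 48 * p * e ^ 2
        + 132 * X ^ 48 * p ^ 2 + 132 * X ^ 48 * p ^ 2 * e + 8 * X ^ 52 * e ^ 3 + 48 * X ^ 52 * p * e
        + 132 * X ^ 52 * p * e ^ 2 + 72 * X ^ 52 * p * e ^ 3 + 30 * X ^ 52 * p ^ 2
        + 162 * X ^ 52 * p ^ 2 * e + 126 * X ^ 52 * p ^ 2 * e ^ 2 + 43 * X ^ 52 * p ^ 3
        + 42 * X ^ 52 * p ^ 3 * e + 156 * X ^ 56 * p ^ 2 + 312 * X ^ 56 * p ^ 2 * e
        + 156 * X ^ 56 * p ^ 2 * e ^ 2 + 24 * X ^ 60 * p * e ^ 2 + 24 * X ^ 60 * p * e ^ 3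
        + 24 * X ^ 60 * p ^ 2 + 108 * X ^ 60 * p ^ 2 * e + 120 * X ^ 60 * p ^ 2 * e ^ 2
        + 36 * X ^ 60 * p ^ 2 * e ^ 3 + 48 * X ^ 60 * p ^ 3 + 90 * X ^ 60 * p ^ 3 * e
        + 42 * X ^ 60 * p ^ 3 * e ^ 2 + 24 * X ^ 68 * p ^ 2 * e + 48 * X ^ 68 * p ^ 2 * e ^ 2
        + 24 * X ^ 68 * p ^ 2 * e ^ 3 + 12 * X ^ 68 * p ^ 3 + 24 * X ^ 68 * p ^ 3 * e
        + 12 * X ^ 68 * p ^ 3 * e ^ 2 + 8 * X ^ 76 * p ^ 3 + 24 * X ^ 76 * p ^ 3 * e
        + 24 * X ^ 76 * p ^ 3 * e ^ 2 + 8 * X ^ 76 * p ^ 3 * e ^ 3)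
      + (3 * X ^ 12 - X ^ 4 + 3 * X ^ 16 * Q_solution X p e + 18 * X ^ 16) * u + X ^ 16 * u')
      + (X ^ 4 - 2 * X ^ 8 + 6 * X ^ 12 * e - X ^ 12 * p + 4 * X ^ 20 + 4 * X ^ 20 * e - 2 * X ^ 20 * p
        + 4 * X ^ 28 * p * e)
        * (X ^ 16 * p ^ 2 - (2 * e - p - 1))
      + (4 * X ^ 4 + 4 * X ^ 12 * p)
        * (X ^ 16 * e ^ 2 - (e - 1 - X ^ 16 * p + X ^ 16 + 2 * f))"
    unfolding t t' Q_solution_def by algebra
  have "X ^ 16 * p ^ 2 - (2 * e - p - 1) = 0" "X ^ 16 * e ^ 2 - (e - 1 - X ^ 16 * p + X ^ 16 + 2 * f) = 0"
    using p_sq e_sq by simp_all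
  then show ?thesis
    unfolding R by (simp only: mult_zero_left mult_zero_right add_0_right diff_zero dvd_triv_left)
qed

text \<open>Returns from p, e and p', e' to \<Phi>, after both sides have been multiplied by z^13 to
  clear denominators. The second solution stands for z times its series, hence its smaller factor
  z^12.\<close>

lemma solution_sum:
  fixes X p p' e e' \<Phi> :: "int fps"
  assumes p_sq: "X ^ 8 * p ^ 2 = 2 * e - p - 1" and p': "X ^ 8 * p' = p - 1" and e': "X ^ 8 * e' = e - 1
      - X ^ 8 * p + X ^ 8"
    and \<Phi>: "\<Phi> = X + X ^ 2 + X ^ 4 + X ^ 8 * p"
  shows "8 dvd (6 * X + 3 * X ^ 2 + X ^ 4 + 4 * X ^ 5 + 6 * X ^ 6 + 6 * X ^ 7 + 3 * X ^ 10 + 7 * X ^ 11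
        + 6 * X ^ 13 + 4 * X ^ 14 + 4 * X ^ 15 + 6 * X ^ 17 + 4 * X ^ 18 + 6 * X ^ 21 + 4 * X ^ 22
        + 4 * X ^ 23 + 4 * X ^ 25 + 4 * X ^ 27 + 4 * X ^ 30 + 4 * X ^ 33)
      + (2 + 6 * X + 4 * X ^ 3 + 4 * X ^ 4 + 4 * X ^ 5 + 2 * X ^ 6 + 6 * X ^ 7 + 6 * X ^ 9 + 6 * X ^ 10
        + 4 * X ^ 12 + 4 * X ^ 15 + 4 * X ^ 16) * \<Phi>
      + (5 + 6 * X + 6 * X ^ 2 + 4 * X ^ 3 + 6 * X ^ 4 + 4 * X ^ 5 + X ^ 6 + 6 * X ^ 7 + 2 * X ^ 8
        + 5 * X ^ 9 + 2 * X ^ 10 + 6 * X ^ 11 + 4 * X ^ 12 + 4 * X ^ 13 + 6 * X ^ 15 + 4 * X ^ 16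
        + 4 * X ^ 17 + 4 * X ^ 21) * \<Phi> ^ 2
      + (2 + 4 * X + 4 * X ^ 2 + 4 * X ^ 4 + 2 * X ^ 6 + 4 * X ^ 7 + 4 * X ^ 8 + 2 * X ^ 9 + 4 * X ^ 10
        + 4 * X ^ 11 + 4 * X ^ 15) * \<Phi> ^ 3
      - (X ^ 13 * P_solution X p e + X ^ 12 * Q_solution X p' e')" (is "_ dvd ?R")
proof -
  have R: "?R = 8 * (X + 2 * X ^ 2 + 3 * X ^ 3 + 5 * X ^ 4 + 9 * X ^ 5 + 11 * X ^ 6 + 13 * X ^ 7 + 16 * X ^ 8
        - 2 * X ^ 8 * e + 12 * X ^ 9 + 2 * X ^ 9 * e + X ^ 9 * p + 13 * X ^ 10 + X ^ 10 * e
        + 3 * X ^ 10 * p + 15 * X ^ 11 + X ^ 11 * e + 6 * X ^ 11 * p + 12 * X ^ 12 + X ^ 12 * e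
        + 9 * X ^ 12 * p + 14 * X ^ 13 + X ^ 13 * e + 10 * X ^ 13 * p + 16 * X ^ 14 - X ^ 14 * e
        + 11 * X ^ 14 * p + 13 * X ^ 15 + 2 * X ^ 15 * e + 11 * X ^ 15 * p + 12 * X ^ 16
        + 2 * X ^ 16 * e + 9 * X ^ 16 * p + X ^ 16 * p ^ 2 + 15 * X ^ 17 - 2 * X ^ 17 * e
        + 11 * X ^ 17 * p + X ^ 17 * p * e + 12 * X ^ 18 + X ^ 18 * e + 11 * X ^ 18 * p
        + X ^ 18 * p * e + 2 * X ^ 18 * p ^ 2 + 9 * X ^ 19 + 2 * X ^ 19 * e + 9 * X ^ 19 * p
        + 3 * X ^ 19 * p ^ 2 + 9 * X ^ 20 + 13 * X ^ 20 * p + X ^ 20 * p * e + 2 * X ^ 20 * p ^ 2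
        + 8 * X ^ 21 - X ^ 21 * e + 15 * X ^ 21 * p + 3 * X ^ 21 * p ^ 2 + 5 * X ^ 22 + X ^ 22 * e
        + 11 * X ^ 22 * p + 3 * X ^ 22 * p ^ 2 + 4 * X ^ 23 + X ^ 23 * e + 9 * X ^ 23 * p
        + X ^ 23 * p * e + 3 * X ^ 24 + 9 * X ^ 24 * p + X ^ 24 * p * e + 3 * X ^ 24 * p ^ 2
        + 3 * X ^ 25 + 8 * X ^ 25 * p + 4 * X ^ 25 * p ^ 2 + X ^ 26 + 6 * X ^ 26 * p + X ^ 26 * p * e
        + 2 * X ^ 26 * p ^ 2 + X ^ 27 + X ^ 27 * e + 4 * X ^ 27 * p + X ^ 27 * p * e
        + 3 * X ^ 27 * p ^ 2 + 4 * X ^ 28 * p + 5 * X ^ 28 * p ^ 2 + X ^ 29 * e + 3 * X ^ 29 * p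
        + 3 * X ^ 29 * p ^ 2 + X ^ 30 * p + X ^ 30 * p ^ 2 + 2 * X ^ 31 * p + X ^ 31 * p * e
        + X ^ 31 * p ^ 2 + 2 * X ^ 32 * p ^ 2 + X ^ 33 * p + 2 * X ^ 33 * p ^ 2 + X ^ 35 * p ^ 2)
      + (- 5 * X ^ 8 + 8 * X ^ 9 + 4 * X ^ 10 + 4 * X ^ 11 + 4 * X ^ 12 + 4 * X ^ 13 - X ^ 14
        + 8 * X ^ 15 + 8 * X ^ 16 + 2 * X ^ 16 * p - 5 * X ^ 17 + 4 * X ^ 17 * p + 6 * X ^ 18
        + 4 * X ^ 18 * p + 8 * X ^ 19 + 4 * X ^ 20 * p - 2 * X ^ 21 + 4 * X ^ 22 + 2 * X ^ 22 * p
        + 6 * X ^ 23 + 4 * X ^ 23 * p + 4 * X ^ 24 * p + 2 * X ^ 25 * p + 4 * X ^ 26 * p + 4 * X ^ 27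
        + 4 * X ^ 27 * p + 4 * X ^ 29 + 4 * X ^ 31 * p)
        * (X ^ 8 * p ^ 2 - (2 * e - p - 1))
      - (6 * X ^ 8 + 4 * X ^ 16) * (X ^ 8 * e' - (e - 1 - X ^ 8 * p + X ^ 8))
      - (7 * X ^ 8 + 2 * X ^ 16 + 4 * X ^ 24) * (X ^ 8 * p' - (p - 1))
      - 4 * X ^ 16 * ((X ^ 8 * e' - (e - 1 - X ^ 8 * p + X ^ 8)) * (X ^ 8 * p') + (e - 1 - X ^ 8 * p
      + X ^ 8) * (X ^ 8 * p' - (p - 1)))"
    unfolding \<Phi> P_solution_def Q_solution_def by algebra
  have "X ^ 8 * p ^ 2 - (2 * e - p - 1) = 0" "X ^ 8 * p' - (p - 1) = 0" "X ^ 8 * e' - (e - 1 - X ^ 8 * p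
      + X ^ 8) = 0"
    using p_sq p' e' by simp_all
  then show ?thesis
    unfolding R by (simp only: mult_zero_left mult_zero_right add_0_right diff_zero dvd_triv_left)
qed

section \<open>Derivatives and uniqueness of the solutions\<close>

text \<open>The derivative of p is divisible by 8, that of e only by 4, but e occurs with even
  coefficients. So modulo 8 the Euler operator acts on the powers of z alone.\<close>

lemma fps_theta_P_solution:
  assumes "fps_theta p = 8 * u" "fps_theta e = 4 * v"
  shows "fps_theta (P_solution fps_X p e) =
     (4 * fps_X + 8 * fps_X ^ 2 + 16 * fps_X ^ 4 + 12 * fps_X ^ 6 + 16 * fps_X ^ 8 + 36 * fps_X ^ 9
         + 44 * fps_X ^ 11
        + 56 * fps_X ^ 14 + 68 * fps_X ^ 17 + 80 * fps_X ^ 20)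
     + (6 * fps_X + 24 * fps_X ^ 4 + 20 * fps_X ^ 5 + 32 * fps_X ^ 8 + 40 * fps_X ^ 10) * e
     + (7 * fps_X + 12 * fps_X ^ 4 + 10 * fps_X ^ 5 + 16 * fps_X ^ 8 + 36 * fps_X ^ 9 + 20 * fps_X ^ 10
         + 48 * fps_X ^ 12
        + 56 * fps_X ^ 14 + 64 * fps_X ^ 16) * p
     + (36 * fps_X ^ 9 + 48 * fps_X ^ 12) * (p * e)
    + 8 * ((7 * fps_X + 3 * fps_X ^ 4 + 2 * fps_X ^ 5 + 2 * fps_X ^ 8 + 4 * fps_X ^ 9 + 2 * fps_X ^ 10
        + 4 * fps_X ^ 12 + 4 * fps_X ^ 14
        + 4 * fps_X ^ 16) * u + (3 * fps_X + 3 * fps_X ^ 4 + 2 * fps_X ^ 5 + 2 * fps_X ^ 8 + 2 * fps_X ^ 10) * v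
      + (4 * fps_X ^ 9 + 4 * fps_X ^ 12) * (u * e) + (2 * fps_X ^ 9 + 2 * fps_X ^ 12) * (p * v))"
  unfolding P_solution_def Q_solution_def fps_theta_diff fps_theta_add fps_theta_mult fps_theta_X_power
      fps_theta_X
    fps_theta_numeral fps_theta_1 assms of_nat_numeral
  by (simp add: algebra_simps)

lemma fps_theta_Q_solution:
  assumes "fps_theta p = 8 * u" "fps_theta e = 4 * v"
  shows "fps_theta (Q_solution fps_X p e) =
     (16 * fps_X ^ 4) + (24 * fps_X ^ 4 + 48 * fps_X ^ 12) * e + (28 * fps_X ^ 4 + 24 * fps_X ^ 12
         + 80 * fps_X ^ 20) * p + (80 * fps_X ^ 20) * (p * e)
    + 8 * ((7 * fps_X ^ 4 + 2 * fps_X ^ 12 + 4 * fps_X ^ 20) * u + (3 * fps_X ^ 4 + 2 * fps_X ^ 12) * v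
      + (4 * fps_X ^ 20) * (u * e) + (2 * fps_X ^ 20) * (p * v))"
  unfolding P_solution_def Q_solution_def fps_theta_diff fps_theta_add fps_theta_mult fps_theta_X_power
      fps_theta_X
    fps_theta_numeral fps_theta_1 assms of_nat_numeral
  by (simp add: algebra_simps)

lemma fps_theta_Q_solution':
  assumes "fps_theta p = 8 * u" "fps_theta e = 4 * v"
  shows "fps_theta ((16 * fps_X ^ 4) + (24 * fps_X ^ 4 + 48 * fps_X ^ 12) * e + (28 * fps_X ^ 4
      + 24 * fps_X ^ 12 + 80 * fps_X ^ 20) * p + (80 * fps_X ^ 20) * (p * e)) =
     (64 * fps_X ^ 4) + (96 * fps_X ^ 4 + 576 * fps_X ^ 12) * e + (112 * fps_X ^ 4 + 288 * fps_X ^ 12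
         + 1600 * fps_X ^ 20) * p + (1600 * fps_X ^ 20) * (p * e)
    + 8 * ((28 * fps_X ^ 4 + 24 * fps_X ^ 12 + 80 * fps_X ^ 20) * u + (12 * fps_X ^ 4 + 24 * fps_X ^ 12) * v
      + (80 * fps_X ^ 20) * (u * e) + (40 * fps_X ^ 20) * (p * v))"
  unfolding P_solution_def Q_solution_def fps_theta_diff fps_theta_add fps_theta_mult fps_theta_X_power
      fps_theta_X
    fps_theta_numeral fps_theta_1 assms of_nat_numeral
  by (simp add: algebra_simps)

text \<open>The coefficient of S in the Riccati equation has constant term -1. Subtracting the
  equation of the candidate from that of S therefore expresses the difference as z times a linear
  expression in itself and its Euler derivative, modulo 8.\<close>

lemma P_series_mod_8:
  fixes S :: "int fps"
  assumes S: "(fps_X ^ 7 - fps_X ^ 10) * (fps_deriv S + S ^ 2) + (-1 + 4 * fps_X ^ 3 + 2 * fps_X ^ 4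
      + 4 * fps_X ^ 6 - 2 * fps_X ^ 7 - 4 * fps_X ^ 9) * S + (1 + fps_X + 4 * fps_X ^ 2 + 4 * fps_X ^ 3
      - fps_X ^ 4 + 4 * fps_X ^ 5 - 2 * fps_X ^ 6 - 2 * fps_X ^ 8) = 0"
    and p_sq: "fps_X ^ 8 * p ^ 2 = 2 * e - p - 1"
    and e_sq: "fps_X ^ 8 * e ^ 2 = e - 1 - fps_X ^ 8 * p + fps_X ^ 8 + 2 * f"
    and p: "fps_theta p = 8 * u" and e: "fps_theta e = 4 * v"
  shows "8 dvd S - P_solution fps_X p e"
proof -
  define F where "F = P_solution fps_X p e"
  obtain r where r: "(fps_X ^ 6 - fps_X ^ 9) * (fps_theta F + fps_X * F ^ 2) + (-1 + 4 * fps_X ^ 3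
      + 2 * fps_X ^ 4 + 4 * fps_X ^ 6 - 2 * fps_X ^ 7 - 4 * fps_X ^ 9) * F + (1 + fps_X + 4 * fps_X ^ 2
      + 4 * fps_X ^ 3 - fps_X ^ 4 + 4 * fps_X ^ 5 - 2 * fps_X ^ 6 - 2 * fps_X ^ 8) = 8 * r"
    using P_solution_residue[OF p_sq e_sq fps_theta_P_solution[OF p e]] unfolding F_def by blast
  define d where "d = S - F"
  have \<theta>: "fps_X * fps_deriv S = fps_theta F + fps_theta d"
    by (simp add: d_def fps_theta_def algebra_simps)
  have S_eq: "S = F + d" by (simp add: d_def)
  let ?t = "fps_theta F" and ?q = "fps_theta d"
  \<comment> \<open>One factor z is moved to the derivative, turning S' into the Euler derivative,
    to which divisibility by 8 applies.\<close>
  have "(fps_X ^ 6 - fps_X ^ 9) * (fps_X * fps_deriv S + fps_X * S ^ 2) + (-1 + 4 * fps_X ^ 3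
      + 2 * fps_X ^ 4 + 4 * fps_X ^ 6 - 2 * fps_X ^ 7 - 4 * fps_X ^ 9) * S + (1 + fps_X + 4 * fps_X ^ 2
      + 4 * fps_X ^ 3 - fps_X ^ 4 + 4 * fps_X ^ 5 - 2 * fps_X ^ 6 - 2 * fps_X ^ 8) =
      (fps_X ^ 7 - fps_X ^ 10) * (fps_deriv S + S ^ 2) + (-1 + 4 * fps_X ^ 3 + 2 * fps_X ^ 4
      + 4 * fps_X ^ 6 - 2 * fps_X ^ 7 - 4 * fps_X ^ 9) * S + (1 + fps_X + 4 * fps_X ^ 2 + 4 * fps_X ^ 3
      - fps_X ^ 4 + 4 * fps_X ^ 5 - 2 * fps_X ^ 6 - 2 * fps_X ^ 8)"
    by algebra
  then have E1: "(fps_X ^ 6 - fps_X ^ 9) * (?t + ?q + fps_X * (F + d) ^ 2) + (-1 + 4 * fps_X ^ 3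
      + 2 * fps_X ^ 4 + 4 * fps_X ^ 6 - 2 * fps_X ^ 7 - 4 * fps_X ^ 9) * (F + d) + (1 + fps_X
      + 4 * fps_X ^ 2 + 4 * fps_X ^ 3 - fps_X ^ 4 + 4 * fps_X ^ 5 - 2 * fps_X ^ 6
      - 2 * fps_X ^ 8) = 0" (is "?E1 = 0")
    using S unfolding \<theta> unfolding S_eq by simp
  \<comment> \<open>The quadratic terms differ by (2F + d) d, which keeps the difference formally
    linear in d.\<close>
  have "fps_X * ((4 * fps_X ^ 2 + 2 * fps_X ^ 3 + 4 * fps_X ^ 5 - 2 * fps_X ^ 6 - 4 * fps_X ^ 8
      + (fps_X ^ 6 - fps_X ^ 9) * (2 * F + d)) * d + (fps_X ^ 5 - fps_X ^ 8) * ?q + 0 * fps_theta (fps_theta d))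
    = d + ?E1 - ((fps_X ^ 6 - fps_X ^ 9) * (?t + fps_X * F ^ 2) + (-1 + 4 * fps_X ^ 3 + 2 * fps_X ^ 4
        + 4 * fps_X ^ 6 - 2 * fps_X ^ 7 - 4 * fps_X ^ 9) * F + (1 + fps_X + 4 * fps_X ^ 2 + 4 * fps_X ^ 3
        - fps_X ^ 4 + 4 * fps_X ^ 5 - 2 * fps_X ^ 6 - 2 * fps_X ^ 8))"
    by algebra
  then have "d = fps_X * ((4 * fps_X ^ 2 + 2 * fps_X ^ 3 + 4 * fps_X ^ 5 - 2 * fps_X ^ 6 - 4 * fps_X ^ 8
      + (fps_X ^ 6 - fps_X ^ 9) * (2 * F + d)) * d + (fps_X ^ 5 - fps_X ^ 8) * ?q
      + 0 * fps_theta (fps_theta d)) + 8 * r"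
    unfolding E1 r by simp
  then show ?thesis unfolding d_def[symmetric] F_def[symmetric] by (rule dvd_of_contraction)
qed

lemma Q_series_mod_8:
  fixes T :: "int fps"
  defines "T1 \<equiv> fps_theta T" and "T2 \<equiv> fps_theta (fps_theta T)"
  assumes T: "T = fps_X ^ 4 * (1 + 6 * T - T1 - T ^ 2) + 3 * fps_X ^ 8 * (T + 2) + 3 * fps_X ^ 12 * (T1
      + T ^ 2 + 8 * T + 12)
     + fps_X ^ 16 * (T2 + 3 * T * T1 + T ^ 3 + 18 * (T1 + T ^ 2) + 92 * T + 120)"
    and p_sq: "fps_X ^ 16 * p ^ 2 = 2 * e - p - 1"
    and e_sq: "fps_X ^ 16 * e ^ 2 = e - 1 - fps_X ^ 16 * p + fps_X ^ 16 + 2 * f"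
    and p: "fps_theta p = 8 * u" and e: "fps_theta e = 4 * v"
  shows "8 dvd T - Q_solution fps_X p e"
proof -
  define F where "F = Q_solution fps_X p e"
  define F1 where "F1 = fps_theta F"
  define F2 where "F2 = fps_theta F1"
  obtain w where w: "F1 = (16 * fps_X ^ 4) + (24 * fps_X ^ 4 + 48 * fps_X ^ 12) * e + (28 * fps_X ^ 4
      + 24 * fps_X ^ 12 + 80 * fps_X ^ 20) * p + (80 * fps_X ^ 20) * (p * e) + 8 * w"
    using fps_theta_Q_solution[OF p e] unfolding F1_def F_def by blast
  have w': "\<exists>w'. F2 = (64 * fps_X ^ 4) + (96 * fps_X ^ 4 + 576 * fps_X ^ 12) * e + (112 * fps_X ^ 4
      + 288 * fps_X ^ 12 + 1600 * fps_X ^ 20) * p + (1600 * fps_X ^ 20) * (p * e) + 8 * w'"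
  proof -
    have th8: "fps_theta (8 * w) = 8 * fps_theta w" by (simp add: fps_theta_mult)
    show ?thesis
      unfolding F2_def w fps_theta_add[of _ "8 * w"] th8 fps_theta_Q_solution'[OF p e]
      unfolding add.assoc[of _ "8 * _" "8 * _"] distrib_left[of 8, symmetric] by blast
  qed
  then obtain w' where w': "F2 = (64 * fps_X ^ 4) + (96 * fps_X ^ 4 + 576 * fps_X ^ 12) * e
      + (112 * fps_X ^ 4 + 288 * fps_X ^ 12 + 1600 * fps_X ^ 20) * p + (1600 * fps_X ^ 20) * (p * e)
      + 8 * w'" by blast
  obtain r where r: "fps_X ^ 4 * (1 + 6 * F - F1 - F ^ 2) + 3 * fps_X ^ 8 * (F + 2)
      + 3 * fps_X ^ 12 * (F1 + F ^ 2 + 8 * F + 12)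
     + fps_X ^ 16 * (F2 + 3 * F * F1 + F ^ 3 + 18 * (F1 + F ^ 2) + 92 * F + 120) - F = 8 * r"
    using Q_solution_residue[OF p_sq e_sq w w'] unfolding F_def by blast
  define d where "d = T - F"
  define d1 where "d1 = fps_theta d"
  define d2 where "d2 = fps_theta d1"
  have TF: "T = F + d" by (simp add: d_def)
  have T1F: "T1 = F1 + d1" unfolding T1_def TF fps_theta_add by (simp add: F1_def d1_def)
  have T2F: "T2 = F2 + d2"
    unfolding T2_def using T1F[unfolded T1_def] by (simp add: fps_theta_add F2_def d2_def)
  \<comment> \<open>The nonlinear terms are split as T^2 - F^2 = (T + F) d, T^3 - F^3 = (T^2 + TF +
    F^2) d and T T1 - F F1 = T1 d + F d1.\<close>
  have "fps_X * ((fps_X ^ 3 * (6 - (T + F)) + 3 * fps_X ^ 7 + 3 * fps_X ^ 11 * (T + F + 8)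
      + fps_X ^ 15 * (3 * T1 + T ^ 2 + T * F + F ^ 2 + 18 * (T + F) + 92)) * d
      + (3 * fps_X ^ 11 - fps_X ^ 3 + fps_X ^ 15 * (3 * F + 18)) * d1 + fps_X ^ 15 * d2) =
     (fps_X ^ 4 * (1 + 6 * T - T1 - T ^ 2) + 3 * fps_X ^ 8 * (T + 2) + 3 * fps_X ^ 12 * (T1 + T ^ 2
         + 8 * T + 12)
     + fps_X ^ 16 * (T2 + 3 * T * T1 + T ^ 3 + 18 * (T1 + T ^ 2) + 92 * T + 120)) - F
     - (fps_X ^ 4 * (1 + 6 * F - F1 - F ^ 2) + 3 * fps_X ^ 8 * (F + 2) + 3 * fps_X ^ 12 * (F1 + F ^ 2
         + 8 * F + 12)
     + fps_X ^ 16 * (F2 + 3 * F * F1 + F ^ 3 + 18 * (F1 + F ^ 2) + 92 * F + 120) - F)"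
    unfolding T2F T1F TF by algebra
  also have "\<dots> = d - 8 * r"
    unfolding r T[symmetric] by (simp add: d_def)
  finally have "d = fps_X * ((fps_X ^ 3 * (6 - (T + F)) + 3 * fps_X ^ 7 + 3 * fps_X ^ 11 * (T + F + 8)
      + fps_X ^ 15 * (3 * T1 + T ^ 2 + T * F + F ^ 2 + 18 * (T + F) + 92)) * d
      + (3 * fps_X ^ 11 - fps_X ^ 3 + fps_X ^ 15 * (3 * F + 18)) * d1 + fps_X ^ 15 * d2) + 8 * r"
    by simp
  then show ?thesis unfolding d_def[symmetric] F_def[symmetric] d2_def d1_def by (rule dvd_of_contraction)
qed

text \<open>\<open>Y\<close> stands for 1/z. Treating it as a second variable reduces the Laurent
  expression to a polynomial identity modulo the relations X^13 Y^k = X^(13-k) for k \<le> 13, the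
  highest power of \<open>Y\<close> that occurs.\<close>

lemma laurent_clear_denominators:
  fixes X Y \<Phi> :: "'a::idom"
  assumes "X * Y = 1"
  shows "X ^ 13 * (4 * X ^ 20 + 4 * X ^ 17 + 4 * X ^ 14 + 4 * X ^ 12 + 4 * X ^ 10 +
     4 * X ^ 9 + 6 * X ^ 8 + 4 * X ^ 5 + 6 * X ^ 4 + 4 * X ^ 2 +
     4 * X + 6 + 7 * Y ^ 2 + 3 * Y ^ 3 + 6 * Y ^ 6 +
     6 * Y ^ 7 + 4 * Y ^ 8 + Y ^ 9 + 3 * Y ^ 11 + 6 * Y ^ 12 +
     (4 * X ^ 3 + 4 * X ^ 2 + 4 * Y + 6 * Y ^ 3 + 6 * Y ^ 4 +
      6 * Y ^ 6 + 2 * Y ^ 7 + 4 * Y ^ 8 + 4 * Y ^ 9 + 4 * Y ^ 10 +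
      6 * Y ^ 12 + 2 * Y ^ 13) * \<Phi> +
     (4 * X ^ 8 + 4 * X ^ 4 + 4 * X ^ 3 + 6 * X ^ 2 + 4 +
      4 * Y + 6 * Y ^ 2 + 2 * Y ^ 3 + 5 * Y ^ 4 + 2 * Y ^ 5 +
      6 * Y ^ 6 + Y ^ 7 + 4 * Y ^ 8 + 6 * Y ^ 9 + 4 * Y ^ 10 +
      6 * Y ^ 11 + 6 * Y ^ 12 + 5 * Y ^ 13) * \<Phi> ^ 2 +
     (4 * X ^ 2 + 4 * Y ^ 2 + 4 * Y ^ 3 + 2 * Y ^ 4 + 4 * Y ^ 5 +
      4 * Y ^ 6 + 2 * Y ^ 7 + 4 * Y ^ 9 + 4 * Y ^ 11 + 4 * Y ^ 12 +
      2 * Y ^ 13) * \<Phi> ^ 3) =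
      (6 * X + 3 * X ^ 2 + X ^ 4 + 4 * X ^ 5 + 6 * X ^ 6 + 6 * X ^ 7 + 3 * X ^ 10 + 7 * X ^ 11
        + 6 * X ^ 13 + 4 * X ^ 14 + 4 * X ^ 15 + 6 * X ^ 17 + 4 * X ^ 18 + 6 * X ^ 21 + 4 * X ^ 22
        + 4 * X ^ 23 + 4 * X ^ 25 + 4 * X ^ 27 + 4 * X ^ 30 + 4 * X ^ 33)
      + (2 + 6 * X + 4 * X ^ 3 + 4 * X ^ 4 + 4 * X ^ 5 + 2 * X ^ 6 + 6 * X ^ 7 + 6 * X ^ 9 + 6 * X ^ 10
        + 4 * X ^ 12 + 4 * X ^ 15 + 4 * X ^ 16) * \<Phi>
      + (5 + 6 * X + 6 * X ^ 2 + 4 * X ^ 3 + 6 * X ^ 4 + 4 * X ^ 5 + X ^ 6 + 6 * X ^ 7 + 2 * X ^ 8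
        + 5 * X ^ 9 + 2 * X ^ 10 + 6 * X ^ 11 + 4 * X ^ 12 + 4 * X ^ 13 + 6 * X ^ 15 + 4 * X ^ 16
        + 4 * X ^ 17 + 4 * X ^ 21) * \<Phi> ^ 2
      + (2 + 4 * X + 4 * X ^ 2 + 4 * X ^ 4 + 2 * X ^ 6 + 4 * X ^ 7 + 4 * X ^ 8 + 2 * X ^ 9 + 4 * X ^ 10
        + 4 * X ^ 11 + 4 * X ^ 15) * \<Phi> ^ 3"
proof -
  have *: "X ^ 13 * Y ^ k - X ^ j = 0" if "13 = j + k" for j k
  proof -
    have "X ^ 13 * Y ^ k = X ^ j * (X * Y) ^ k" unfolding that by (simp add: power_add power_mult_distrib)
    then show ?thesis using assms by simp
  qed
  have z: "X ^ 13 * Y ^ 1 - X ^ 12 = 0" "X ^ 13 * Y ^ 2 - X ^ 11 = 0" "X ^ 13 * Y ^ 3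
      - X ^ 10 = 0" "X ^ 13 * Y ^ 4 - X ^ 9 = 0" "X ^ 13 * Y ^ 5 - X ^ 8 = 0" "X ^ 13 * Y ^ 6
      - X ^ 7 = 0" "X ^ 13 * Y ^ 7 - X ^ 6 = 0" "X ^ 13 * Y ^ 8 - X ^ 5 = 0" "X ^ 13 * Y ^ 9
      - X ^ 4 = 0" "X ^ 13 * Y ^ 10 - X ^ 3 = 0" "X ^ 13 * Y ^ 11 - X ^ 2 = 0" "X ^ 13 * Y ^ 12
      - X ^ 1 = 0" "X ^ 13 * Y ^ 13 - X ^ 0 = 0"
    by (rule *, simp)+
  have "X ^ 13 * (4 * X ^ 20 + 4 * X ^ 17 + 4 * X ^ 14 + 4 * X ^ 12 + 4 * X ^ 10 +
     4 * X ^ 9 + 6 * X ^ 8 + 4 * X ^ 5 + 6 * X ^ 4 + 4 * X ^ 2 +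
     4 * X + 6 + 7 * Y ^ 2 + 3 * Y ^ 3 + 6 * Y ^ 6 +
     6 * Y ^ 7 + 4 * Y ^ 8 + Y ^ 9 + 3 * Y ^ 11 + 6 * Y ^ 12 +
     (4 * X ^ 3 + 4 * X ^ 2 + 4 * Y + 6 * Y ^ 3 + 6 * Y ^ 4 +
      6 * Y ^ 6 + 2 * Y ^ 7 + 4 * Y ^ 8 + 4 * Y ^ 9 + 4 * Y ^ 10 +
      6 * Y ^ 12 + 2 * Y ^ 13) * \<Phi> +
     (4 * X ^ 8 + 4 * X ^ 4 + 4 * X ^ 3 + 6 * X ^ 2 + 4 +
      4 * Y + 6 * Y ^ 2 + 2 * Y ^ 3 + 5 * Y ^ 4 + 2 * Y ^ 5 +
      6 * Y ^ 6 + Y ^ 7 + 4 * Y ^ 8 + 6 * Y ^ 9 + 4 * Y ^ 10 +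
      6 * Y ^ 11 + 6 * Y ^ 12 + 5 * Y ^ 13) * \<Phi> ^ 2 +
     (4 * X ^ 2 + 4 * Y ^ 2 + 4 * Y ^ 3 + 2 * Y ^ 4 + 4 * Y ^ 5 +
      4 * Y ^ 6 + 2 * Y ^ 7 + 4 * Y ^ 9 + 4 * Y ^ 11 + 4 * Y ^ 12 +
      2 * Y ^ 13) * \<Phi> ^ 3) =
      (6 * X + 3 * X ^ 2 + X ^ 4 + 4 * X ^ 5 + 6 * X ^ 6 + 6 * X ^ 7 + 3 * X ^ 10 + 7 * X ^ 11
        + 6 * X ^ 13 + 4 * X ^ 14 + 4 * X ^ 15 + 6 * X ^ 17 + 4 * X ^ 18 + 6 * X ^ 21 + 4 * X ^ 22
        + 4 * X ^ 23 + 4 * X ^ 25 + 4 * X ^ 27 + 4 * X ^ 30 + 4 * X ^ 33)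
      + (2 + 6 * X + 4 * X ^ 3 + 4 * X ^ 4 + 4 * X ^ 5 + 2 * X ^ 6 + 6 * X ^ 7 + 6 * X ^ 9 + 6 * X ^ 10
        + 4 * X ^ 12 + 4 * X ^ 15 + 4 * X ^ 16) * \<Phi>
      + (5 + 6 * X + 6 * X ^ 2 + 4 * X ^ 3 + 6 * X ^ 4 + 4 * X ^ 5 + X ^ 6 + 6 * X ^ 7 + 2 * X ^ 8
        + 5 * X ^ 9 + 2 * X ^ 10 + 6 * X ^ 11 + 4 * X ^ 12 + 4 * X ^ 13 + 6 * X ^ 15 + 4 * X ^ 16
        + 4 * X ^ 17 + 4 * X ^ 21) * \<Phi> ^ 2
      + (2 + 4 * X + 4 * X ^ 2 + 4 * X ^ 4 + 2 * X ^ 6 + 4 * X ^ 7 + 4 * X ^ 8 + 2 * X ^ 9 + 4 * X ^ 10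
        + 4 * X ^ 11 + 4 * X ^ 15) * \<Phi> ^ 3
      + (4 * \<Phi> + 4 * \<Phi> ^ 2) * (X ^ 13 * Y ^ 1 - X ^ 12)
      + (7 + 6 * \<Phi> ^ 2 + 4 * \<Phi> ^ 3) * (X ^ 13 * Y ^ 2 - X ^ 11)
      + (3 + 6 * \<Phi> + 2 * \<Phi> ^ 2 + 4 * \<Phi> ^ 3) * (X ^ 13 * Y ^ 3 - X ^ 10)
      + (6 * \<Phi> + 5 * \<Phi> ^ 2 + 2 * \<Phi> ^ 3) * (X ^ 13 * Y ^ 4 - X ^ 9)
      + (2 * \<Phi> ^ 2 + 4 * \<Phi> ^ 3) * (X ^ 13 * Y ^ 5 - X ^ 8)
      + (6 + 6 * \<Phi> + 6 * \<Phi> ^ 2 + 4 * \<Phi> ^ 3) * (X ^ 13 * Y ^ 6 - X ^ 7)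
      + (6 + 2 * \<Phi> + 1 * \<Phi> ^ 2 + 2 * \<Phi> ^ 3) * (X ^ 13 * Y ^ 7 - X ^ 6)
      + (4 + 4 * \<Phi> + 4 * \<Phi> ^ 2) * (X ^ 13 * Y ^ 8 - X ^ 5)
      + (1 + 4 * \<Phi> + 6 * \<Phi> ^ 2 + 4 * \<Phi> ^ 3) * (X ^ 13 * Y ^ 9 - X ^ 4)
      + (4 * \<Phi> + 4 * \<Phi> ^ 2) * (X ^ 13 * Y ^ 10 - X ^ 3)
      + (3 + 6 * \<Phi> ^ 2 + 4 * \<Phi> ^ 3) * (X ^ 13 * Y ^ 11 - X ^ 2)
      + (6 + 6 * \<Phi> + 6 * \<Phi> ^ 2 + 4 * \<Phi> ^ 3) * (X ^ 13 * Y ^ 12 - X ^ 1)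
      + (2 * \<Phi> + 5 * \<Phi> ^ 2 + 2 * \<Phi> ^ 3) * (X ^ 13 * Y ^ 13 - X ^ 0)"
    by algebra
  then show ?thesis unfolding z by simp
qed

section \<open>Subgroups of the modular group\<close>

lemma negative_one_commute: "mat2 (-1) 0 0 (-1) ** M = M ** mat2 (-1) 0 0 (-1)"
  by (subst (1 2) mat2_collapse[of M]) simp

text \<open>A family of arbitrary sets, so that its complement is the other family; being a subgroup
  is imposed separately in the counts.\<close>

definition even_subgroups :: "(int ^ 2 ^ 2) set set" where
  "even_subgroups = {H. mat2 (-1) 0 0 (-1) \<in> H}"

text \<open>Conjugation fixes the central element \<open>-I\<close>. The equivalence gives
  invariance of both the family and its complement.\<close>

lemma conjugate_mem_iff:
  assumes "g \<in> carrier SL2Z"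
  shows "(\<lambda>h. g \<otimes>\<^bsub>SL2Z\<^esub> h \<otimes>\<^bsub>SL2Z\<^esub> inv\<^bsub>SL2Z\<^esub> g) ` H \<in> even_subgroups \<longleftrightarrow> H \<in> even_subgroups"
proof -
  interpret group SL2Z by (rule group_SL2Z)
  let ?J = "mat2 (-1) 0 0 (-1)"
  have mult: "x \<otimes>\<^bsub>SL2Z\<^esub> y = x ** y" and one: "\<one>\<^bsub>SL2Z\<^esub> = mat 1" for x y
    by (simp_all add: SL2Z_def)
  define k where "k = inv\<^bsub>SL2Z\<^esub> g"
  have gk: "g ** k = mat 1" and kg: "k ** g = mat 1"
    using r_inv[OF assms] l_inv[OF assms] by (simp_all add: k_def mult one)
  have conj: "g ** h ** k = ?J \<longleftrightarrow> h = ?J" for h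
  proof
    assume *: "g ** h ** k = ?J"
    have "h = (k ** g) ** h ** (k ** g)" by (simp add: kg)
    also have "\<dots> = k ** (g ** h ** k) ** g" by (simp add: matrix_mul_assoc)
    also have "\<dots> = ?J ** (k ** g)" unfolding * by (simp add: negative_one_commute[symmetric] matrix_mul_assoc)
    finally show "h = ?J" by (simp add: kg)
  next
    assume h: "h = ?J"
    have "g ** h ** k = ?J ** g ** k" unfolding h by (simp only: negative_one_commute)
    also have "\<dots> = ?J ** (g ** k)" by (simp only: matrix_mul_assoc)
    finally show "g ** h ** k = ?J" by (simp add: gk)
  qed
  show ?thesis
    unfolding even_subgroups_def mult k_def[symmetric] by (simp add: image_iff eq_commute[of ?J] conj)
qed

lemma actions_SL2Z_even_iff:
  assumes "\<phi> \<in> actions SL2Z UNIV A"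
  shows "{g\<in>carrier SL2Z. \<phi> g x = x} \<in> even_subgroups \<longleftrightarrow> \<phi> SS (\<phi> SS x) = x"
proof -
  have J: "mat2 (-1) 0 0 (-1) = SS \<otimes>\<^bsub>SL2Z\<^esub> SS" "SS \<in> carrier SL2Z" "mat2 (-1) 0 0 (-1) \<in> carrier SL2Z"
    by (simp_all add: SL2Z_def)
  have "\<phi> (mat2 (-1) 0 0 (-1)) x = \<phi> SS (\<phi> SS x)"
    unfolding J(1) by (rule actionsD(3)[OF assms J(2,2)])
  then show ?thesis using J(3) by (simp add: even_subgroups_def)
qed

text \<open>If all stabilizers contain -I = S^2, then a^2 = 1 and hence b^3 = 1; apart from that
  \<open>a\<close> and \<open>b\<close> are independent.\<close>

lemma card_actions_even:
  fixes A :: "'a set"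
  assumes A: "finite A"
  shows "finite (actions SL2Z even_subgroups A)" "card (actions SL2Z even_subgroups A) = hP (card A)"
proof -
  let ?T = "{(a, b). a permutes A \<and> b permutes A \<and> a \<circ> a = b \<circ> b \<circ> b \<and> a \<circ> a \<circ> (a \<circ> a) = (id :: 'a \<Rightarrow> 'a)}"
  let ?R = "perm_roots (\<lambda>_ _. True) 2 id A \<times> perm_roots (\<lambda>_ _. True) 3 id A"
  have act: "actions SL2Z even_subgroups A = {\<phi>\<in>actions SL2Z UNIV A. \<forall>x\<in>A. \<phi> SS (\<phi> SS x) = x}"
    using actions_SL2Z_even_iff[of _ A] by (auto simp: actions_def)
  have T: "{p\<in>?T. \<forall>x\<in>A. fst p (fst p x) = x} = ?R"
  proof (intro equalityI subsetI)
    fix p assume p: "p \<in> {p\<in>?T. \<forall>x\<in>A. fst p (fst p x) = x}"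
    obtain a b where ab: "p = (a, b)" by (cases p)
    have "a (a x) = x" for x
      using p permutes_not_in[of a A x] by (cases "x \<in> A") (auto simp: ab)
    then have "a \<circ> a = id" by auto
    then show "p \<in> ?R" using p by (auto simp: perm_roots_def funpow_2_3 ab)
  next
    fix p assume "p \<in> ?R"
    then obtain a b where ab: "p = (a, b)" "a permutes A" "b permutes A" "a \<circ> a = id" "b \<circ> b \<circ> b = id"
      by (auto simp: perm_roots_def funpow_2_3)
    moreover have "a (a x) = x" for x using fun_cong[OF ab(4), of x] by simp
    ultimately show "p \<in> {p\<in>?T. \<forall>x\<in>A. fst p (fst p x) = x}" by simp
  qed
  have bij: "bij_betw (\<lambda>\<phi>. (\<phi> SS, \<phi> UU)) (actions SL2Z even_subgroups A) ?R"
    unfolding act T[symmetric] by (rule bij_betw_Collect[OF bij_betw_actions_SL2Z]) simp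
  have "finite ?R" using finite_perm_roots[OF A] by blast
  then show "finite (actions SL2Z even_subgroups A)" using bij_betw_finite[OF bij] by simp
  show "card (actions SL2Z even_subgroups A) = hP (card A)"
    using bij_betw_same_card[OF bij] card_involutions[OF A] card_cube_roots_id[OF A]
    by (simp add: card_cartesian_product)
qed

text \<open>No stabilizer contains \<open>-I\<close> exactly if z = a^2 has no fixed point in
  \<open>A\<close>. For fixed \<open>z\<close> the permutations \<open>a\<close> and
  \<open>b\<close> are an arbitrary square root and an arbitrary cube root, and their numbers depend
  on the size of \<open>A\<close> only.\<close>

lemma card_actions_odd:
  fixes A :: "'a set"
  assumes A: "finite A"
  shows "finite (actions SL2Z (- even_subgroups) A)" "card (actions SL2Z (- even_subgroups) A) = hQ (card A)"
proof -
  let ?T = "{(a, b). a permutes A \<and> b permutes A \<and> a \<circ> a = b \<circ> b \<circ> b \<and> a \<circ> a \<circ> (a \<circ> a) = (id :: 'a \<Rightarrow> 'a)}"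
  let ?S = "{p\<in>?T. \<forall>x\<in>A. fst p (fst p x) \<noteq> x}"
  let ?I = "perm_roots (\<noteq>) 2 id A"
  have act: "actions SL2Z (- even_subgroups) A = {\<phi>\<in>actions SL2Z UNIV A. \<forall>x\<in>A. \<phi> SS (\<phi> SS x) \<noteq> x}"
    using actions_SL2Z_even_iff[of _ A] by (auto simp: actions_def)
  have bij: "bij_betw (\<lambda>\<phi>. (\<phi> SS, \<phi> UU)) (actions SL2Z (- even_subgroups) A) ?S"
    unfolding act by (rule bij_betw_Collect[OF bij_betw_actions_SL2Z]) simp
  have fin: "finite ?S"
    by (rule finite_subset[of _ "{a. a permutes A} \<times> {b. b permutes A}"])
      (use finite_permutations[OF A] in auto)
  then show "finite (actions SL2Z (- even_subgroups) A)" using bij_betw_finite[OF bij] by simp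
  have "card (actions SL2Z (- even_subgroups) A) = card ?S" using bij by (rule bij_betw_same_card)
  also have "\<dots> = (\<Sum>z\<in>?I. card {p\<in>?S. fst p \<circ> fst p = z})"
  proof (rule card_eq_sum_fibres[OF fin finite_perm_roots[OF A]])
    fix p assume "p \<in> ?S"
    then show "fst p \<circ> fst p \<in> ?I"
      by (auto simp: perm_roots_def funpow_2_3 permutes_compose fun_eq_iff)
  qed
  also have "\<dots> = (\<Sum>z\<in>?I. matching_sqrt_count (card A) * matching_cube_root_count (card A))"
  proof (rule sum.cong[OF refl])
    fix z assume z: "z \<in> ?I"
    then have zz: "z \<circ> z = id" and zne: "\<And>x. x \<in> A \<Longrightarrow> x \<noteq> z x"
      by (auto simp: perm_roots_def funpow_2_3)
    have "{p\<in>?S. fst p \<circ> fst p = z} = perm_roots (\<lambda>_ _. True) 2 z A \<times> perm_roots (\<lambda>_ _. True) 3 z A"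
    proof (intro equalityI subsetI)
      fix p assume "p \<in> {p\<in>?S. fst p \<circ> fst p = z}"
      then show "p \<in> perm_roots (\<lambda>_ _. True) 2 z A \<times> perm_roots (\<lambda>_ _. True) 3 z A"
        by (auto simp: perm_roots_def funpow_2_3)
    next
      fix p assume "p \<in> perm_roots (\<lambda>_ _. True) 2 z A \<times> perm_roots (\<lambda>_ _. True) 3 z A"
      then obtain a b where ab: "p = (a, b)" "a permutes A" "b permutes A" "a \<circ> a = z" "b \<circ> b \<circ> b = z"
        by (auto simp: perm_roots_def funpow_2_3)
      have "a (a x) \<noteq> x" if "x \<in> A" for x
        using zne[OF that] fun_cong[OF ab(4), of x] by simp
      then show "p \<in> {p\<in>?S. fst p \<circ> fst p = z}"
        using ab zz by simp
    qed
    then show "card {p\<in>?S. fst p \<circ> fst p = z} = matching_sqrt_count (card A) * matching_cube_root_count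
        (card A)"
      using card_sqrt_matching[OF A z] card_cube_root_matching[OF A z] by (simp add: card_cartesian_product)
  qed
  also have "\<dots> = hQ (card A)" using card_fixpoint_free_involutions[OF A] by simp
  finally show "card (actions SL2Z (- even_subgroups) A) = hQ (card A)" .
qed

definition subgroup_count_in :: "(int ^ 2 ^ 2) set set \<Rightarrow> nat \<Rightarrow> nat" where
  "subgroup_count_in F n = card {H\<in>F. subgroup H SL2Z \<and> card (rcosets\<^bsub>SL2Z\<^esub> H) = n}"

lemma subgroup_count_in_recurrence:
  "hP (Suc n) = (\<Sum>k\<le>n. (n choose k) * (fact k * subgroup_count_in even_subgroups (Suc k) * hP (n - k)))"
  "hQ (Suc n) = (\<Sum>k\<le>n. (n choose k) * (fact k * subgroup_count_in (- even_subgroups) (Suc k) * hQ (n - k)))"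
  "subgroup_count SL2Z (Suc n) = subgroup_count_in even_subgroups (Suc n)
      + subgroup_count_in (- even_subgroups) (Suc n)"
proof -
  interpret group SL2Z by (rule group_SL2Z)
  have conj: "(\<lambda>h. g \<otimes>\<^bsub>SL2Z\<^esub> h \<otimes>\<^bsub>SL2Z\<^esub> inv\<^bsub>SL2Z\<^esub> g) ` H \<in> even_subgroups"
    if "H \<in> even_subgroups" "g \<in> carrier SL2Z" for H g
    using conjugate_mem_iff that by blast
  have conj': "(\<lambda>h. g \<otimes>\<^bsub>SL2Z\<^esub> h \<otimes>\<^bsub>SL2Z\<^esub> inv\<^bsub>SL2Z\<^esub> g) ` H \<in> - even_subgroups"
    if "H \<in> - even_subgroups" "g \<in> carrier SL2Z" for H g
    using conjugate_mem_iff that by blast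
  have recP: "hP (Suc n) = (\<Sum>k\<le>n. (n choose k) * (fact k *
      card {H\<in>even_subgroups. subgroup H SL2Z \<and> card (rcosets\<^bsub>SL2Z\<^esub> H) = Suc k} * hP (n - k)))"
    by (rule card_actions_recurrence(1)[where h = hP and F = "even_subgroups", OF _ _ _ infinite_UNIV_nat])
      (erule card_actions_even | erule (1) conj)+
  \<comment> \<open>Finiteness of both sets keeps \<open>card\<close> away from its default value 0
    and makes it additive on the union below.\<close>
  have finP: "finite {H\<in>even_subgroups. subgroup H SL2Z \<and> card (rcosets\<^bsub>SL2Z\<^esub> H) = Suc n}"
    by (rule card_actions_recurrence(2)[where h = hP and F = "even_subgroups", OF _ _ _ infinite_UNIV_nat])
      (erule card_actions_even | erule (1) conj)+
  have recQ: "hQ (Suc n) = (\<Sum>k\<le>n. (n choose k) * (fact k *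
      card {H\<in>- even_subgroups. subgroup H SL2Z \<and> card (rcosets\<^bsub>SL2Z\<^esub> H) = Suc k} * hQ (n - k)))"
    by (rule card_actions_recurrence(1)[where h = hQ and F = "- even_subgroups", OF _ _ _ infinite_UNIV_nat])
      (erule card_actions_odd | erule (1) conj')+
  have finQ: "finite {H\<in>- even_subgroups. subgroup H SL2Z \<and> card (rcosets\<^bsub>SL2Z\<^esub> H) = Suc n}"
    by (rule card_actions_recurrence(2)[where h = hQ and F = "- even_subgroups", OF _ _ _ infinite_UNIV_nat])
      (erule card_actions_odd | erule (1) conj')+
  show "hP (Suc n) = (\<Sum>k\<le>n. (n choose k) * (fact k * subgroup_count_in even_subgroups (Suc k) * hP (n - k)))"
    unfolding subgroup_count_in_def by (rule recP)
  show "hQ (Suc n) = (\<Sum>k\<le>n. (n choose k) * (fact k * subgroup_count_in (- even_subgroups) (Suc k) * hQ (n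
      - k)))"
    unfolding subgroup_count_in_def by (rule recQ)
  have "{H. subgroup H SL2Z \<and> card (rcosets\<^bsub>SL2Z\<^esub> H) = Suc n} =
      {H\<in>even_subgroups. subgroup H SL2Z \<and> card (rcosets\<^bsub>SL2Z\<^esub> H) = Suc n} \<union>
      {H\<in>- even_subgroups. subgroup H SL2Z \<and> card (rcosets\<^bsub>SL2Z\<^esub> H) = Suc n}"
    by auto
  then show "subgroup_count SL2Z (Suc n) = subgroup_count_in even_subgroups (Suc n)
      + subgroup_count_in (- even_subgroups) (Suc n)"
    unfolding subgroup_count_def subgroup_count_in_def
    by (simp only:) (rule card_Un_disjoint[OF finP finQ], auto)
qed

text \<open>Multiplication by a power of z only shifts coefficients, so a congruence of Laurent
  series can be checked after the denominators have been cleared.\<close>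

lemma fls_cong_of_fps:
  assumes R: "fls_X ^ m * R = fps_to_fls g" and S: "8 dvd g - fps_X ^ m * f"
  shows "fls_cong (fps_to_fls f) R 8"
  unfolding fls_cong_def
proof
  fix k
  have shift: "fls_nth h k = fls_nth (fls_X ^ m * h) (k + int m)" for h :: "int fls"
    by (simp add: fls_X_power_times_conv_shift)
  have S': "fls_X ^ m * fps_to_fls f = fps_to_fls (fps_X ^ m * f)"
    by (simp add: fls_times_fps_to_fls fps_to_fls_power)
  have "8 dvd fps_nth g n - fps_nth (fps_X ^ m * f) n" for n
    using S unfolding numeral_dvd_fps_iff by (metis fps_sub_nth)
  then have "8 dvd fls_nth R k - fls_nth (fps_to_fls f) k"
    unfolding shift[of R] shift[of "fps_to_fls f"] R S' by simp
  then show "[fls_nth (fps_to_fls f) k = fls_nth R k] (mod 8)"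
    by (simp add: cong_iff_dvd_diff dvd_diff_commute)
qed

theorem theorem26:
  shows "fls_cong
    (fps_to_fls (Abs_fps (\<lambda>n. int (subgroup_count SL2Z (n + 1)))))
    (4 * fls_X ^ 20 + 4 * fls_X ^ 17 + 4 * fls_X ^ 14 + 4 * fls_X ^ 12 + 4 * fls_X ^ 10 +
     4 * fls_X ^ 9 + 6 * fls_X ^ 8 + 4 * fls_X ^ 5 + 6 * fls_X ^ 4 + 4 * fls_X ^ 2 +
     4 * fls_X + 6 + 7 * fls_X_inv ^ 2 + 3 * fls_X_inv ^ 3 + 6 * fls_X_inv ^ 6 +
     6 * fls_X_inv ^ 7 + 4 * fls_X_inv ^ 8 + fls_X_inv ^ 9 + 3 * fls_X_inv ^ 11 + 6 * fls_X_inv ^ 12 +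
     (4 * fls_X ^ 3 + 4 * fls_X ^ 2 + 4 * fls_X_inv + 6 * fls_X_inv ^ 3 + 6 * fls_X_inv ^ 4 +
      6 * fls_X_inv ^ 6 + 2 * fls_X_inv ^ 7 + 4 * fls_X_inv ^ 8 + 4 * fls_X_inv ^ 9 + 4 * fls_X_inv ^ 10 +
      6 * fls_X_inv ^ 12 + 2 * fls_X_inv ^ 13) * Phi +
     (4 * fls_X ^ 8 + 4 * fls_X ^ 4 + 4 * fls_X ^ 3 + 6 * fls_X ^ 2 + 4 +
      4 * fls_X_inv + 6 * fls_X_inv ^ 2 + 2 * fls_X_inv ^ 3 + 5 * fls_X_inv ^ 4 + 2 * fls_X_inv ^ 5 +
      6 * fls_X_inv ^ 6 + fls_X_inv ^ 7 + 4 * fls_X_inv ^ 8 + 6 * fls_X_inv ^ 9 + 4 * fls_X_inv ^ 10 +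
      6 * fls_X_inv ^ 11 + 6 * fls_X_inv ^ 12 + 5 * fls_X_inv ^ 13) * Phi ^ 2 +
     (4 * fls_X ^ 2 + 4 * fls_X_inv ^ 2 + 4 * fls_X_inv ^ 3 + 2 * fls_X_inv ^ 4 + 4 * fls_X_inv ^ 5 +
      4 * fls_X_inv ^ 6 + 2 * fls_X_inv ^ 7 + 4 * fls_X_inv ^ 9 + 4 * fls_X_inv ^ 11 + 4 * fls_X_inv ^ 12 +
      2 * fls_X_inv ^ 13) * Phi ^ 3)
    8"
proof -
  define SP where "SP = Abs_fps (\<lambda>n. int (subgroup_count_in even_subgroups (Suc n)))"
  define SQ where "SQ = Abs_fps (\<lambda>n. int (subgroup_count_in (- even_subgroups) (Suc n)))"
  have pow8: "(2::nat) ^ 3 = 8" and pow16: "(2::nat) ^ 4 = 16" by simp_all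
  obtain e r u v where e: "fps_X ^ 8 * Phi_tail 3 ^ 2 = 2 * e - Phi_tail 3 - 1"
    "fps_X ^ 8 * e ^ 2 = e - 1 - fps_X ^ 8 * Phi_tail 3 + fps_X ^ 8 + 2 * r"
    "fps_theta (Phi_tail 3) = 8 * u" "fps_theta e = 4 * v"
    by (rule Phi_tail_relations[of 3, unfolded pow8, OF order_refl]) (blast intro: that)
  obtain e' r' u' v' where e': "fps_X ^ 16 * Phi_tail 4 ^ 2 = 2 * e' - Phi_tail 4 - 1"
    "fps_X ^ 16 * e' ^ 2 = e' - 1 - fps_X ^ 16 * Phi_tail 4 + fps_X ^ 16 + 2 * r'"
    "fps_theta (Phi_tail 4) = 8 * u'" "fps_theta e' = 4 * v'"
    by (rule Phi_tail_relations[of 4, unfolded pow16]) (simp, blast intro: that)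
  have tail: "Phi_tail 3 = 1 + fps_X ^ 8 * Phi_tail 4"
    using Phi_tail_Suc[of 3] by simp
  \<comment> \<open>The two tails differ by one term of \<Phi>. Inserting this into the quadratic
    relation for k = 4 and reducing with the one for k = 3 expresses \<open>e'\<close> through
    \<open>e\<close>, so a single pair of series suffices.\<close>
  have "2 * (fps_X ^ 8 * e') = 2 * (e - 1 - fps_X ^ 8 * Phi_tail 3 + fps_X ^ 8)"
    using e(1) e'(1) unfolding tail by algebra
  then have ee': "fps_X ^ 8 * e' = e - 1 - fps_X ^ 8 * Phi_tail 3 + fps_X ^ 8"
    by (rule iffD1[OF mult_left_cancel, rotated]) simp
  have P: "8 dvd SP - P_solution fps_X (Phi_tail 3) e"
    by (rule P_series_mod_8[OF _ e]) (use P_riccati[OF subgroup_count_in_recurrence(1)] in \<open>simp only: SP_def\<close>)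
  have Q: "8 dvd fps_X * SQ - Q_solution fps_X (Phi_tail 4) e'"
    by (rule Q_series_mod_8[OF _ e']) (use Q_riccati[OF subgroup_count_in_recurrence(2)] in \<open>simp only: SQ_def\<close>)
  have S: "Abs_fps (\<lambda>n. int (subgroup_count SL2Z (n + 1))) = SP + SQ"
    by (simp add: fps_eq_iff SP_def SQ_def subgroup_count_in_recurrence(3))
  have X_inv: "fls_X * fls_X_inv = (1 :: int fls)"
    by (simp add: fls_X_times_conv_shift(1))
  show ?thesis
    unfolding S Phi_def
  proof (rule fls_cong_of_fps)
    show "fls_X ^ 13 * (4 * fls_X ^ 20 + 4 * fls_X ^ 17 + 4 * fls_X ^ 14 + 4 * fls_X ^ 12 + 4 * fls_X ^ 10 +
     4 * fls_X ^ 9 + 6 * fls_X ^ 8 + 4 * fls_X ^ 5 + 6 * fls_X ^ 4 + 4 * fls_X ^ 2 +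
     4 * fls_X + 6 + 7 * fls_X_inv ^ 2 + 3 * fls_X_inv ^ 3 + 6 * fls_X_inv ^ 6 +
     6 * fls_X_inv ^ 7 + 4 * fls_X_inv ^ 8 + fls_X_inv ^ 9 + 3 * fls_X_inv ^ 11 + 6 * fls_X_inv ^ 12 +
     (4 * fls_X ^ 3 + 4 * fls_X ^ 2 + 4 * fls_X_inv + 6 * fls_X_inv ^ 3 + 6 * fls_X_inv ^ 4 +
      6 * fls_X_inv ^ 6 + 2 * fls_X_inv ^ 7 + 4 * fls_X_inv ^ 8 + 4 * fls_X_inv ^ 9 + 4 * fls_X_inv ^ 10 +
      6 * fls_X_inv ^ 12 + 2 * fls_X_inv ^ 13) * fps_to_fls Phi_fps +
     (4 * fls_X ^ 8 + 4 * fls_X ^ 4 + 4 * fls_X ^ 3 + 6 * fls_X ^ 2 + 4 +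
      4 * fls_X_inv + 6 * fls_X_inv ^ 2 + 2 * fls_X_inv ^ 3 + 5 * fls_X_inv ^ 4 + 2 * fls_X_inv ^ 5 +
      6 * fls_X_inv ^ 6 + fls_X_inv ^ 7 + 4 * fls_X_inv ^ 8 + 6 * fls_X_inv ^ 9 + 4 * fls_X_inv ^ 10 +
      6 * fls_X_inv ^ 11 + 6 * fls_X_inv ^ 12 + 5 * fls_X_inv ^ 13) * fps_to_fls Phi_fps ^ 2 +
     (4 * fls_X ^ 2 + 4 * fls_X_inv ^ 2 + 4 * fls_X_inv ^ 3 + 2 * fls_X_inv ^ 4 + 4 * fls_X_inv ^ 5 +
      4 * fls_X_inv ^ 6 + 2 * fls_X_inv ^ 7 + 4 * fls_X_inv ^ 9 + 4 * fls_X_inv ^ 11 + 4 * fls_X_inv ^ 12 +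
      2 * fls_X_inv ^ 13) * fps_to_fls Phi_fps ^ 3) = fps_to_fls ((6 * fps_X + 3 * fps_X ^ 2 + fps_X ^ 4
      + 4 * fps_X ^ 5 + 6 * fps_X ^ 6 + 6 * fps_X ^ 7 + 3 * fps_X ^ 10 + 7 * fps_X ^ 11
        + 6 * fps_X ^ 13 + 4 * fps_X ^ 14 + 4 * fps_X ^ 15 + 6 * fps_X ^ 17 + 4 * fps_X ^ 18
        + 6 * fps_X ^ 21 + 4 * fps_X ^ 22
        + 4 * fps_X ^ 23 + 4 * fps_X ^ 25 + 4 * fps_X ^ 27 + 4 * fps_X ^ 30 + 4 * fps_X ^ 33)
      + (2 + 6 * fps_X + 4 * fps_X ^ 3 + 4 * fps_X ^ 4 + 4 * fps_X ^ 5 + 2 * fps_X ^ 6 + 6 * fps_X ^ 7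
      + 6 * fps_X ^ 9 + 6 * fps_X ^ 10
        + 4 * fps_X ^ 12 + 4 * fps_X ^ 15 + 4 * fps_X ^ 16) * Phi_fps
      + (5 + 6 * fps_X + 6 * fps_X ^ 2 + 4 * fps_X ^ 3 + 6 * fps_X ^ 4 + 4 * fps_X ^ 5 + fps_X ^ 6
      + 6 * fps_X ^ 7 + 2 * fps_X ^ 8
        + 5 * fps_X ^ 9 + 2 * fps_X ^ 10 + 6 * fps_X ^ 11 + 4 * fps_X ^ 12 + 4 * fps_X ^ 13
        + 6 * fps_X ^ 15 + 4 * fps_X ^ 16
        + 4 * fps_X ^ 17 + 4 * fps_X ^ 21) * Phi_fps ^ 2
      + (2 + 4 * fps_X + 4 * fps_X ^ 2 + 4 * fps_X ^ 4 + 2 * fps_X ^ 6 + 4 * fps_X ^ 7 + 4 * fps_X ^ 8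
      + 2 * fps_X ^ 9 + 4 * fps_X ^ 10
        + 4 * fps_X ^ 11 + 4 * fps_X ^ 15) * Phi_fps ^ 3)"
      by (subst laurent_clear_denominators[OF X_inv])
        (simp add: fls_times_fps_to_fls fps_to_fls_power)
    define g where "g = ((6 * fps_X + 3 * fps_X ^ 2 + fps_X ^ 4 + 4 * fps_X ^ 5 + 6 * fps_X ^ 6
        + 6 * fps_X ^ 7 + 3 * fps_X ^ 10 + 7 * fps_X ^ 11
        + 6 * fps_X ^ 13 + 4 * fps_X ^ 14 + 4 * fps_X ^ 15 + 6 * fps_X ^ 17 + 4 * fps_X ^ 18
        + 6 * fps_X ^ 21 + 4 * fps_X ^ 22
        + 4 * fps_X ^ 23 + 4 * fps_X ^ 25 + 4 * fps_X ^ 27 + 4 * fps_X ^ 30 + 4 * fps_X ^ 33)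
      + (2 + 6 * fps_X + 4 * fps_X ^ 3 + 4 * fps_X ^ 4 + 4 * fps_X ^ 5 + 2 * fps_X ^ 6 + 6 * fps_X ^ 7
      + 6 * fps_X ^ 9 + 6 * fps_X ^ 10
        + 4 * fps_X ^ 12 + 4 * fps_X ^ 15 + 4 * fps_X ^ 16) * Phi_fps
      + (5 + 6 * fps_X + 6 * fps_X ^ 2 + 4 * fps_X ^ 3 + 6 * fps_X ^ 4 + 4 * fps_X ^ 5 + fps_X ^ 6
      + 6 * fps_X ^ 7 + 2 * fps_X ^ 8
        + 5 * fps_X ^ 9 + 2 * fps_X ^ 10 + 6 * fps_X ^ 11 + 4 * fps_X ^ 12 + 4 * fps_X ^ 13
        + 6 * fps_X ^ 15 + 4 * fps_X ^ 16
        + 4 * fps_X ^ 17 + 4 * fps_X ^ 21) * Phi_fps ^ 2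
      + (2 + 4 * fps_X + 4 * fps_X ^ 2 + 4 * fps_X ^ 4 + 2 * fps_X ^ 6 + 4 * fps_X ^ 7 + 4 * fps_X ^ 8
      + 2 * fps_X ^ 9 + 4 * fps_X ^ 10
        + 4 * fps_X ^ 11 + 4 * fps_X ^ 15) * Phi_fps ^ 3)"
    let ?P = "P_solution fps_X (Phi_tail 3) e" and ?Q = "Q_solution fps_X (Phi_tail 4) e'"
    have "8 dvd g - (fps_X ^ 13 * ?P + fps_X ^ 12 * ?Q)"
      unfolding g_def by (rule solution_sum[OF e(1) _ ee' Phi_fps_eq_tail]) (simp add: tail)
    \<comment> \<open>Subtracting the weighted congruences for the two series replaces the explicit
      solutions by the subgroup series.\<close>
    then have "8 dvd (g - (fps_X ^ 13 * ?P + fps_X ^ 12 * ?Q)) - (fps_X ^ 13 * (SP - ?P)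
        + fps_X ^ 12 * (fps_X * SQ - ?Q))"
      by (rule dvd_diff[OF _ dvd_add[OF dvd_mult[OF P] dvd_mult[OF Q]]])
    also have "\<dots> = g - fps_X ^ 13 * (SP + SQ)"
      by algebra
    finally show "8 dvd ((6 * fps_X + 3 * fps_X ^ 2 + fps_X ^ 4 + 4 * fps_X ^ 5 + 6 * fps_X ^ 6
        + 6 * fps_X ^ 7 + 3 * fps_X ^ 10 + 7 * fps_X ^ 11
        + 6 * fps_X ^ 13 + 4 * fps_X ^ 14 + 4 * fps_X ^ 15 + 6 * fps_X ^ 17 + 4 * fps_X ^ 18
        + 6 * fps_X ^ 21 + 4 * fps_X ^ 22
        + 4 * fps_X ^ 23 + 4 * fps_X ^ 25 + 4 * fps_X ^ 27 + 4 * fps_X ^ 30 + 4 * fps_X ^ 33)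
      + (2 + 6 * fps_X + 4 * fps_X ^ 3 + 4 * fps_X ^ 4 + 4 * fps_X ^ 5 + 2 * fps_X ^ 6 + 6 * fps_X ^ 7
      + 6 * fps_X ^ 9 + 6 * fps_X ^ 10
        + 4 * fps_X ^ 12 + 4 * fps_X ^ 15 + 4 * fps_X ^ 16) * Phi_fps
      + (5 + 6 * fps_X + 6 * fps_X ^ 2 + 4 * fps_X ^ 3 + 6 * fps_X ^ 4 + 4 * fps_X ^ 5 + fps_X ^ 6
      + 6 * fps_X ^ 7 + 2 * fps_X ^ 8
        + 5 * fps_X ^ 9 + 2 * fps_X ^ 10 + 6 * fps_X ^ 11 + 4 * fps_X ^ 12 + 4 * fps_X ^ 13
        + 6 * fps_X ^ 15 + 4 * fps_X ^ 16
        + 4 * fps_X ^ 17 + 4 * fps_X ^ 21) * Phi_fps ^ 2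
      + (2 + 4 * fps_X + 4 * fps_X ^ 2 + 4 * fps_X ^ 4 + 2 * fps_X ^ 6 + 4 * fps_X ^ 7 + 4 * fps_X ^ 8
      + 2 * fps_X ^ 9 + 4 * fps_X ^ 10
        + 4 * fps_X ^ 11 + 4 * fps_X ^ 15) * Phi_fps ^ 3) - fps_X ^ 13 * (SP + SQ)"
      unfolding g_def .
  qed
qed

end
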